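(* Suppose that for each $\ell=1,\dots,n$ the sequence $(v_\ell(j),\rho_\ell(j))_{j\ge1}\subset(0,+\infty)^2$ converges to $(v_\ell,\rho_\ell)\in(0,+\infty)^2$ as $j\to\infty$. Then $A_{v(j),\rho(j)}$ converges to $A_{v,\rho}$ in norm resolvent sense, i.e. $\|(-A_{v(j),\rho(j)}-\kappa^2)^{-1}-(-A_{v,\rho}-\kappa^2)^{-1}\|_{\mathscr B(L^2(\mathbb R^3))}\to0$ for every $\kappa\in\mathbb C_+$.
   Context: Let $\Omega_1,\dots,\Omega_n\subset\mathbb R^3$ be fixed open, bounded, connected Lipschitz domains with pairwise disjoint closures; $\Omega=\bigcup_\ell\Omega_\ell$, $\Gamma_\ell=\partial\Omega_\ell$, $\Omega_{ex}=\mathbb R^3\setminus\overline\Omega$. For constants $v_\ell,\rho_\ell>0$ the acoustic operator $A_{v,\rho}$ has domain $\{u\in H^1(\mathbb R^3):\Delta(u|_\Omega)\in L^2(\Omega),\ \Delta(u|_{\Omega_{ex}})\in L^2(\Omega_{ex}),\ \rho_\ell\gamma^{ex}_{1,\ell}u=\gamma^{in}_{1,\ell}u,\ \ell=1,\dots,n\}$, where $\gamma^{in/ex}_{1,\ell}$ are the Neumann traces on $\Gamma_\ell$ from inside/outside (normal pointing out of $\Omega$), and acts as $\Delta u$ on $\Omega_{ex}$ and $v_\ell^2\Delta u$ on $\Omega_\ell$; $A_{v(j),\rho(j)}$ is the same with $v_\ell(j),\rho_\ell(j)$. All these operators have spectrum in $(-\infty,0]$. *)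

theory Defs
  imports "HOL-Analysis.Analysis"
begin

type_synonym pt = "real^3"

definition L2_on :: "pt set \<Rightarrow> (pt \<Rightarrow> complex) \<Rightarrow> bool" where
  "L2_on S u \<longleftrightarrow> set_borel_measurable lebesgue S u \<and>
     set_integrable lebesgue S (\<lambda>x. (cmod (u x))^2)"

definition L2norm :: "(pt \<Rightarrow> complex) \<Rightarrow> real" where
  "L2norm u = sqrt (LINT x|lebesgue. (cmod (u x))^2)"

definition pd :: "3 \<Rightarrow> (pt \<Rightarrow> real) \<Rightarrow> pt \<Rightarrow> real" where
  "pd i \<phi> x = frechet_derivative \<phi> (at x) (axis i 1)"

definition lap :: "(pt \<Rightarrow> real) \<Rightarrow> pt \<Rightarrow> real" where
  "lap \<phi> x = (\<Sum>i\<in>UNIV. pd i (pd i \<phi>) x)"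

definition test_fun :: "pt set \<Rightarrow> (pt \<Rightarrow> real) \<Rightarrow> bool" where
  "test_fun U \<phi> \<longleftrightarrow> (\<forall>x. \<phi> differentiable (at x)) \<and>
     (\<forall>i x. pd i \<phi> differentiable (at x)) \<and>
     (\<forall>i k. continuous_on UNIV (pd k (pd i \<phi>))) \<and>
     compact (closure {x. \<phi> x \<noteq> 0}) \<and> closure {x. \<phi> x \<noteq> 0} \<subseteq> U"

definition weak_grad :: "pt set \<Rightarrow> (pt \<Rightarrow> complex) \<Rightarrow> (3 \<Rightarrow> pt \<Rightarrow> complex) \<Rightarrow> bool" where
  "weak_grad U u g \<longleftrightarrow> (\<forall>i \<phi>. test_fun U \<phi> \<longrightarrow>
     (LINT x:U|lebesgue. u x * of_real (pd i \<phi> x)) = - (LINT x:U|lebesgue. g i x * of_real (\<phi> x)))"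

definition weak_lap :: "pt set \<Rightarrow> (pt \<Rightarrow> complex) \<Rightarrow> (pt \<Rightarrow> complex) \<Rightarrow> bool" where
  "weak_lap U u h \<longleftrightarrow> (\<forall>\<phi>. test_fun U \<phi> \<longrightarrow>
     (LINT x:U|lebesgue. u x * of_real (lap \<phi> x)) = (LINT x:U|lebesgue. h x * of_real (\<phi> x)))"

text \<open>Neumann trace (w.r.t. the outward normal of U) of u, tested against \<phi>,
  defined via Green's formula: <gamma_1 u, phi> = int_U grad u . grad phi + int_U (Delta u) phi.\<close>
definition neumann_pairing :: "pt set \<Rightarrow> (3 \<Rightarrow> pt \<Rightarrow> complex) \<Rightarrow> (pt \<Rightarrow> complex) \<Rightarrow> (pt \<Rightarrow> real) \<Rightarrow> complex" where
  "neumann_pairing U g h \<phi> =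
     (LINT x:U|lebesgue. (\<Sum>i\<in>UNIV. g i x * of_real (pd i \<phi> x)) + h x * of_real (\<phi> x))"

definition Omega_union :: "nat \<Rightarrow> (nat \<Rightarrow> pt set) \<Rightarrow> pt set" where
  "Omega_union n Om = (\<Union>l\<in>{1..n}. Om l)"

definition Omega_ex :: "nat \<Rightarrow> (nat \<Rightarrow> pt set) \<Rightarrow> pt set" where
  "Omega_ex n Om = - closure (Omega_union n Om)"

definition lipschitz_domain :: "pt set \<Rightarrow> bool" where
  "lipschitz_domain U \<longleftrightarrow> open U \<and>
    (\<forall>p\<in>frontier U. \<exists>(T::pt \<Rightarrow> pt) (r::real) (\<psi>::pt \<Rightarrow> real) (M::real). orthogonal_transformation T \<and> r > 0 \<and>
       M-lipschitz_on UNIV \<psi> \<and>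
       (\<forall>y z. y$1 = z$1 \<and> y$2 = z$2 \<longrightarrow> \<psi> y = \<psi> z) \<and>
       U \<inter> ball p r = {x \<in> ball p r. (T (x - p))$3 < \<psi> (T (x - p))})"

definition acoustic_graph ::
  "nat \<Rightarrow> (nat \<Rightarrow> pt set) \<Rightarrow> (nat \<Rightarrow> real) \<Rightarrow> (nat \<Rightarrow> real) \<Rightarrow> (pt \<Rightarrow> complex) \<Rightarrow> (pt \<Rightarrow> complex) \<Rightarrow> bool" where
  "acoustic_graph n Om v \<rho> u w \<longleftrightarrow>
    L2_on UNIV u \<and> L2_on UNIV w \<and>
    (\<exists>g hex hin.
       (\<forall>i. L2_on UNIV (g i)) \<and> weak_grad UNIV u g \<and>
       L2_on (Omega_ex n Om) hex \<and> weak_lap (Omega_ex n Om) u hex \<and>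
       (\<forall>l\<in>{1..n}. L2_on (Om l) (hin l) \<and> weak_lap (Om l) u (hin l)) \<and>
       (\<forall>l\<in>{1..n}. \<forall>\<phi>. test_fun UNIV \<phi> \<and>
           (\<forall>k\<in>{1..n}. k \<noteq> l \<longrightarrow> closure {x. \<phi> x \<noteq> 0} \<inter> closure (Om k) = {}) \<longrightarrow>
           of_real (\<rho> l) * (- neumann_pairing (Omega_ex n Om) g hex \<phi>)
             = neumann_pairing (Om l) g (hin l) \<phi>) \<and>
       (AE x in lebesgue. x \<in> Omega_ex n Om \<longrightarrow> w x = hex x) \<and>
       (\<forall>l\<in>{1..n}. AE x in lebesgue. x \<in> Om l \<longrightarrow> w x = of_real ((v l)^2) * hin l x))"

definition acoustic_resolvent ::
  "nat \<Rightarrow> (nat \<Rightarrow> pt set) \<Rightarrow> (nat \<Rightarrow> real) \<Rightarrow> (nat \<Rightarrow> real) \<Rightarrow> complex \<Rightarrow> (pt \<Rightarrow> complex) \<Rightarrow> (pt \<Rightarrow> complex)" where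
  "acoustic_resolvent n Om v \<rho> \<kappa> f = (SOME u. \<exists>w. acoustic_graph n Om v \<rho> u w \<and>
       (AE x in lebesgue. - w x - \<kappa>^2 * u x = f x))"

definition L2_opnorm_diff :: "((pt \<Rightarrow> complex) \<Rightarrow> (pt \<Rightarrow> complex)) \<Rightarrow> ((pt \<Rightarrow> complex) \<Rightarrow> (pt \<Rightarrow> complex)) \<Rightarrow> ennreal" where
  "L2_opnorm_diff R S = (SUP f\<in>{f. L2_on UNIV f \<and> L2norm f \<le> 1}. ennreal (L2norm (\<lambda>x. R f x - S f x)))"

end

theory Submission
  imports Defs
begin

text \<open>
  Put \<open>a = b = 1\<close> outside \<open>\<Omega>\<close> and \<open>a = 1/\<rho>\<^sub>l\<close>, \<open>b = 1/(\<rho>\<^sub>l v\<^sub>l\<^sup>2)\<close> in \<open>\<Omega>\<^sub>l\<close>. By Green's formula the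
  transmission condition says that \<open>a \<nabla>u\<close> has no flux jump, so \<open>(-A - \<kappa>\<^sup>2) u = f\<close> is equivalent to
  \<open>\<integral> a \<nabla>u \<sqdot> \<nabla>\<phi> - \<kappa>\<^sup>2 \<integral> b u \<phi> = \<integral> b f \<phi>\<close> for all \<open>\<phi> \<in> H\<^sup>1\<close>; the interfaces are Lipschitz graphs and hence
  null sets. Multiplied by \<open>\<i> \<kappa>\<^sup>*\<close> this form is coercive on \<open>H\<^sup>1\<close>, with a constant depending only on
  \<open>\<kappa>\<close> and a lower bound of \<open>a\<close> and \<open>b\<close>. Lax--Milgram gives the resolvents, and subtracting the
  equations for two sets of coefficients bounds the difference of the solutions by
  \<open>C (\<parallel>a' - a\<parallel>\<^sub>\<infinity> + \<parallel>b' - b\<parallel>\<^sub>\<infinity>) \<parallel>f\<parallel>\<close>.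

  Test functions are dense in \<open>H\<^sup>1\<close>: if \<open>(u, \<nabla>u)\<close> is orthogonal to all of them, then \<open>u\<close> is a weak \<open>L\<^sup>2\<close>
  solution of \<open>\<Delta>u = u\<close>, so its convolution with any test function is a bounded classical solution of
  the same equation and vanishes by the maximum principle.
\<close>

section \<open>Hilbert spaces\<close>

text \<open>The delicate point is regularity. \<open>test_fun\<close> allows all C^2 functions, and
  Green's formula applies the weak gradient to a derivative of the test function, which costs one
  order: a gradient tested with C^2 functions gives the weak form for C^3 functions only, while the
  converse must deliver weak Laplacians and transmission conditions against every C^2 function.
  Density closes the gap. H^1 is encoded as \<open>sobolev\<close>, the closed span in L^2 of the
  pairs (u, gradient) of C^3 test functions; it contains every pair whose gradient is correct
  against C^2 tests, and its members are correct even against C^1 tests. The resolvent is a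
  \<open>SOME\<close> choice. Coercivity makes this harmless: the difference estimate holds for any
  solutions of the two problems, so uniqueness is never a separate step. The transmission condition
  on one interface may be tested only with functions whose support misses the other closed domains;
  a general test function is therefore cut into pieces, one per domain and one supported in the
  exterior.\<close>

lemma parallelogram_law:
  fixes x y :: "'a::real_inner"
  shows "(norm (x + y))\<^sup>2 + (norm (x - y))\<^sup>2 = 2 * (norm x)\<^sup>2 + 2 * (norm y)\<^sup>2"
  by (simp add: power2_norm_eq_inner inner_simps inner_commute)

text \<open>The parallelogram law, applied to two members of a minimising sequence whose midpoint
  again lies in \<open>S\<close>, forces the sequence to be Cauchy; the first variation at its limit
  gives orthogonality.\<close>

lemma closed_subspace_orthogonal_projection:
  fixes S :: "'a::{real_inner,complete_space} set"
  assumes S: "subspace S" "closed S"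
  obtains p where "p \<in> S" "\<And>y. y \<in> S \<Longrightarrow> inner (x - p) y = 0"
proof -
  define d where "d = (INF y\<in>S. (norm (x - y))\<^sup>2)"
  have bdd: "bdd_below ((\<lambda>y. (norm (x - y))\<^sup>2) ` S)" by (rule bdd_belowI2[of _ 0]) simp
  have S0: "0 \<in> S" using S(1) by (simp add: subspace_0)
  have dle: "d \<le> (norm (x - y))\<^sup>2" if "y \<in> S" for y
    unfolding d_def by (rule cINF_lower[OF bdd that])
  have "\<exists>y\<in>S. (norm (x - y))\<^sup>2 < d + 1 / real (Suc k)" for k
    using cINF_less_iff[OF _ bdd, of "d + 1 / real (Suc k)"] S0 unfolding d_def by force
  then obtain s where s: "\<And>k. s k \<in> S" "\<And>k. (norm (x - s k))\<^sup>2 < d + 1 / real (Suc k)" by metis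
  have est: "(norm (s k - s m))\<^sup>2 \<le> 2 / real (Suc k) + 2 / real (Suc m)" for k m
  proof -
    have mid: "(1/2) *\<^sub>R (s k + s m) \<in> S" using S s(1) by (intro subspace_scale subspace_add)
    have e: "(x - s k) + (x - s m) = 2 *\<^sub>R (x - (1/2) *\<^sub>R (s k + s m))"
      by (simp add: algebra_simps scaleR_2)
    have "(norm ((x - s k) + (x - s m)))\<^sup>2 = 4 * (norm (x - (1/2) *\<^sub>R (s k + s m)))\<^sup>2"
      unfolding e norm_scaleR power_mult_distrib by simp
    then have "4 * d \<le> (norm ((x - s k) + (x - s m)))\<^sup>2" using dle[OF mid] by simp
    moreover have "norm ((x - s k) - (x - s m)) = norm (s k - s m)" by (simp add: norm_minus_commute)
    ultimately show ?thesis
      using parallelogram_law[of "x - s k" "x - s m"] s(2)[of k] s(2)[of m] by simp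
  qed
  have "Cauchy s"
  proof (rule metric_CauchyI)
    fix e :: real assume e: "0 < e"
    obtain N where N: "4 / e\<^sup>2 < real N" using reals_Archimedean2 by blast
    have "norm (s k - s m) < e" if "k \<ge> N" "m \<ge> N" for k m
    proof -
      have pos: "0 < real N" using N e by (smt (verit) divide_nonneg_nonneg zero_le_power2)
      have "2 / real (Suc k) \<le> 2 / real N" "2 / real (Suc m) \<le> 2 / real N"
        using that pos by (auto intro!: divide_left_mono mult_pos_pos)
      then have "(norm (s k - s m))\<^sup>2 \<le> 4 / real N" using est[of k m] by simp
      also have "\<dots> < e\<^sup>2" using N pos e by (simp add: field_simps)
      finally show ?thesis using e by (simp add: power2_less_imp_less)
    qed
    then show "\<exists>M. \<forall>m\<ge>M. \<forall>n\<ge>M. dist (s m) (s n) < e" by (auto simp: dist_norm)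
  qed
  then obtain p where p: "s \<longlonglongrightarrow> p" using Cauchy_convergent convergent_def by blast
  have pS: "p \<in> S" using closed_sequentially[OF S(2)] s(1) p by blast
  have "(norm (x - p))\<^sup>2 \<le> d"
  proof (rule LIMSEQ_le)
    show "(\<lambda>k. (norm (x - s k))\<^sup>2) \<longlonglongrightarrow> (norm (x - p))\<^sup>2" by (intro tendsto_intros p)
    show "(\<lambda>k. d + 1 / real (Suc k)) \<longlonglongrightarrow> d"
      using tendsto_add[OF tendsto_const LIMSEQ_inverse_real_of_nat, of d] by (simp add: inverse_eq_divide)
    show "\<exists>N. \<forall>k\<ge>N. (norm (x - s k))\<^sup>2 \<le> d + 1 / real (Suc k)" using s(2) less_imp_le by blast
  qed
  then have min: "(norm (x - p))\<^sup>2 \<le> (norm (x - y))\<^sup>2" if "y \<in> S" for y using dle[OF that] by (rule order_trans)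
  have "inner (x - p) y = 0" if y: "y \<in> S" for y
  proof (cases "y = 0")
    case False
    \<comment> \<open>This \<open>t\<close> minimises the norm of x - p - t y; the squared norm
      drops by inner(x - p, y)^2 / |y|^2, which minimality of \<open>p\<close> forbids unless it is
      0.\<close>
    define t where "t = inner (x - p) y / (norm y)\<^sup>2"
    have "p + t *\<^sub>R y \<in> S" using S pS y by (intro subspace_add subspace_scale)
    from min[OF this] have "(norm (x - p))\<^sup>2 \<le> (norm ((x - p) - t *\<^sub>R y))\<^sup>2" by (simp add: algebra_simps)
    also have "\<dots> = (norm (x - p))\<^sup>2 - 2 * t * inner (x - p) y + t\<^sup>2 * (norm y)\<^sup>2"
      by (simp only: power2_norm_eq_inner inner_diff_left inner_diff_right inner_scaleR_left inner_scaleR_right)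
         (simp add: inner_commute algebra_simps power2_eq_square)
    also have "\<dots> = (norm (x - p))\<^sup>2 - (inner (x - p) y)\<^sup>2 / (norm y)\<^sup>2"
      using False by (simp add: t_def field_simps power2_eq_square)
    finally have "(inner (x - p) y)\<^sup>2 / (norm y)\<^sup>2 \<le> 0" by simp
    then show ?thesis using False by (simp add: divide_le_0_iff)
  qed simp
  with pS that show thesis by blast
qed

text \<open>The part of a vector of \<open>T\<close> orthogonal to \<open>S\<close> stays in
  \<open>T\<close>, because its projection lies in \<open>S\<close> and \<open>S\<close> is
  contained in \<open>T\<close>. This yields density of test functions without
  mollification.\<close>

lemma dense_if_orthogonal_trivial:
  fixes S :: "'a::{real_inner,complete_space} set"
  assumes "subspace S" "closed S" "subspace T" "S \<subseteq> T"
    and "\<And>x. x \<in> T \<Longrightarrow> (\<And>y. y \<in> S \<Longrightarrow> inner x y = 0) \<Longrightarrow> x = 0"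
  shows "T \<subseteq> S"
proof
  fix x assume x: "x \<in> T"
  obtain p where p: "p \<in> S" "\<And>y. y \<in> S \<Longrightarrow> inner (x - p) y = 0"
    using closed_subspace_orthogonal_projection assms(1,2) by blast
  have "x - p \<in> T" using x p(1) assms(3,4) by (auto intro: subspace_diff)
  then have "x - p = 0" using assms(5) p(2) by blast
  then show "x \<in> S" using p(1) by simp
qed

text \<open>The map \<open>x \<mapsto> x - t P (A x - f)\<close>, with \<open>P\<close> the orthogonal projection onto \<open>S\<close>, is a
  contraction of \<open>S\<close> for small \<open>t\<close>.\<close>
lemma lax_milgram_closed_subspace:
  fixes S :: "'a::{real_inner,complete_space} set" and A :: "'a \<Rightarrow> 'a"
  assumes S: "subspace S" "closed S" and A: "bounded_linear A"
    and c: "0 < c" and coercive: "\<And>x. x \<in> S \<Longrightarrow> c * (norm x)\<^sup>2 \<le> inner (A x) x"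
  shows "\<exists>x\<in>S. \<forall>y\<in>S. inner (A x - f) y = 0"
proof -
  interpret A: bounded_linear A by (rule A)
  have "\<exists>p\<in>S. \<forall>y\<in>S. inner (x - p) y = 0" for x
    by (rule closed_subspace_orthogonal_projection[OF S, of x]) blast
  then obtain P where P: "\<And>x. P x \<in> S" "\<And>x y. y \<in> S \<Longrightarrow> inner (x - P x) y = 0"
    by metis
  have Pin: "inner (P x) y = inner x y" if "y \<in> S" for x y
    using P(2)[OF that, of x] by (simp add: inner_diff_left)
  have Pdiff: "norm (P x - P y) \<le> norm (x - y)" for x y
  proof -
    have m: "P x - P y \<in> S" using P S by (intro subspace_diff)
    have "(norm (P x - P y))\<^sup>2 = inner (x - y) (P x - P y)"
      unfolding power2_norm_eq_inner using Pin[OF m] by (simp add: inner_diff_left)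
    also have "\<dots> \<le> norm (x - y) * norm (P x - P y)" by (rule norm_cauchy_schwarz)
    finally show ?thesis by (cases "P x = P y") (simp_all add: power2_eq_square mult_le_cancel_right)
  qed
  obtain K where K: "0 < K" "\<And>x. norm (A x) \<le> norm x * K" using A.pos_bounded by blast
  \<comment> \<open>With this size t^2 K^2 <= t c, so the squared contraction factor 1 - 2 t c + t^2
    K^2 is at most 1 - t c. The extra c^2 in the denominator keeps t c < 1, so that \<open>q\<close>
    is the root of a positive number.\<close>
  define t where "t = c / (K\<^sup>2 + c\<^sup>2)"
  define q where "q = sqrt (1 - t * c)"
  have Kc: "0 < K\<^sup>2 + c\<^sup>2" using K(1) by (simp add: add_pos_nonneg)
  then have t: "0 < t" using c by (simp add: t_def)
  have tc: "t * c < 1" using K(1) Kc by (simp add: t_def power2_eq_square)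
  have tK: "t\<^sup>2 * K\<^sup>2 \<le> t * c"
  proof -
    have "t * K\<^sup>2 \<le> t * (K\<^sup>2 + c\<^sup>2)" using t by simp
    also have "\<dots> = c" using Kc by (simp add: t_def)
    finally show ?thesis using t by (simp add: power2_eq_square mult.assoc mult_left_mono)
  qed
  have q: "0 \<le> q" "q < 1" using tc t c by (simp_all add: q_def)
  define G where "G x = x - t *\<^sub>R P (A x - f)" for x
  have "\<exists>!x\<in>S. G x = x"
  proof (rule Banach_fix[OF _ _ q])
    show "complete S" using S(2) by (simp add: complete_eq_closed)
    show "S \<noteq> {}" using S(1) subspace_0 by blast
    show "G ` S \<subseteq> S" using S P unfolding G_def by (auto intro!: subspace_diff subspace_scale)
    fix x y assume xy: "x \<in> S" "y \<in> S"
    define z where "z = x - y"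
    define w where "w = P (A x - f) - P (A y - f)"
    have z: "z \<in> S" using xy S by (simp add: z_def subspace_diff)
    have Az: "A x - f - (A y - f) = A z" by (simp add: z_def A.diff)
    have w1: "norm w \<le> K * norm z"
      using Pdiff[of "A x - f" "A y - f"] K(2)[of z] unfolding w_def Az by (simp add: mult.commute)
    have w2: "inner w z = inner (A z) z"
      unfolding w_def inner_diff_left Pin[OF z] Az[symmetric] by (simp add: inner_diff_left)
    have "(norm (z - t *\<^sub>R w))\<^sup>2 = (norm z)\<^sup>2 - 2 * t * inner w z + t\<^sup>2 * (norm w)\<^sup>2"
      by (simp only: power2_norm_eq_inner inner_diff_left inner_diff_right inner_scaleR_left inner_scaleR_right)
         (simp add: inner_commute algebra_simps power2_eq_square)
    also have "\<dots> \<le> (norm z)\<^sup>2 - 2 * t * (c * (norm z)\<^sup>2) + t\<^sup>2 * (K * norm z)\<^sup>2"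
      using coercive[OF z] w2 t w1 by (intro add_mono diff_mono mult_left_mono power_mono) auto
    also have "\<dots> = (norm z)\<^sup>2 * (1 - 2 * (t * c) + t\<^sup>2 * K\<^sup>2)" by (simp add: algebra_simps)
    also have "\<dots> \<le> (norm z)\<^sup>2 * (1 - t * c)" using tK by (intro mult_left_mono) (auto simp: mult.commute)
    also have "\<dots> = (q * norm z)\<^sup>2" using tc by (simp add: q_def power_mult_distrib)
    finally have "norm (z - t *\<^sub>R w) \<le> q * norm z" by (rule power2_le_imp_le) (simp add: q)
    moreover have "G x - G y = z - t *\<^sub>R w" by (simp add: G_def z_def w_def algebra_simps)
    ultimately show "dist (G x) (G y) \<le> q * dist x y" by (simp add: dist_norm z_def)
  qed
  then obtain x where x: "x \<in> S" "G x = x" by blast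
  then have "P (A x - f) = 0" using t by (simp add: G_def)
  then have "inner (A x - f) y = 0" if "y \<in> S" for y using Pin[OF that, of "A x - f"] by simp
  with x(1) show ?thesis by blast
qed

text \<open>Subtract the two equations and test with x' - x; coercivity of \<open>A'\<close> then
  absorbs one factor |x' - x|. The bound measures how far a solution moves when operator and data
  are both perturbed; with A = A', x = 0 and f = 0 it is the a priori estimate.\<close>

lemma coercive_solution_difference:
  fixes x x' :: "'a::real_inner"
  assumes "c > 0" and coercive: "c * (norm (x' - x))\<^sup>2 \<le> inner (A' (x' - x)) (x' - x)"
    and A': "bounded_linear A'"
    and eq: "inner (A x - f) (x' - x) = 0" "inner (A' x' - f') (x' - x) = 0"
  shows "c * norm (x' - x) \<le> norm (f' - f) + norm (A' x - A x)"
proof -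
  interpret bounded_linear A' by (rule A')
  have "c * (norm (x' - x))\<^sup>2 \<le> inner ((f' - f) - (A' x - A x)) (x' - x)"
    using coercive eq by (simp add: diff inner_diff_left)
  also have "\<dots> \<le> norm ((f' - f) - (A' x - A x)) * norm (x' - x)" by (rule norm_cauchy_schwarz)
  also have "\<dots> \<le> (norm (f' - f) + norm (A' x - A x)) * norm (x' - x)"
    by (intro mult_right_mono norm_triangle_ineq4) simp
  finally have "(c * norm (x' - x)) * norm (x' - x) \<le> (norm (f' - f) + norm (A' x - A x)) * norm (x' - x)"
    by (simp add: power2_eq_square mult.assoc)
  then show ?thesis by (cases "x' = x") (simp_all add: mult_le_cancel_right)
qed

section \<open>Square-integrable functions modulo null sets\<close>

definition sq_integrable :: "('a::euclidean_space \<Rightarrow> 'b::euclidean_space) \<Rightarrow> bool" where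
  "sq_integrable f \<longleftrightarrow> f \<in> borel_measurable lebesgue \<and> integrable lebesgue (\<lambda>x. (norm (f x))\<^sup>2)"

lemma sq_integrable_measurable [measurable_dest]:
  "sq_integrable f \<Longrightarrow> f \<in> borel_measurable lebesgue"
  by (simp add: sq_integrable_def)

lemma sq_integrable_bound:
  assumes g: "sq_integrable g" and f: "f \<in> borel_measurable lebesgue"
    and le: "AE x in lebesgue. norm (f x) \<le> C * norm (g x)"
  shows "sq_integrable f"
proof -
  have "integrable lebesgue (\<lambda>x. (norm (f x))\<^sup>2)"
  proof (rule Bochner_Integration.integrable_bound)
    show "integrable lebesgue (\<lambda>x. C\<^sup>2 * (norm (g x))\<^sup>2)"
      using g by (simp add: sq_integrable_def)
    show "AE x in lebesgue. norm ((norm (f x))\<^sup>2) \<le> norm (C\<^sup>2 * (norm (g x))\<^sup>2)"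
      using le
    proof eventually_elim
      case (elim x)
      then have "(norm (f x))\<^sup>2 \<le> (C * norm (g x))\<^sup>2" by (intro power_mono) auto
      then show ?case by (simp add: power_mult_distrib)
    qed
  qed (use f in measurable)
  with f show ?thesis by (simp add: sq_integrable_def)
qed

lemma sq_integrable_inner:
  assumes "sq_integrable f" "sq_integrable g"
  shows "integrable lebesgue (\<lambda>x. inner (f x) (g x))"
proof (rule Bochner_Integration.integrable_bound)
  have [measurable]: "f \<in> borel_measurable lebesgue" "g \<in> borel_measurable lebesgue"
    using assms by (simp_all add: sq_integrable_def)
  show "integrable lebesgue (\<lambda>x. (norm (f x))\<^sup>2 + (norm (g x))\<^sup>2)"
    using assms by (simp add: sq_integrable_def)
  have "\<bar>inner (f x) (g x)\<bar> \<le> (norm (f x))\<^sup>2 + (norm (g x))\<^sup>2" for x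
  proof -
    have "\<bar>inner (f x) (g x)\<bar> \<le> norm (f x) * norm (g x)" by (rule Cauchy_Schwarz_ineq2)
    also have "\<dots> \<le> (norm (f x))\<^sup>2 + (norm (g x))\<^sup>2"
      using sum_squares_bound[of "norm (f x)" "norm (g x)"] mult_nonneg_nonneg[OF norm_ge_zero norm_ge_zero, of "f x" "g x"]
      unfolding mult.assoc by linarith
    finally show ?thesis .
  qed
  then show "AE x in lebesgue. norm (inner (f x) (g x)) \<le> norm ((norm (f x))\<^sup>2 + (norm (g x))\<^sup>2)" by simp
  show "(\<lambda>x. inner (f x) (g x)) \<in> borel_measurable lebesgue" by measurable
qed

lemma sq_integrable_add:
  assumes "sq_integrable f" "sq_integrable g"
  shows "sq_integrable (\<lambda>x. f x + g x)"
proof -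
  have [measurable]: "f \<in> borel_measurable lebesgue" "g \<in> borel_measurable lebesgue"
    using assms by (simp_all add: sq_integrable_def)
  have "integrable lebesgue (\<lambda>x. (norm (f x))\<^sup>2 + 2 * inner (f x) (g x) + (norm (g x))\<^sup>2)"
    using assms sq_integrable_inner[OF assms] by (simp add: sq_integrable_def)
  moreover have "(norm (f x + g x))\<^sup>2 = (norm (f x))\<^sup>2 + 2 * inner (f x) (g x) + (norm (g x))\<^sup>2" for x
    by (simp add: power2_norm_eq_inner inner_simps inner_commute)
  ultimately show ?thesis by (simp add: sq_integrable_def)
qed

lemma sq_integrable_scaleR:
  "sq_integrable f \<Longrightarrow> sq_integrable (\<lambda>x. c *\<^sub>R f x)"
  by (auto simp: sq_integrable_def power_mult_distrib)

lemma sq_integrable_zero: "sq_integrable (\<lambda>x. 0)"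
  by (simp add: sq_integrable_def)

lemma sq_integrable_uminus:
  "sq_integrable f \<Longrightarrow> sq_integrable (\<lambda>x. - f x)"
  by (auto simp: sq_integrable_def)

lemma sq_integrable_diff:
  "sq_integrable f \<Longrightarrow> sq_integrable g \<Longrightarrow> sq_integrable (\<lambda>x. f x - g x)"
  using sq_integrable_add[of f "\<lambda>x. - g x"] sq_integrable_uminus[of g] by simp

text \<open>Square integrability is part of the relation, so it is reflexive exactly on the
  square-integrable functions and the partial quotient is L^2.\<close>

definition ae_eq_sq_integrable ::
  "('a::euclidean_space \<Rightarrow> 'b::euclidean_space) \<Rightarrow> ('a \<Rightarrow> 'b) \<Rightarrow> bool" where
  "ae_eq_sq_integrable f g \<longleftrightarrow>
     sq_integrable f \<and> sq_integrable g \<and> (AE x in lebesgue. f x = g x)"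

quotient_type (overloaded) ('a, 'b) l2 = "'a::euclidean_space \<Rightarrow> 'b::euclidean_space" / partial: ae_eq_sq_integrable
proof (rule part_equivpI)
  show "\<exists>x::'a \<Rightarrow> 'b. ae_eq_sq_integrable x x"
    using sq_integrable_zero unfolding ae_eq_sq_integrable_def by (auto intro!: exI[of _ "\<lambda>_. 0"])
  show "symp (ae_eq_sq_integrable :: ('a \<Rightarrow> 'b) \<Rightarrow> _)"
    unfolding symp_def ae_eq_sq_integrable_def by (auto elim: AE_mp)
  show "transp (ae_eq_sq_integrable :: ('a \<Rightarrow> 'b) \<Rightarrow> _)"
    unfolding transp_def ae_eq_sq_integrable_def
  proof (intro allI impI, elim conjE, intro conjI)
    fix x y z :: "'a \<Rightarrow> 'b"
    assume "AE t in lebesgue. x t = y t" "AE t in lebesgue. y t = z t"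
    then show "AE t in lebesgue. x t = z t" by eventually_elim simp
  qed
qed

text \<open>Complex-valued functions carry the real inner product, the real part of the Hermitian
  one. This suffices for projections and Lax--Milgram; complex identities come back by varying a
  complex factor in the test vector.\<close>

instantiation l2 :: (euclidean_space, euclidean_space) real_inner
begin

lift_definition zero_l2 :: "('a, 'b) l2" is "\<lambda>x. 0"
  by (simp add: ae_eq_sq_integrable_def sq_integrable_zero)

lift_definition plus_l2 :: "('a, 'b) l2 \<Rightarrow> ('a, 'b) l2 \<Rightarrow> ('a, 'b) l2" is "\<lambda>f g x. f x + g x"
  unfolding ae_eq_sq_integrable_def
  by (intro conjI sq_integrable_add; (elim conjE)?; (assumption)?) auto

lift_definition minus_l2 :: "('a, 'b) l2 \<Rightarrow> ('a, 'b) l2 \<Rightarrow> ('a, 'b) l2" is "\<lambda>f g x. f x - g x"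
  unfolding ae_eq_sq_integrable_def
  by (intro conjI sq_integrable_diff; (elim conjE)?; (assumption)?) auto

lift_definition uminus_l2 :: "('a, 'b) l2 \<Rightarrow> ('a, 'b) l2" is "\<lambda>f x. - f x"
  unfolding ae_eq_sq_integrable_def
  by (intro conjI sq_integrable_uminus; (elim conjE)?; (assumption)?) auto

lift_definition scaleR_l2 :: "real \<Rightarrow> ('a, 'b) l2 \<Rightarrow> ('a, 'b) l2" is "\<lambda>c f x. c *\<^sub>R f x"
  unfolding ae_eq_sq_integrable_def
  by (intro conjI sq_integrable_scaleR; (elim conjE)?; (assumption)?) auto

lift_definition inner_l2 :: "('a, 'b) l2 \<Rightarrow> ('a, 'b) l2 \<Rightarrow> real" is
  "\<lambda>f g. LINT x|lebesgue. inner (f x) (g x)"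
proof -
  fix f f' g g' :: "'a \<Rightarrow> 'b"
  assume "ae_eq_sq_integrable f f'" "ae_eq_sq_integrable g g'"
  then have [measurable]: "f \<in> borel_measurable lebesgue" "f' \<in> borel_measurable lebesgue"
      "g \<in> borel_measurable lebesgue" "g' \<in> borel_measurable lebesgue"
    and ae: "AE x in lebesgue. f x = f' x" "AE x in lebesgue. g x = g' x"
    by (auto simp: ae_eq_sq_integrable_def sq_integrable_def)
  show "(LINT x|lebesgue. inner (f x) (g x)) = (LINT x|lebesgue. inner (f' x) (g' x))"
  proof (rule integral_cong_AE)
    show "AE x in lebesgue. inner (f x) (g x) = inner (f' x) (g' x)"
      using ae by eventually_elim simp
  qed measurable
qed

definition "norm (x::('a, 'b) l2) = sqrt (inner x x)"
definition "sgn (x::('a, 'b) l2) = inverse (norm x) *\<^sub>R x"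
definition "dist (x::('a, 'b) l2) y = norm (x - y)"
definition "uniformity = (INF e\<in>{0 <..}. principal {(x::('a, 'b) l2, y). dist x y < e})"
definition "open (U :: ('a, 'b) l2 set) \<longleftrightarrow>
  (\<forall>x\<in>U. eventually (\<lambda>(x', y). x' = x \<longrightarrow> y \<in> U) uniformity)"

instance
proof
  fix x y z :: "('a, 'b) l2" and a b :: real
  show "x + y + z = x + (y + z)"
    by transfer (auto simp: ae_eq_sq_integrable_def algebra_simps intro!: sq_integrable_add)
  show "x + y = y + x"
    by transfer (auto simp: ae_eq_sq_integrable_def algebra_simps intro!: sq_integrable_add)
  show "0 + x = x"
    by transfer (auto simp: ae_eq_sq_integrable_def)
  show "- x + x = 0"
    by transfer (auto simp: ae_eq_sq_integrable_def sq_integrable_zero)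
  show "x - y = x + - y"
    by transfer (auto simp: ae_eq_sq_integrable_def sq_integrable_diff)
  show "a *\<^sub>R (x + y) = a *\<^sub>R x + a *\<^sub>R y"
    by transfer (auto simp: ae_eq_sq_integrable_def algebra_simps
        intro!: sq_integrable_add sq_integrable_scaleR)
  show "(a + b) *\<^sub>R x = a *\<^sub>R x + b *\<^sub>R x"
    by transfer (auto simp: ae_eq_sq_integrable_def algebra_simps
        intro!: sq_integrable_add sq_integrable_scaleR)
  show "a *\<^sub>R b *\<^sub>R x = (a * b) *\<^sub>R x"
    by transfer (auto simp: ae_eq_sq_integrable_def
        intro!: sq_integrable_add sq_integrable_scaleR)
  show "1 *\<^sub>R x = x"
    by transfer (auto simp: ae_eq_sq_integrable_def)
  show "inner x y = inner y x"
    by transfer (simp add: inner_commute)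
  show "inner (x + y) z = inner x z + inner y z"
    by transfer (simp add: ae_eq_sq_integrable_def inner_add_left sq_integrable_inner)
  show "inner (a *\<^sub>R x) y = a * inner x y"
    by transfer simp
  show "0 \<le> inner x x"
    by transfer (simp add: integral_nonneg_AE)
  show "inner x x = 0 \<longleftrightarrow> x = 0"
  proof transfer
    fix f :: "'a \<Rightarrow> 'b" assume "ae_eq_sq_integrable f f"
    then have f: "sq_integrable f" by (simp add: ae_eq_sq_integrable_def)
    have "(LINT x|lebesgue. inner (f x) (f x)) = 0 \<longleftrightarrow> (AE x in lebesgue. inner (f x) (f x) = 0)"
      by (rule integral_nonneg_eq_0_iff_AE) (auto simp: sq_integrable_inner f)
    then show "((LINT x|lebesgue. inner (f x) (f x)) = 0) = ae_eq_sq_integrable f (\<lambda>x. 0)"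
      using f by (simp add: ae_eq_sq_integrable_def sq_integrable_zero)
  qed
qed (rule norm_l2_def sgn_l2_def dist_l2_def uniformity_l2_def open_l2_def)+

end

definition l2_of :: "('a::euclidean_space \<Rightarrow> 'b::euclidean_space) \<Rightarrow> ('a, 'b) l2" where
  "l2_of = abs_l2"

definition l2_fun :: "('a::euclidean_space, 'b::euclidean_space) l2 \<Rightarrow> 'a \<Rightarrow> 'b" where
  "l2_fun = rep_l2"

lemma sq_integrable_l2_fun [simp]: "sq_integrable (l2_fun F)"
  using Quotient_rep_reflp[OF Quotient_l2, of F] by (simp add: l2_fun_def ae_eq_sq_integrable_def)

lemma l2_of_l2_fun [simp]: "l2_of (l2_fun F) = F"
  by (simp add: l2_of_def l2_fun_def Quotient_abs_rep[OF Quotient_l2])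

lemma l2_of_eq_iff:
  assumes "sq_integrable f" "sq_integrable g"
  shows "l2_of f = l2_of g \<longleftrightarrow> (AE x in lebesgue. f x = g x)"
  using Quotient_rel[OF Quotient_l2, of f g] assms
  by (auto simp: l2_of_def ae_eq_sq_integrable_def)

lemma l2_fun_l2_of:
  assumes "sq_integrable f"
  shows "AE x in lebesgue. l2_fun (l2_of f) x = f x"
  using l2_of_eq_iff[of "l2_fun (l2_of f)" f] assms by simp

lemma l2_of_add:
  assumes "sq_integrable f" "sq_integrable g"
  shows "l2_of (\<lambda>x. f x + g x) = l2_of f + l2_of g"
  using assms by (simp add: l2_of_def plus_l2.abs_eq ae_eq_sq_integrable_def)

lemma l2_of_diff:
  assumes "sq_integrable f" "sq_integrable g"
  shows "l2_of (\<lambda>x. f x - g x) = l2_of f - l2_of g"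
  using assms by (simp add: l2_of_def minus_l2.abs_eq ae_eq_sq_integrable_def)

lemma l2_of_scaleR:
  assumes "sq_integrable f"
  shows "l2_of (\<lambda>x. c *\<^sub>R f x) = c *\<^sub>R l2_of f"
  using assms by (simp add: l2_of_def scaleR_l2.abs_eq ae_eq_sq_integrable_def)

lemma inner_l2_of:
  assumes "sq_integrable f" "sq_integrable g"
  shows "inner (l2_of f) (l2_of g) = (LINT x|lebesgue. inner (f x) (g x))"
  using assms by (simp add: l2_of_def inner_l2.abs_eq ae_eq_sq_integrable_def)

lemma norm_l2_of:
  assumes "sq_integrable f"
  shows "norm (l2_of f) = sqrt (LINT x|lebesgue. (norm (f x))\<^sup>2)"
  using assms by (simp add: norm_eq_sqrt_inner[of "l2_of f"] inner_l2_of power2_norm_eq_inner)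

section \<open>Completeness of L^2 (Riesz--Fischer)\<close>

lemma nn_integral_l2_fun_diff:
  "(\<integral>\<^sup>+x. ennreal ((norm (l2_fun F x - l2_fun G x))\<^sup>2) \<partial>lebesgue) = ennreal ((norm (F - G))\<^sup>2)"
proof -
  have si: "sq_integrable (\<lambda>x. l2_fun F x - l2_fun G x)"
    by (intro sq_integrable_diff sq_integrable_l2_fun)
  have "(norm (F - G))\<^sup>2 = (LINT x|lebesgue. (norm (l2_fun F x - l2_fun G x))\<^sup>2)"
    using norm_l2_of[OF si] by (simp add: l2_of_diff integral_nonneg_AE)
  moreover have "integrable lebesgue (\<lambda>x. (norm (l2_fun F x - l2_fun G x))\<^sup>2)"
    using si by (simp add: sq_integrable_def)
  ultimately show ?thesis by (simp add: nn_integral_eq_integral)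
qed

text \<open>With \<open>\<parallel>X (k + 1) - X k\<parallel> < 2\<^sup>-\<^sup>k\<close> the weighted sum
  \<open>\<Sum>k. 2\<^sup>k |X (k + 1) - X k|\<^sup>2\<close> is integrable, which forces geometric decay of the increments
  almost everywhere.\<close>
lemma l2_fast_Cauchy_AE_convergent:
  fixes X :: "nat \<Rightarrow> ('a::euclidean_space, 'b::euclidean_space) l2"
  assumes fast: "\<And>k. norm (X (Suc k) - X k) < (1/2) ^ k"
  shows "AE x in lebesgue. convergent (\<lambda>k. l2_fun (X k) x)"
proof -
  have [measurable]: "l2_fun (X k) \<in> borel_measurable lebesgue" for k
    by (rule sq_integrable_measurable[OF sq_integrable_l2_fun])
  define D where "D k x = (norm (l2_fun (X (Suc k)) x - l2_fun (X k) x))\<^sup>2" for k x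
  have [measurable]: "D k \<in> borel_measurable lebesgue" for k unfolding D_def by measurable
  have "(\<integral>\<^sup>+x. (\<Sum>k. ennreal (2 ^ k * D k x)) \<partial>lebesgue) = (\<Sum>k. \<integral>\<^sup>+x. ennreal (2 ^ k * D k x) \<partial>lebesgue)"
    by (rule nn_integral_suminf) measurable
  also have "\<dots> \<le> (\<Sum>k. ennreal ((1/2) ^ k))"
  proof (rule suminf_le)
    fix k
    have "(\<integral>\<^sup>+x. ennreal (2 ^ k * D k x) \<partial>lebesgue) = ennreal (2 ^ k) * (\<integral>\<^sup>+x. ennreal (D k x) \<partial>lebesgue)"
      by (subst nn_integral_cmult[symmetric]) (auto simp: ennreal_mult D_def)
    also have "\<dots> = ennreal (2 ^ k * (norm (X (Suc k) - X k))\<^sup>2)"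
      unfolding D_def nn_integral_l2_fun_diff by (simp add: ennreal_mult)
    also have "\<dots> \<le> ennreal ((1/2) ^ k)"
    proof (rule ennreal_leI)
      have "(norm (X (Suc k) - X k))\<^sup>2 \<le> ((1/2) ^ k)\<^sup>2"
        using less_imp_le[OF fast[of k]] by (intro power_mono) auto
      then have "2 ^ k * (norm (X (Suc k) - X k))\<^sup>2 \<le> 2 ^ k * ((1/2) ^ k)\<^sup>2" by simp
      also have "\<dots> = (1/2) ^ k" by (simp add: power2_eq_square power_one_over)
      finally show "2 ^ k * (norm (X (Suc k) - X k))\<^sup>2 \<le> (1/2) ^ k" .
    qed
    finally show "(\<integral>\<^sup>+x. ennreal (2 ^ k * D k x) \<partial>lebesgue) \<le> ennreal ((1/2) ^ k)" .
  qed auto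
  also have "\<dots> = ennreal 2"
    by (subst suminf_ennreal2) (auto simp: suminf_geometric summable_geometric)
  also have "\<dots> < \<infinity>" by simp
  finally have "AE x in lebesgue. (\<Sum>k. ennreal (2 ^ k * D k x)) \<noteq> \<infinity>"
    by (intro nn_integral_noteq_infinite) auto
  then show ?thesis
  proof eventually_elim
    case (elim x)
    have sm: "summable (\<lambda>k. 2 ^ k * D k x)"
      using elim by (intro summable_suminf_not_top) (auto simp: D_def)
    then have "(\<lambda>k. 2 ^ k * D k x) \<longlonglongrightarrow> 0" by (rule summable_LIMSEQ_zero)
    then have "\<forall>\<^sub>F k in sequentially. 2 ^ k * D k x < 1" by (rule order_tendstoD) simp
    then have ev: "\<forall>\<^sub>F k in sequentially. norm (l2_fun (X (Suc k)) x - l2_fun (X k) x) \<le> sqrt (1/2) ^ k"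
    proof eventually_elim
      case (elim k)
      then have "D k x \<le> (1/2) ^ k" by (simp add: field_simps)
      then have "sqrt (D k x) \<le> sqrt ((1/2) ^ k)" by simp
      then show ?case by (simp add: D_def real_sqrt_power)
    qed
    have "summable (\<lambda>k. l2_fun (X (Suc k)) x - l2_fun (X k) x)"
      by (rule summable_comparison_test_ev[OF ev summable_geometric]) simp
    then have "convergent (\<lambda>n. \<Sum>k<n. l2_fun (X (Suc k)) x - l2_fun (X k) x)"
      by (simp add: summable_iff_convergent)
    then have "convergent (\<lambda>n. l2_fun (X n) x - l2_fun (X 0) x)"
      using sum_lessThan_telescope[of "\<lambda>k. l2_fun (X k) x"] by simp
    then obtain L where "(\<lambda>n. l2_fun (X n) x - l2_fun (X 0) x) \<longlonglongrightarrow> L"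
      by (auto simp: convergent_def)
    then have "(\<lambda>n. (l2_fun (X n) x - l2_fun (X 0) x) + l2_fun (X 0) x) \<longlonglongrightarrow> L + l2_fun (X 0) x"
      by (intro tendsto_intros)
    then show ?case by (auto simp: convergent_def)
  qed
qed

text \<open>Fatou's lemma bounds the L^2 distance of the pointwise limit to \<open>X m\<close> by
  any bound on X k - X m valid for large k. The bound 1 makes \<open>f\<close> square-integrable,
  arbitrarily small bounds give convergence.\<close>

lemma l2_AE_limit_Cauchy:
  fixes X :: "nat \<Rightarrow> ('a::euclidean_space, 'b::euclidean_space) l2"
  assumes "Cauchy X" and f[measurable]: "f \<in> borel_measurable lebesgue"
    and lim: "AE x in lebesgue. (\<lambda>k. l2_fun (X k) x) \<longlonglongrightarrow> f x"
  shows "convergent X"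
proof -
  have [measurable]: "l2_fun (X k) \<in> borel_measurable lebesgue" for k
    by (rule sq_integrable_measurable[OF sq_integrable_l2_fun])
  have fatou: "(\<integral>\<^sup>+x. ennreal ((norm (f x - l2_fun (X m) x))\<^sup>2) \<partial>lebesgue) \<le> ennreal (e\<^sup>2)"
    if m: "\<And>k. k \<ge> N \<Longrightarrow> norm (X k - X m) \<le> e" for m e N
  proof -
    have "(\<integral>\<^sup>+x. ennreal ((norm (f x - l2_fun (X m) x))\<^sup>2) \<partial>lebesgue)
        = (\<integral>\<^sup>+x. liminf (\<lambda>k. ennreal ((norm (l2_fun (X k) x - l2_fun (X m) x))\<^sup>2)) \<partial>lebesgue)"
    proof (rule nn_integral_cong_AE)
      show "AE x in lebesgue. ennreal ((norm (f x - l2_fun (X m) x))\<^sup>2)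
          = liminf (\<lambda>k. ennreal ((norm (l2_fun (X k) x - l2_fun (X m) x))\<^sup>2))"
        using lim
      proof eventually_elim
        case (elim x)
        then have "(\<lambda>k. ennreal ((norm (l2_fun (X k) x - l2_fun (X m) x))\<^sup>2)) \<longlonglongrightarrow> ennreal ((norm (f x - l2_fun (X m) x))\<^sup>2)"
          by (intro tendsto_intros)
        then show ?case by (rule lim_imp_Liminf[symmetric, rotated]) simp
      qed
    qed
    also have "\<dots> \<le> liminf (\<lambda>k. \<integral>\<^sup>+x. ennreal ((norm (l2_fun (X k) x - l2_fun (X m) x))\<^sup>2) \<partial>lebesgue)"
      by (rule nn_integral_liminf) measurable
    also have "\<dots> \<le> ennreal (e\<^sup>2)"
    proof (rule Liminf_le)
      show "\<forall>\<^sub>F k in sequentially. (\<integral>\<^sup>+x. ennreal ((norm (l2_fun (X k) x - l2_fun (X m) x))\<^sup>2) \<partial>lebesgue) \<le> ennreal (e\<^sup>2)"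
        unfolding nn_integral_l2_fun_diff eventually_sequentially
        using m by (auto intro!: exI[of _ N] ennreal_leI power_mono)
    qed simp
    finally show ?thesis .
  qed
  have si: "sq_integrable (\<lambda>x. f x - l2_fun (X m) x)" if "\<And>k. k \<ge> N \<Longrightarrow> norm (X k - X m) \<le> e" for m e N
  proof -
    have "(\<integral>\<^sup>+x. ennreal ((norm (f x - l2_fun (X m) x))\<^sup>2) \<partial>lebesgue) < \<infinity>"
      using fatou[of N m e] that by (auto intro: le_less_trans)
    then show ?thesis unfolding sq_integrable_def by (auto intro!: integrableI_nonneg)
  qed
  obtain N where N: "\<And>k m. k \<ge> N \<Longrightarrow> m \<ge> N \<Longrightarrow> norm (X k - X m) < 1"
    using metric_CauchyD[OF assms(1), of 1] by (auto simp: dist_norm)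
  have "sq_integrable (\<lambda>x. (f x - l2_fun (X N) x) + l2_fun (X N) x)"
    using N by (intro sq_integrable_add sq_integrable_l2_fun si[of N N 1]) (auto intro: less_imp_le)
  then have sif: "sq_integrable f" by simp
  have "X \<longlonglongrightarrow> l2_of f"
  proof (rule metric_LIMSEQ_I)
    fix e :: real assume e: "e > 0"
    obtain N where N: "\<And>k m. k \<ge> N \<Longrightarrow> m \<ge> N \<Longrightarrow> norm (X k - X m) < e / 2"
      using metric_CauchyD[OF assms(1), of "e / 2"] e by (auto simp: dist_norm)
    have "dist (X m) (l2_of f) < e" if m: "m \<ge> N" for m
    proof -
      have b: "\<And>k. k \<ge> N \<Longrightarrow> norm (X k - X m) \<le> e / 2" using N m by (auto intro: less_imp_le)
      have sim: "sq_integrable (\<lambda>x. f x - l2_fun (X m) x)" by (rule si[of N]) (rule b)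
      have ft: "(\<integral>\<^sup>+x. ennreal ((norm (f x - l2_fun (X m) x))\<^sup>2) \<partial>lebesgue) \<le> ennreal ((e / 2)\<^sup>2)"
        by (rule fatou[of N]) (rule b)
      have "norm (l2_of f - X m) = norm (l2_of (\<lambda>x. f x - l2_fun (X m) x))"
        using sif by (simp add: l2_of_diff)
      also have "\<dots> \<le> sqrt ((e / 2)\<^sup>2)"
        unfolding norm_l2_of[OF sim]
      proof (rule real_sqrt_le_mono)
        have "ennreal (LINT x|lebesgue. (norm (f x - l2_fun (X m) x))\<^sup>2) \<le> ennreal ((e / 2)\<^sup>2)"
          using ft sim
          by (subst nn_integral_eq_integral[symmetric]) (auto simp: sq_integrable_def)
        then show "(LINT x|lebesgue. (norm (f x - l2_fun (X m) x))\<^sup>2) \<le> (e / 2)\<^sup>2"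
          by (simp add: ennreal_le_iff)
      qed
      finally show ?thesis using e by (simp add: dist_norm norm_minus_commute)
    qed
    then show "\<exists>N. \<forall>m\<ge>N. dist (X m) (l2_of f) < e" by blast
  qed
  then show ?thesis by (auto simp: convergent_def)
qed

instance l2 :: (euclidean_space, euclidean_space) complete_space
proof
  fix X :: "nat \<Rightarrow> ('a, 'b) l2" assume X: "Cauchy X"
  have "\<exists>N. \<forall>m\<ge>N. \<forall>n\<ge>N. dist (X m) (X n) < (1/2) ^ k" for k :: nat
    using metric_CauchyD[OF X, of "(1/2) ^ k"] by simp
  then obtain N where N: "\<And>k m n. m \<ge> N k \<Longrightarrow> n \<ge> N k \<Longrightarrow> dist (X m) (X n) < (1/2) ^ k" by metis
  \<comment> \<open>The summand \<open>k\<close> makes \<open>r\<close> strictly increasing, and the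
    partial sum dominates \<open>N k\<close> even if \<open>N\<close> is not monotone.\<close>
  define r where "r k = k + (\<Sum>i\<le>k. N i)" for k
  have r: "strict_mono r" unfolding r_def by (rule strict_monoI_Suc) simp
  have rN: "r k \<ge> N k" for k
    unfolding r_def by (simp add: trans_le_add2 member_le_sum)
  have Y: "Cauchy (X \<circ> r)" using X r by (rule Cauchy_subseq_Cauchy)
  have "AE x in lebesgue. convergent (\<lambda>k. l2_fun ((X \<circ> r) k) x)"
  proof (rule l2_fast_Cauchy_AE_convergent)
    fix k
    have "r (Suc k) \<ge> N k" using rN[of k] strict_monoD[OF r, of k "Suc k"] by simp
    then show "norm ((X \<circ> r) (Suc k) - (X \<circ> r) k) < (1/2) ^ k"
      using N[of k "r (Suc k)" "r k"] rN[of k] by (simp add: dist_norm)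
  qed
  then have lim: "AE x in lebesgue. (\<lambda>k. l2_fun ((X \<circ> r) k) x) \<longlonglongrightarrow> lim (\<lambda>k. l2_fun ((X \<circ> r) k) x)"
    by eventually_elim (simp add: convergent_LIMSEQ_iff)
  have [measurable]: "l2_fun ((X \<circ> r) k) \<in> borel_measurable lebesgue" for k
    by (rule sq_integrable_measurable[OF sq_integrable_l2_fun])
  have "convergent (X \<circ> r)"
    by (rule l2_AE_limit_Cauchy[OF Y _ lim]) measurable
  then show "convergent X"
    using Cauchy_converges_subseq[OF X r] by (auto simp: convergent_def)
qed

section \<open>Functions with continuous partial derivatives\<close>

lemma pd_eqI: "(\<phi> has_derivative D) (at x) \<Longrightarrow> pd i \<phi> x = D (axis i 1)"
  unfolding pd_def by (metis frechet_derivative_at)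

lemma has_derivative_frechet:
  fixes \<phi> :: "pt \<Rightarrow> real"
  shows "\<phi> differentiable (at x) \<Longrightarrow> (\<phi> has_derivative frechet_derivative \<phi> (at x)) (at x)"
  by (simp add: frechet_derivative_works)

lemma pd_const [simp]: "pd i (\<lambda>x. c) x = 0"
  by (rule pd_eqI[OF has_derivative_const])

lemma pd_add:
  "\<phi> differentiable (at x) \<Longrightarrow> \<psi> differentiable (at x) \<Longrightarrow> pd i (\<lambda>x. \<phi> x + \<psi> x) x = pd i \<phi> x + pd i \<psi> x"
  by (subst pd_eqI[OF has_derivative_add[OF has_derivative_frechet has_derivative_frechet]]) (auto simp: pd_def)

lemma pd_diff:
  "\<phi> differentiable (at x) \<Longrightarrow> \<psi> differentiable (at x) \<Longrightarrow> pd i (\<lambda>x. \<phi> x - \<psi> x) x = pd i \<phi> x - pd i \<psi> x"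
  by (subst pd_eqI[OF has_derivative_diff[OF has_derivative_frechet has_derivative_frechet]]) (auto simp: pd_def)

lemma pd_mult:
  "\<phi> differentiable (at x) \<Longrightarrow> \<psi> differentiable (at x) \<Longrightarrow>
    pd i (\<lambda>x. \<phi> x * \<psi> x) x = \<phi> x * pd i \<psi> x + pd i \<phi> x * \<psi> x"
  by (subst pd_eqI[OF has_derivative_mult[OF has_derivative_frechet has_derivative_frechet]]) (auto simp: pd_def)

lemma has_derivative_chain_real:
  fixes q :: "pt \<Rightarrow> real"
  assumes "q differentiable (at x)" "(h has_real_derivative h') (at (q x))"
  shows "((\<lambda>x. h (q x)) has_derivative (\<lambda>v. h' * frechet_derivative q (at x) v)) (at x)"
  using has_derivative_compose[OF has_derivative_frechet[OF assms(1)] assms(2)[unfolded has_field_derivative_def]] .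

lemma pd_chain_real:
  assumes "q differentiable (at x)" "(h has_real_derivative h') (at (q x))"
  shows "pd i (\<lambda>x. h (q x)) x = h' * pd i q x"
  using pd_eqI[OF has_derivative_chain_real[OF assms]] by (simp add: pd_def)

text \<open>C^k by recursion on partial derivatives, so that closure under algebraic operations
  follows by induction on k. Each level asks for total differentiability; k = 2 is the regularity
  demanded by \<open>test_fun\<close>.\<close>

fun ck :: "nat \<Rightarrow> (pt \<Rightarrow> real) \<Rightarrow> bool" where
  "ck 0 \<phi> \<longleftrightarrow> continuous_on UNIV \<phi>"
| "ck (Suc k) \<phi> \<longleftrightarrow> (\<forall>x. \<phi> differentiable (at x)) \<and> (\<forall>i. ck k (pd i \<phi>))"

lemma ck_Suc_imp_ck: "ck (Suc k) \<phi> \<Longrightarrow> ck k \<phi>"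
proof (induction k arbitrary: \<phi>)
  case 0
  then show ?case by (simp add: differentiable_imp_continuous_within continuous_at_imp_continuous_on)
qed simp

lemma ck_mono: "ck k \<phi> \<Longrightarrow> j \<le> k \<Longrightarrow> ck j \<phi>"
  by (induction k) (auto simp del: ck.simps dest: ck_Suc_imp_ck simp: le_Suc_eq)

lemma ck_continuous: "ck k \<phi> \<Longrightarrow> continuous_on UNIV \<phi>"
  using ck_mono[of k \<phi> 0] by simp

lemma ck_const [simp]: "ck k (\<lambda>x. c)"
proof (induction k arbitrary: c)
  case (Suc k)
  have "pd i (\<lambda>x. c) = (\<lambda>x. 0)" for i by (rule ext) simp
  with Suc show ?case by simp
qed simp

lemma ck_add: "ck k \<phi> \<Longrightarrow> ck k \<psi> \<Longrightarrow> ck k (\<lambda>x. \<phi> x + \<psi> x)"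
proof (induction k arbitrary: \<phi> \<psi>)
  case (Suc k)
  then have "pd i (\<lambda>x. \<phi> x + \<psi> x) = (\<lambda>x. pd i \<phi> x + pd i \<psi> x)" for i by (auto simp: pd_add)
  with Suc show ?case by (simp add: differentiable_add)
qed (simp add: continuous_on_add)

lemma ck_diff: "ck k \<phi> \<Longrightarrow> ck k \<psi> \<Longrightarrow> ck k (\<lambda>x. \<phi> x - \<psi> x)"
proof (induction k arbitrary: \<phi> \<psi>)
  case (Suc k)
  then have "pd i (\<lambda>x. \<phi> x - \<psi> x) = (\<lambda>x. pd i \<phi> x - pd i \<psi> x)" for i by (auto simp: pd_diff)
  with Suc show ?case by (simp add: differentiable_diff)
qed (simp add: continuous_on_diff)

lemma ck_mult: "ck k \<phi> \<Longrightarrow> ck k \<psi> \<Longrightarrow> ck k (\<lambda>x. \<phi> x * \<psi> x)"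
proof (induction k arbitrary: \<phi> \<psi>)
  case (Suc k)
  then have "pd i (\<lambda>x. \<phi> x * \<psi> x) = (\<lambda>x. \<phi> x * pd i \<psi> x + pd i \<phi> x * \<psi> x)" for i by (auto simp: pd_mult)
  moreover have "ck k \<phi>" "ck k \<psi>" using Suc.prems ck_Suc_imp_ck by blast+
  ultimately show ?case using Suc by (simp add: differentiable_mult ck_add)
qed (simp add: continuous_on_mult)

lemma ck_sum: "(\<And>a. a \<in> A \<Longrightarrow> ck k (f a)) \<Longrightarrow> ck k (\<lambda>x. \<Sum>a\<in>A. f a x)"
  by (induction A rule: infinite_finite_induct) (auto intro: ck_add)

lemma ck_component: "ck k (\<lambda>x. x $ i)"
proof (cases k)
  case (Suc j)
  have d: "((\<lambda>x::pt. x $ i) has_derivative (\<lambda>v. v $ i)) (at x)" for x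
    by (rule bounded_linear_imp_has_derivative[OF bounded_linear_vec_nth])
  have "pd l (\<lambda>x. x $ i) = (\<lambda>x. axis l 1 $ i)" for l by (rule ext) (rule pd_eqI[OF d])
  then show ?thesis using d Suc by (auto simp: differentiable_def)
qed (simp add: continuous_on_component)

lemma ck_norm_diff_squared: "ck k (\<lambda>x. (norm (x - c))\<^sup>2)"
proof -
  have "(\<lambda>x. (norm (x - c))\<^sup>2) = (\<lambda>x. \<Sum>i\<in>UNIV. (x $ i - c $ i) * (x $ i - c $ i))"
    by (simp add: power2_norm_eq_inner inner_vec_def)
  then show ?thesis by (simp add: ck_sum ck_mult ck_diff ck_component)
qed

section \<open>Finitely smooth cutoff functions\<close>

lemma DERIV_pos_part_power:
  "((\<lambda>t::real. (max 0 t) ^ Suc (Suc m)) has_real_derivative (real (Suc (Suc m)) * (max 0 t) ^ Suc m)) (at t)"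
proof -
  consider "t > 0" | "t < 0" | "t = 0" by linarith
  then show ?thesis
  proof cases
    case 1
    have "((\<lambda>t::real. t ^ Suc (Suc m)) has_real_derivative (real (Suc (Suc m)) * t ^ Suc m)) (at t)"
      by (rule derivative_eq_intros refl)+ simp
    then have "((\<lambda>t::real. (max 0 t) ^ Suc (Suc m)) has_real_derivative (real (Suc (Suc m)) * t ^ Suc m)) (at t)"
      by (rule has_field_derivative_transform_within_open[where S="{0<..}"]) (use 1 in auto)
    with 1 show ?thesis by simp
  next
    case 2
    have "((\<lambda>t::real. 0) has_real_derivative 0) (at t)" by simp
    then have "((\<lambda>t::real. (max 0 t) ^ Suc (Suc m)) has_real_derivative 0) (at t)"
      by (rule has_field_derivative_transform_within_open[where S="{..<0}"]) (use 2 in auto)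
    with 2 show ?thesis by (simp add: max_def)
  next
    case 3
    \<comment> \<open>At the kink the difference quotient is at most (max 0 h)^(m+1), which tends to
      0; this is where an exponent of at least 2 is used.\<close>
    have "((\<lambda>h::real. (max 0 h) ^ Suc (Suc m) / h) \<longlongrightarrow> 0) (at 0)"
    proof (rule Lim_null_comparison)
      show "((\<lambda>h::real. (max 0 h) ^ Suc m) \<longlongrightarrow> 0) (at 0)"
        by (rule tendsto_eq_intros refl)+ simp
      show "\<forall>\<^sub>F h::real in at 0. norm ((max 0 h) ^ Suc (Suc m) / h) \<le> (max 0 h) ^ Suc m"
        by (auto simp: eventually_at_filter max_def intro!: always_eventually)
    qed
    then show ?thesis unfolding 3 by (simp add: DERIV_def)
  qed
qed

text \<open>Truncated powers replace the exponential bump, since only finitely many derivatives are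
  ever taken. Each derivative lowers the exponent by one, which is why k < m is carried through the
  induction.\<close>

lemma ck_pos_part_power: "ck k q \<Longrightarrow> k < m \<Longrightarrow> ck k (\<lambda>x. (max 0 (q x)) ^ m)"
proof (induction k arbitrary: q m)
  case 0
  then show ?case by (auto intro!: continuous_intros)
next
  case (Suc k)
  obtain m' where m: "m = Suc (Suc m')" using Suc.prems(2) by (metis Suc_lessE less_imp_Suc_add)
  have qd: "q differentiable (at x)" for x using Suc.prems(1) by simp
  have "(\<lambda>x. (max 0 (q x)) ^ m) differentiable (at x)" for x
    using has_derivative_chain_real[OF qd DERIV_pos_part_power[of m']] m unfolding differentiable_def by blast
  moreover have "pd i (\<lambda>x. (max 0 (q x)) ^ m) = (\<lambda>x. real m * (max 0 (q x)) ^ Suc m' * pd i q x)" for i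
    using pd_chain_real[OF qd DERIV_pos_part_power[of m']] m by auto
  moreover have "ck k (\<lambda>x. real m * (max 0 (q x)) ^ Suc m' * pd i q x)" for i
    using Suc m by (intro ck_mult ck_const Suc.IH) (auto intro: ck_Suc_imp_ck simp del: power_Suc)
  ultimately show ?case by simp
qed

abbreviation supp :: "(pt \<Rightarrow> real) \<Rightarrow> pt set" where
  "supp \<phi> \<equiv> closure {x. \<phi> x \<noteq> 0}"

definition ck_test :: "nat \<Rightarrow> pt set \<Rightarrow> (pt \<Rightarrow> real) \<Rightarrow> bool" where
  "ck_test k U \<phi> \<longleftrightarrow> ck k \<phi> \<and> compact (supp \<phi>) \<and> supp \<phi> \<subseteq> U"

lemma test_fun_iff: "test_fun U \<phi> \<longleftrightarrow> ck_test 2 U \<phi>"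
  by (auto simp: test_fun_def ck_test_def numeral_2_eq_2)

lemma ck_test_ck: "ck_test k U \<phi> \<Longrightarrow> ck k \<phi>"
  by (simp add: ck_test_def)

lemma ck_test_mono: "ck_test k U \<phi> \<Longrightarrow> j \<le> k \<Longrightarrow> U \<subseteq> V \<Longrightarrow> ck_test j V \<phi>"
  by (auto simp: ck_test_def intro: ck_mono)

lemma zero_outside_support:
  "x \<notin> supp \<phi> \<Longrightarrow> \<phi> x = (0::real)"
  using closure_subset[of "{x. \<phi> x \<noteq> 0}"] by auto

lemma pd_zero_outside_support:
  assumes "x \<notin> supp \<phi>"
  shows "pd i \<phi> x = 0"
proof -
  have "((\<lambda>x. 0) has_derivative (\<lambda>v. 0::real)) (at x)" by simp
  then have "(\<phi> has_derivative (\<lambda>v. 0)) (at x)"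
    by (rule has_derivative_transform_within_open[where s = "- supp \<phi>"])
       (use assms in \<open>auto dest: zero_outside_support\<close>)
  then show ?thesis by (rule pd_eqI)
qed

lemma support_pd_subset: "supp (pd i \<phi>) \<subseteq> supp \<phi>"
proof (rule closure_minimal)
  show "{x. pd i \<phi> x \<noteq> 0} \<subseteq> supp \<phi>" using pd_zero_outside_support by blast
qed simp

lemma ck_test_support_le:
  assumes "ck_test j U \<phi>" "ck k \<psi>" "supp \<psi> \<subseteq> supp \<phi>"
  shows "ck_test k U \<psi>"
  using assms compact_Int_closed[of "supp \<phi>" "supp \<psi>"]
  by (auto simp: ck_test_def Int_absorb1)

lemma ck_test_pd: "ck_test (Suc k) U \<phi> \<Longrightarrow> ck_test k U (pd i \<phi>)"
  by (rule ck_test_support_le[OF _ _ support_pd_subset, of "Suc k"]) (auto simp: ck_test_def)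

lemma ck_test_mult: "ck_test k U \<phi> \<Longrightarrow> ck k \<eta> \<Longrightarrow> ck_test k U (\<lambda>x. \<eta> x * \<phi> x)"
  by (rule ck_test_support_le) (auto simp: ck_test_def intro!: ck_mult closure_mono)

lemma ck_test_add:
  assumes "ck_test k UNIV \<phi>" "ck_test k UNIV \<psi>" shows "ck_test k UNIV (\<lambda>x. \<phi> x + \<psi> x)"
proof -
  let ?K = "supp \<phi> \<union> supp \<psi>"
  have "{x. \<phi> x + \<psi> x \<noteq> 0} \<subseteq> {x. \<phi> x \<noteq> 0} \<union> {x. \<psi> x \<noteq> 0}" by auto
  from closure_mono[OF this] have "closure {x. \<phi> x + \<psi> x \<noteq> 0} \<subseteq> ?K" by simp
  moreover have "compact (?K \<inter> closure {x. \<phi> x + \<psi> x \<noteq> 0})"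
    using assms by (intro compact_Int_closed compact_Un) (auto simp: ck_test_def)
  ultimately show ?thesis using assms by (auto simp: ck_test_def ck_add Int_absorb1)
qed

text \<open>Cover \<open>K\<close> by finitely many balls whose closed versions lie in
  \<open>V\<close> and add truncated powers of r^2 - |x - c|^2 to get \<open>s\<close>, positive on
  \<open>K\<close> and zero off the balls. The profile 1 - (1 - s/\<delta>)_+^(k+1) is 0 where s = 0
  and 1 where s >= \<delta>; with \<delta> half the minimum of \<open>s\<close> on \<open>K\<close>,
  the set s > \<delta> is an open neighbourhood of \<open>K\<close>.\<close>

lemma smooth_cutoff:
  assumes K: "compact K" and V: "open V" "K \<subseteq> V"
  obtains \<eta> W where "ck_test k V \<eta>" "\<And>x. 0 \<le> \<eta> x" "\<And>x. \<eta> x \<le> 1" "open W" "K \<subseteq> W" "\<And>x. x \<in> W \<Longrightarrow> \<eta> x = 1"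
proof (cases "K = {}")
  case True
  then show ?thesis using that[of "\<lambda>x. 0" "{}"] by (simp add: ck_test_def)
next
  case False
  have "\<exists>r>0. cball x r \<subseteq> V" if "x \<in> K" for x
    using V that open_contains_cball by blast
  then obtain r where r: "\<And>x. x \<in> K \<Longrightarrow> r x > 0" "\<And>x. x \<in> K \<Longrightarrow> cball x (r x) \<subseteq> V" by metis
  obtain C where C: "C \<subseteq> K" "finite C" "K \<subseteq> (\<Union>c\<in>C. ball c (r c))"
  proof (rule compactE_image[OF K, of K "\<lambda>c. ball c (r c)"])
    show "K \<subseteq> (\<Union>c\<in>K. ball c (r c))" using r(1) by force
  qed auto
  define s where "s x = (\<Sum>c\<in>C. (max 0 ((r c)\<^sup>2 - (norm (x - c))\<^sup>2)) ^ Suc k)" for x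
  have s_ck: "ck k s" unfolding s_def
    by (intro ck_sum ck_pos_part_power ck_diff ck_const ck_norm_diff_squared) simp
  have s_nonneg: "s x \<ge> 0" for x unfolding s_def by (intro sum_nonneg) simp
  have s_pos: "s x > 0" if "x \<in> K" for x
  proof -
    obtain c where c: "c \<in> C" "x \<in> ball c (r c)" using C(3) \<open>x \<in> K\<close> by blast
    then have "norm (x - c) < r c" by (simp add: dist_norm norm_minus_commute)
    then have "(norm (x - c))\<^sup>2 < (r c)\<^sup>2" by (intro power_strict_mono) auto
    then have "0 < (max 0 ((r c)\<^sup>2 - (norm (x - c))\<^sup>2)) ^ Suc k" by (intro zero_less_power) auto
    then show ?thesis unfolding s_def using c(1) C(2) by (intro sum_pos2[of C c]) auto
  qed
  have s_supp: "x \<in> (\<Union>c\<in>C. cball c (r c))" if "s x \<noteq> 0" for x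
  proof (rule ccontr)
    assume n: "x \<notin> (\<Union>c\<in>C. cball c (r c))"
    have "(max 0 ((r c)\<^sup>2 - (norm (x - c))\<^sup>2)) ^ Suc k = 0" if "c \<in> C" for c
    proof -
      have "r c \<le> norm (x - c)" using n that by (auto simp: dist_norm norm_minus_commute)
      then have "(r c)\<^sup>2 \<le> (norm (x - c))\<^sup>2" using r(1)[of c] that C(1) by (intro power_mono) auto
      then show ?thesis by simp
    qed
    then have "s x = 0" unfolding s_def by (intro sum.neutral ballI)
    then show False using \<open>s x \<noteq> 0\<close> by simp
  qed
  obtain x0 where x0: "x0 \<in> K" "\<And>x. x \<in> K \<Longrightarrow> s x0 \<le> s x"
    using continuous_attains_inf[OF K False continuous_on_subset[OF ck_continuous[OF s_ck]]] by auto
  define \<delta> where "\<delta> = s x0 / 2"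
  have \<delta>: "\<delta> > 0" using s_pos[OF x0(1)] by (simp add: \<delta>_def)
  define \<eta> where "\<eta> x = 1 - (max 0 (1 - s x * (1 / \<delta>))) ^ Suc k" for x
  have "ck k \<eta>" unfolding \<eta>_def
    by (intro ck_diff ck_const ck_pos_part_power ck_mult s_ck) simp
  moreover have sub: "supp \<eta> \<subseteq> (\<Union>c\<in>C. cball c (r c))"
  proof (rule closure_minimal)
    have "s x \<noteq> 0" if "\<eta> x \<noteq> 0" for x using that by (intro notI) (simp add: \<eta>_def)
    then show "{x. \<eta> x \<noteq> 0} \<subseteq> (\<Union>c\<in>C. cball c (r c))" using s_supp by blast
  qed (use C(2) in auto)
  moreover have "compact (\<Union>c\<in>C. cball c (r c))" using C(2) by (intro compact_UN) auto
  then have "compact ((\<Union>c\<in>C. cball c (r c)) \<inter> supp \<eta>)"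
    by (rule compact_Int_closed) simp
  moreover have "(\<Union>c\<in>C. cball c (r c)) \<subseteq> V" using r(2) C(1) by blast
  ultimately have "ck_test k V \<eta>" by (auto simp: ck_test_def Int_absorb1)
  moreover have "0 \<le> \<eta> x" "\<eta> x \<le> 1" for x
  proof -
    have "(max 0 (1 - s x * (1 / \<delta>))) ^ Suc k \<le> 1"
      using s_nonneg[of x] \<delta> by (intro power_le_one) auto
    then show "0 \<le> \<eta> x" by (simp add: \<eta>_def del: power_Suc)
    have "0 \<le> (max 0 (1 - s x * (1 / \<delta>))) ^ Suc k" by (intro zero_le_power) simp
    then show "\<eta> x \<le> 1" by (simp add: \<eta>_def del: power_Suc)
  qed
  moreover have "open {x. \<delta> < s x}"
    using open_Collect_less[OF continuous_on_const ck_continuous[OF s_ck]] .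
  moreover have "K \<subseteq> {x. \<delta> < s x}" using x0(2) s_pos[OF x0(1)] by (force simp: \<delta>_def)
  moreover have "\<eta> x = 1" if "x \<in> {x. \<delta> < s x}" for x
    using that \<delta> by (simp add: \<eta>_def)
  ultimately show ?thesis using that by blast
qed

section \<open>Integrals against test functions\<close>

definition loc_integrable :: "(pt \<Rightarrow> real) \<Rightarrow> bool" where
  "loc_integrable u \<longleftrightarrow> u \<in> borel_measurable lebesgue \<and>
     (\<forall>R. integrable lebesgue (\<lambda>x. indicator (cball 0 R) x * u x))"

lemma integrable_indicator_cball: "integrable lebesgue (indicator (cball (0::pt) R) :: pt \<Rightarrow> real)"
proof (rule integrable_real_indicator)
  have "cball (0::pt) R \<in> lmeasurable" by (rule lmeasurable_cball)
  then show "cball (0::pt) R \<in> sets lebesgue" "emeasure lebesgue (cball (0::pt) R) < \<infinity>"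
    by (auto simp: fmeasurable_def)
qed

lemma loc_integrable_const: "loc_integrable (\<lambda>x. c)"
  unfolding loc_integrable_def by (auto intro: integrable_indicator_cball)

lemma sq_integrable_imp_loc_integrable:
  assumes u: "sq_integrable (u :: pt \<Rightarrow> real)"
  shows "loc_integrable u"
proof -
  have [measurable]: "u \<in> borel_measurable lebesgue" using u by (simp add: sq_integrable_def)
  have "integrable lebesgue (\<lambda>x. indicator (cball 0 R) x * u x)" for R
  proof (rule Bochner_Integration.integrable_bound)
    show "integrable lebesgue (\<lambda>x. indicator (cball 0 R) x + (norm (u x))\<^sup>2)"
      using integrable_indicator_cball u by (auto simp: sq_integrable_def)
    have "\<bar>u x\<bar> \<le> 1 + (u x)\<^sup>2" for x
    proof (cases "\<bar>u x\<bar> \<le> 1")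
      case False
      then have "\<bar>u x\<bar> * 1 \<le> \<bar>u x\<bar> * \<bar>u x\<bar>" by (intro mult_left_mono) auto
      then show ?thesis by (simp add: power2_eq_square)
    qed (simp add: add_increasing2)
    then show "AE x in lebesgue. norm (indicator (cball 0 R) x * u x) \<le> norm (indicator (cball 0 R) x + (norm (u x))\<^sup>2)"
      by (auto simp: indicator_def)
    show "(\<lambda>x. indicator (cball 0 R) x * u x) \<in> borel_measurable lebesgue"
      by (intro borel_measurable_times borel_measurable_indicator) auto
  qed
  then show ?thesis using u by (simp add: loc_integrable_def sq_integrable_def)
qed

lemma borel_measurable_lebesgue_continuous:
  fixes f :: "pt \<Rightarrow> 'b::{euclidean_space}"
  assumes "continuous_on UNIV f" shows "f \<in> borel_measurable lebesgue"
  using borel_measurable_continuous_onI[OF assms] by (simp add: measurable_completion)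

lemma compact_support_bounds:
  assumes "continuous_on UNIV \<phi>" "compact (supp \<phi>)"
  obtains B R where "0 \<le> B" "0 < R" "\<And>x. \<bar>\<phi> x\<bar> \<le> B" "\<And>x. R < norm x \<Longrightarrow> \<phi> x = 0"
proof -
  let ?K = "supp \<phi>"
  have "bounded (\<phi> ` ?K)"
    using assms by (intro compact_imp_bounded compact_continuous_image) (auto intro: continuous_on_subset)
  then obtain B where B: "B > 0" "\<And>x. x \<in> ?K \<Longrightarrow> \<bar>\<phi> x\<bar> \<le> B" by (auto simp: bounded_pos)
  obtain R where R: "R > 0" "\<And>x. x \<in> ?K \<Longrightarrow> norm x \<le> R"
    using compact_imp_bounded[OF assms(2)] by (auto simp: bounded_pos)
  have "\<bar>\<phi> x\<bar> \<le> B" for x using B zero_outside_support[of x \<phi>] by (cases "x \<in> ?K") auto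
  moreover have "\<phi> x = 0" if "R < norm x" for x
    using R(2)[of x] zero_outside_support[of x \<phi>] that by (cases "x \<in> ?K") auto
  ultimately show thesis using that[of B R] B(1) R(1) by simp
qed

lemma ck_test_bounds:
  assumes "ck_test k U \<phi>"
  obtains B R where "0 \<le> B" "0 < R" "\<And>x. \<bar>\<phi> x\<bar> \<le> B" "\<And>x. R < norm x \<Longrightarrow> \<phi> x = 0"
  using compact_support_bounds[of \<phi>] assms ck_continuous[of k \<phi>] by (auto simp: ck_test_def)

lemma ck_test_measurable: "ck_test k U \<phi> \<Longrightarrow> \<phi> \<in> borel_measurable lebesgue"
  by (intro borel_measurable_lebesgue_continuous ck_continuous[of k] ck_test_ck)

lemma loc_integrable_dominated:
  assumes u: "loc_integrable u"
    and m: "\<And>n. \<phi> n \<in> borel_measurable lebesgue" "\<psi> \<in> borel_measurable lebesgue"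
    and lim: "\<And>x. (\<lambda>n::nat. \<phi> n x) \<longlonglongrightarrow> \<psi> x"
    and B: "\<And>n x. \<bar>\<phi> n x\<bar> \<le> B" and R: "\<And>n x. R < norm x \<Longrightarrow> \<phi> n x = 0"
  shows "(\<lambda>n. LINT x|lebesgue. u x * \<phi> n x) \<longlonglongrightarrow> (LINT x|lebesgue. u x * \<psi> x)"
proof (rule integral_dominated_convergence)
  have [measurable]: "u \<in> borel_measurable lebesgue" using u by (simp add: loc_integrable_def)
  note m[measurable]
  show "(\<lambda>x. u x * \<psi> x) \<in> borel_measurable lebesgue" "\<And>n. (\<lambda>x. u x * \<phi> n x) \<in> borel_measurable lebesgue"
    by measurable
  show "integrable lebesgue (\<lambda>x. B * \<bar>indicator (cball 0 R) x * u x\<bar>)"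
    using u by (auto simp: loc_integrable_def)
  show "AE x in lebesgue. (\<lambda>n. u x * \<phi> n x) \<longlonglongrightarrow> u x * \<psi> x"
    by (intro AE_I2 tendsto_intros lim)
  have "\<bar>u x * \<phi> n x\<bar> \<le> B * \<bar>indicator (cball 0 R) x * u x\<bar>" for n x
  proof (cases "R < norm x")
    case False
    then show ?thesis using mult_right_mono[OF B[of n x], of "\<bar>u x\<bar>"] by (simp add: abs_mult mult.commute)
  qed (simp add: R)
  then show "AE x in lebesgue. norm (u x * \<phi> n x) \<le> B * \<bar>indicator (cball 0 R) x * u x\<bar>" for n by simp
qed

lemma loc_integrable_mult_bounded:
  assumes u: "loc_integrable u" and m: "\<phi> \<in> borel_measurable lebesgue"
    and B: "\<And>x. \<bar>\<phi> x\<bar> \<le> B" and R: "\<And>x. R < norm x \<Longrightarrow> \<phi> x = 0"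
  shows "integrable lebesgue (\<lambda>x. u x * \<phi> x)"
proof (rule Bochner_Integration.integrable_bound)
  show "integrable lebesgue (\<lambda>x. B * \<bar>indicator (cball 0 R) x * u x\<bar>)"
    using u by (auto simp: loc_integrable_def)
  show "(\<lambda>x. u x * \<phi> x) \<in> borel_measurable lebesgue"
    using u m by (auto simp: loc_integrable_def)
  have "0 \<le> B" using B[of 0] by linarith
  then have "\<bar>u x * \<phi> x\<bar> \<le> \<bar>B * \<bar>indicator (cball 0 R) x * u x\<bar>\<bar>" for x
  proof (cases "R < norm x")
    case False
    with \<open>0 \<le> B\<close> show ?thesis using mult_right_mono[OF B[of x], of "\<bar>u x\<bar>"] by (simp add: abs_mult mult.commute)
  qed (simp add: R)
  then show "AE x in lebesgue. norm (u x * \<phi> x) \<le> norm (B * \<bar>indicator (cball 0 R) x * u x\<bar>)" by simp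
qed

lemma loc_integrable_mult_ck_test:
  assumes "loc_integrable u" "ck_test k U \<phi>"
  shows "integrable lebesgue (\<lambda>x. u x * \<phi> x)"
  using ck_test_bounds[OF assms(2)] loc_integrable_mult_bounded[OF assms(1) ck_test_measurable[OF assms(2)]]
  by metis

section \<open>Translates of test functions and differentiation under the integral\<close>

lemma pd_translate:
  assumes "\<eta> differentiable (at (a + x))"
  shows "pd i (\<lambda>y. \<eta> (a + y)) x = pd i \<eta> (a + x)"
proof -
  have "((\<lambda>y::pt. a + y) has_derivative (\<lambda>v. v)) (at x)" by (auto intro!: derivative_eq_intros)
  from has_derivative_compose[OF this has_derivative_frechet[OF assms]] show ?thesis
    by (subst pd_eqI) (auto simp: pd_def)
qed

lemma ck_translate: "ck k \<eta> \<Longrightarrow> ck k (\<lambda>y. \<eta> (a + y))"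
proof (induction k arbitrary: \<eta>)
  case 0
  then show ?case by (auto intro!: continuous_on_compose2[of UNIV \<eta>] continuous_intros)
next
  case (Suc k)
  have "(\<lambda>y. \<eta> (a + y)) differentiable (at x)" for x
  proof -
    have "((\<lambda>y::pt. a + y) has_derivative (\<lambda>v. v)) (at x)" by (auto intro!: derivative_eq_intros)
    moreover have "\<eta> differentiable (at (a + x))" using Suc.prems by simp
    ultimately have "((\<lambda>y. \<eta> (a + y)) has_derivative frechet_derivative \<eta> (at (a + x))) (at x)"
      using has_derivative_compose[OF _ has_derivative_frechet] by blast
    then show ?thesis unfolding differentiable_def by blast
  qed
  moreover have "pd i (\<lambda>y. \<eta> (a + y)) = (\<lambda>y. pd i \<eta> (a + y))" for i
    using Suc.prems by (auto simp: pd_translate)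
  ultimately show ?case using Suc by simp
qed

lemma ck_test_translate:
  assumes "ck_test k UNIV \<eta>" shows "ck_test k UNIV (\<lambda>y. \<eta> (a + y))"
proof -
  have sub: "closure {y. \<eta> (a + y) \<noteq> 0} \<subseteq> (+) (- a) ` supp \<eta>"
  proof (rule closure_minimal)
    show "{y. \<eta> (a + y) \<noteq> 0} \<subseteq> (+) (- a) ` supp \<eta>"
    proof
      fix y assume "y \<in> {y. \<eta> (a + y) \<noteq> 0}"
      then have "a + y \<in> supp \<eta>" using zero_outside_support[of "a + y" \<eta>] by auto
      then show "y \<in> (+) (- a) ` supp \<eta>" by (rule rev_image_eqI) simp
    qed
    show "closed ((+) (- a) ` supp \<eta>)" by (intro closed_translation) simp
  qed
  have "compact ((+) (- a) ` supp \<eta>)"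
    using assms by (intro compact_translation) (simp add: ck_test_def)
  from compact_Int_closed[OF this closed_closure[of "{y. \<eta> (a + y) \<noteq> 0}"]] sub
  show ?thesis using assms ck_translate by (simp add: ck_test_def Int_absorb1)
qed

lemma DERIV_ck_line:
  assumes "ck (Suc k) \<eta>"
  shows "((\<lambda>t. \<eta> (a + t *\<^sub>R axis i 1)) has_real_derivative pd i \<eta> (a + t *\<^sub>R axis i 1)) (at t)"
proof -
  have "((\<lambda>t. a + t *\<^sub>R axis i (1::real)) has_derivative (\<lambda>h. h *\<^sub>R axis i 1)) (at t)"
    by (auto intro!: derivative_eq_intros)
  moreover have d: "(\<eta> has_derivative frechet_derivative \<eta> (at (a + t *\<^sub>R axis i 1))) (at (a + t *\<^sub>R axis i 1))"
    using assms by (intro has_derivative_frechet) simp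
  ultimately have "((\<lambda>t. \<eta> (a + t *\<^sub>R axis i 1)) has_derivative
      (\<lambda>h. frechet_derivative \<eta> (at (a + t *\<^sub>R axis i 1)) (h *\<^sub>R axis i 1))) (at t)"
    by (rule has_derivative_compose)
  moreover have "frechet_derivative \<eta> (at (a + t *\<^sub>R axis i 1)) (h *\<^sub>R axis i 1) = pd i \<eta> (a + t *\<^sub>R axis i 1) * h" for h
    using linear_scale[OF has_derivative_linear[OF d]] by (simp add: pd_def)
  ultimately show ?thesis by (simp add: has_field_derivative_def)
qed

lemma ck_difference_quotient_bound:
  assumes "ck (Suc k) \<eta>" and B: "\<And>x. \<bar>pd i \<eta> x\<bar> \<le> B"
  shows "\<bar>\<eta> (a + h *\<^sub>R axis i 1) - \<eta> a\<bar> \<le> B * \<bar>h\<bar>"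
proof -
  have "norm (\<eta> (a + h *\<^sub>R axis i 1) - \<eta> (a + 0 *\<^sub>R axis i 1)) \<le> B * norm (h - 0)"
    by (rule field_differentiable_bound[where S=UNIV and f'="\<lambda>t. pd i \<eta> (a + t *\<^sub>R axis i 1)"])
       (use DERIV_ck_line[OF assms(1)] B in auto)
  then show ?thesis by simp
qed

text \<open>The difference quotients of \<eta> are bounded by the mean value theorem, and along a
  bounded sequence of increments their supports stay in one ball. Dominated convergence then works
  for a merely locally integrable \<open>u\<close>: all derivatives fall on \<eta>.\<close>

lemma DERIV_integral_translate:
  assumes u: "loc_integrable u" and \<eta>: "ck_test (Suc k) UNIV \<eta>"
  shows "((\<lambda>t. LINT y|lebesgue. u y * \<eta> (x + t *\<^sub>R axis i 1 + y)) has_real_derivative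
          (LINT y|lebesgue. u y * pd i \<eta> (x + t *\<^sub>R axis i 1 + y))) (at t)"
proof -
  obtain B0 R where R: "0 < R" "\<And>x. R < norm x \<Longrightarrow> \<eta> x = 0" using ck_test_bounds[OF \<eta>] by metis
  obtain B where B: "\<And>x. \<bar>pd i \<eta> x\<bar> \<le> B" using ck_test_bounds[OF ck_test_pd[OF \<eta>]] by metis
  have ck: "ck (Suc k) \<eta>" using \<eta> by (rule ck_test_ck)
  define a where "a y = x + t *\<^sub>R axis i 1 + y" for y :: pt
  have tr: "x + (t + h) *\<^sub>R axis i 1 + y = a y + h *\<^sub>R axis i 1" for h y
    by (simp add: a_def algebra_simps)
  have int: "integrable lebesgue (\<lambda>y. u y * \<eta> (b + y))" for b
    by (rule loc_integrable_mult_ck_test[OF u ck_test_translate[OF \<eta>]])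
  have meas: "(\<lambda>y. \<eta> (b + y)) \<in> borel_measurable lebesgue" for b
    by (rule ck_test_measurable[OF ck_test_translate[OF \<eta>]])
  have measd: "(\<lambda>y. pd i \<eta> (b + y)) \<in> borel_measurable lebesgue" for b
    by (rule ck_test_measurable[OF ck_test_translate[OF ck_test_pd[OF \<eta>]]])
  show ?thesis unfolding DERIV_def
  proof (subst tendsto_at_iff_sequentially, intro allI impI)
    fix h :: "nat \<Rightarrow> real" assume h: "\<forall>n. h n \<in> UNIV - {0}" "h \<longlonglongrightarrow> 0"
    then have h0: "h n \<noteq> 0" for n by simp
    obtain M where M: "\<And>n. \<bar>h n\<bar> \<le> M"
      using Bseq_eq_bounded[of h] convergent_imp_Bseq h(2) by (metis BseqE convergent_def real_norm_def)
    define q where "q n y = (\<eta> (a y + h n *\<^sub>R axis i 1) - \<eta> (a y)) / h n" for n y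
    have "(\<lambda>n. LINT y|lebesgue. u y * q n y) \<longlonglongrightarrow> (LINT y|lebesgue. u y * pd i \<eta> (a y))"
    proof (rule loc_integrable_dominated[OF u])
      show "q n \<in> borel_measurable lebesgue" for n
        using meas[of "x + t *\<^sub>R axis i 1"] meas[of "x + t *\<^sub>R axis i 1 + h n *\<^sub>R axis i 1"]
        unfolding q_def a_def by (auto simp: add_ac)
      show "(\<lambda>y. pd i \<eta> (a y)) \<in> borel_measurable lebesgue" unfolding a_def by (rule measd)
      show "(\<lambda>n. q n y) \<longlonglongrightarrow> pd i \<eta> (a y)" for y
      proof -
        have "((\<lambda>s. (\<eta> (a y + (0 + s) *\<^sub>R axis i 1) - \<eta> (a y + 0 *\<^sub>R axis i 1)) / s) \<longlongrightarrow> pd i \<eta> (a y + 0 *\<^sub>R axis i 1)) (at 0)"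
          using DERIV_ck_line[OF ck, of "a y" i 0] by (simp only: DERIV_def)
        then have "((\<lambda>s. (\<eta> (a y + s *\<^sub>R axis i 1) - \<eta> (a y)) / s) \<longlongrightarrow> pd i \<eta> (a y)) (at 0)" by simp
        then show ?thesis unfolding q_def tendsto_at_iff_sequentially using h by (auto simp: comp_def)
      qed
      show "\<bar>q n y\<bar> \<le> B" for n y
        using ck_difference_quotient_bound[OF ck B, of "a y" "h n"] h0[of n]
        by (simp add: q_def abs_divide divide_le_eq)
      \<comment> \<open>To the radius of the support of \<eta> are added the norm of the fixed shift
        and the bound \<open>M\<close> on the increments.\<close>
      show "q n y = 0" if "R + norm (x + t *\<^sub>R axis i 1) + M < norm y" for n y
      proof -
        have "norm y \<le> norm (a y) + norm (x + t *\<^sub>R axis i 1)"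
          using norm_triangle_ineq4[of "a y" "x + t *\<^sub>R axis i 1"] by (simp add: a_def)
        then have 1: "R + M < norm (a y)" using that by linarith
        have "norm (a y) \<le> norm (a y + h n *\<^sub>R axis i 1) + norm (h n *\<^sub>R (axis i 1 :: pt))"
          using norm_triangle_ineq4[of "a y + h n *\<^sub>R axis i 1" "h n *\<^sub>R axis i 1"] by simp
        then have "norm (a y) \<le> norm (a y + h n *\<^sub>R axis i 1) + M" using M[of n] by simp
        then have "R < norm (a y + h n *\<^sub>R axis i 1)" "R < norm (a y)" using 1 M[of n] by linarith+
        then show ?thesis by (simp add: q_def R(2))
      qed
    qed
    moreover have "(LINT y|lebesgue. u y * q n y) = ((LINT y|lebesgue. u y * \<eta> (x + (t + h n) *\<^sub>R axis i 1 + y)) -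
        (LINT y|lebesgue. u y * \<eta> (x + t *\<^sub>R axis i 1 + y))) / h n" for n
    proof -
      have "(LINT y|lebesgue. u y * q n y) = (LINT y|lebesgue. (u y * \<eta> (x + (t + h n) *\<^sub>R axis i 1 + y) - u y * \<eta> (x + t *\<^sub>R axis i 1 + y)) / h n)"
        unfolding q_def tr by (simp add: a_def right_diff_distrib)
      then show ?thesis using int by simp
    qed
    ultimately show "((\<lambda>s. ((LINT y|lebesgue. u y * \<eta> (x + (t + s) *\<^sub>R axis i 1 + y)) -
        (LINT y|lebesgue. u y * \<eta> (x + t *\<^sub>R axis i 1 + y))) / s) \<circ> h)
        \<longlonglongrightarrow> (LINT y|lebesgue. u y * pd i \<eta> (x + t *\<^sub>R axis i 1 + y))"
      by (simp add: comp_def a_def)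
  qed
qed

lemma continuous_integral_translate:
  assumes u: "loc_integrable u" and \<eta>: "ck_test k UNIV \<eta>"
  shows "continuous_on UNIV (\<lambda>x. LINT y|lebesgue. u y * \<eta> (x + y))"
proof (clarsimp simp: continuous_on_sequentially comp_def)
  fix X and x :: pt assume X: "X \<longlonglongrightarrow> x"
  obtain B R where BR: "\<And>x. \<bar>\<eta> x\<bar> \<le> B" "\<And>x. R < norm x \<Longrightarrow> \<eta> x = 0" using ck_test_bounds[OF \<eta>] by metis
  obtain M where M: "\<And>n. norm (X n) \<le> M"
    using convergent_imp_Bseq X by (metis BseqE convergent_def)
  show "(\<lambda>n. LINT y|lebesgue. u y * \<eta> (X n + y)) \<longlonglongrightarrow> (LINT y|lebesgue. u y * \<eta> (x + y))"
  proof (rule loc_integrable_dominated[OF u])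
    show "(\<lambda>y. \<eta> (b + y)) \<in> borel_measurable lebesgue" for b
      by (rule ck_test_measurable[OF ck_test_translate[OF \<eta>]])
    then show "(\<lambda>y. \<eta> (x + y)) \<in> borel_measurable lebesgue" .
    show "(\<lambda>n. \<eta> (X n + y)) \<longlonglongrightarrow> \<eta> (x + y)" for y
      using ck_continuous[OF ck_test_ck[OF \<eta>]]
      by (intro continuous_on_tendsto_compose[of UNIV \<eta>] tendsto_intros X) auto
    show "\<bar>\<eta> (X n + y)\<bar> \<le> B" for n y by (rule BR)
    show "\<eta> (X n + y) = 0" if "R + M < norm y" for n y
    proof (rule BR)
      have "norm y \<le> norm (X n + y) + norm (X n)" by norm
      then show "R < norm (X n + y)" using M[of n] that by linarith
    qed
  qed
qed

lemma integral_lebesgue_translate: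
  fixes f :: "pt \<Rightarrow> real"
  assumes "continuous_on UNIV f"
  shows "(LINT y|lebesgue. f (a + y)) = (LINT y|lebesgue. f y)"
proof -
  have m: "f \<in> borel_measurable borel" by (rule borel_measurable_continuous_onI[OF assms])
  have "(LINT y|lborel. f y) = (LINT y|distr lborel borel ((+) a). f y)" by (simp add: lborel_distr_plus)
  also have "\<dots> = (LINT y|lborel. f (a + y))" by (rule integral_distr) (use m in measurable)
  finally show ?thesis using m by (simp add: integral_completion)
qed

text \<open>By translation invariance the integral of \<phi>(t e_i + y) over y does not depend on t,
  while its derivative in t is the integral of the partial derivative. This takes the place of
  iterated integration.\<close>

lemma integral_pd_zero:
  assumes \<phi>: "ck_test (Suc k) UNIV \<phi>"
  shows "(LINT x|lebesgue. pd i \<phi> x) = 0"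
proof -
  have "((\<lambda>t. LINT y|lebesgue. 1 * \<phi> (0 + t *\<^sub>R axis i 1 + y)) has_real_derivative
          (LINT y|lebesgue. 1 * pd i \<phi> (0 + 0 *\<^sub>R axis i 1 + y))) (at 0)"
    by (rule DERIV_integral_translate[OF loc_integrable_const \<phi>])
  then have "((\<lambda>t. LINT y|lebesgue. \<phi> y) has_real_derivative (LINT y|lebesgue. pd i \<phi> y)) (at 0)"
    using integral_lebesgue_translate[OF ck_continuous[OF ck_test_ck[OF \<phi>]]] by simp
  then show ?thesis by (rule DERIV_unique) simp
qed

lemma integration_by_parts:
  assumes \<phi>: "ck 1 \<phi>" and \<psi>: "ck_test 1 UNIV \<psi>"
  shows "(LINT x|lebesgue. \<phi> x * pd i \<psi> x) = - (LINT x|lebesgue. pd i \<phi> x * \<psi> x)"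
proof -
  have t: "ck_test (Suc 0) UNIV (\<lambda>x. \<phi> x * \<psi> x)" using ck_test_mult[OF \<psi> \<phi>] by simp
  have d: "\<phi> differentiable (at x)" "\<psi> differentiable (at x)" for x
    using \<phi> ck_test_ck[OF \<psi>] by auto
  have c0: "ck_test 0 UNIV (\<lambda>x. \<phi> x * pd i \<psi> x)" "ck_test 0 UNIV (\<lambda>x. pd i \<phi> x * \<psi> x)"
    using \<phi> \<psi> by (auto intro!: ck_test_mult[OF ck_test_pd] ck_test_mult[OF ck_test_mono] ck_continuous[of 1] simp: ck_test_pd)
  have "(LINT x|lebesgue. \<phi> x * pd i \<psi> x + pd i \<phi> x * \<psi> x) = 0"
    using integral_pd_zero[OF t, of i] by (simp add: pd_mult[OF d])
  moreover have "integrable lebesgue (\<lambda>x. 1 * (\<phi> x * pd i \<psi> x))" "integrable lebesgue (\<lambda>x. 1 * (pd i \<phi> x * \<psi> x))"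
    by (rule loc_integrable_mult_ck_test[OF loc_integrable_const c0(1)]
             loc_integrable_mult_ck_test[OF loc_integrable_const c0(2)])+
  ultimately show ?thesis by simp
qed

section \<open>The fundamental lemma and the maximum principle\<close>

text \<open>Cutoffs that equal 1 on \<open>K\<close> and are supported in its 1/(n+1)-neighbourhoods
  converge pointwise to the indicator of \<open>K\<close>, all inside one ball.\<close>

lemma integral_compact_zero_if_tests_zero:
  assumes u: "loc_integrable u"
    and z: "\<And>\<eta>. ck_test k UNIV \<eta> \<Longrightarrow> (LINT x|lebesgue. u x * \<eta> x) = 0"
    and K: "compact K"
  shows "(LINT x|lebesgue. u x * indicator K x) = 0"
proof -
  define V where "V n = (\<Union>x\<in>K. ball x (1 / real (Suc n)))" for n
  have "open (V n)" "K \<subseteq> V n" for n unfolding V_def by auto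
  then have "\<exists>\<eta>. ck_test k (V n) \<eta> \<and> (\<forall>x. 0 \<le> \<eta> x \<and> \<eta> x \<le> 1) \<and> (\<forall>x\<in>K. \<eta> x = 1)" for n
    using smooth_cutoff[OF K, of "V n" k] by (metis subsetD)
  then obtain \<eta> where \<eta>: "\<And>n. ck_test k (V n) (\<eta> n)" "\<And>n x. 0 \<le> \<eta> n x" "\<And>n x. \<eta> n x \<le> 1"
      "\<And>n x. x \<in> K \<Longrightarrow> \<eta> n x = 1" by metis
  obtain R where R: "\<And>x. x \<in> K \<Longrightarrow> norm x \<le> R"
    using compact_imp_bounded[OF K] by (auto simp: bounded_iff)
  have nV: "\<eta> n x = 0" if "x \<notin> V n" for n x
    using \<eta>(1)[of n] zero_outside_support[of x "\<eta> n"] that by (auto simp: ck_test_def)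
  have "(\<lambda>n. LINT x|lebesgue. u x * \<eta> n x) \<longlonglongrightarrow> (LINT x|lebesgue. u x * indicator K x)"
  proof (rule loc_integrable_dominated[OF u])
    show "\<eta> n \<in> borel_measurable lebesgue" for n by (rule ck_test_measurable[OF \<eta>(1)])
    show "indicator K \<in> borel_measurable lebesgue"
      by (intro borel_measurable_indicator fmeasurableD lmeasurable_compact K)
    show "\<bar>\<eta> n x\<bar> \<le> 1" for n x using \<eta>(2,3)[of n x] by simp
    show "\<eta> n x = 0" if "R + 1 < norm x" for n x
    proof (rule nV, rule notI)
      assume "x \<in> V n"
      then obtain y where y: "y \<in> K" "dist y x < 1 / real (Suc n)" by (auto simp: V_def)
      then have "dist y x < 1" by (rule_tac less_le_trans[OF y(2)]) simp
      then have "norm x < R + 1" using R[OF y(1)] norm_triangle_sub[of x y] by (simp add: dist_norm norm_minus_commute)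
      with that show False by simp
    qed
    show "(\<lambda>n. \<eta> n x) \<longlonglongrightarrow> indicator K x" for x
    proof (cases "x \<in> K")
      case False
      then obtain e where e: "e > 0" "ball x e \<inter> K = {}"
        using compact_imp_closed[OF K] by (metis ComplI closed_def disjoint_eq_subset_Compl open_contains_ball)
      obtain N where N: "1 / e < real N" using reals_Archimedean2 by blast
      have "\<eta> n x = 0" if "n \<ge> N" for n
      proof (rule nV, rule notI)
        assume "x \<in> V n"
        then obtain y where y: "y \<in> K" "dist y x < 1 / real (Suc n)" by (auto simp: V_def)
        have "1 / e < real (Suc n)" using N that by linarith
        then have "1 / real (Suc n) < e" using e(1) by (simp add: field_simps)
        then have "y \<in> ball x e" using y(2) by (simp add: dist_commute)
        with y(1) e(2) show False by blast
      qed
      then have "\<forall>\<^sub>F n in sequentially. \<eta> n x = 0" by (auto simp: eventually_sequentially)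
      with False show ?thesis by (simp add: tendsto_eventually)
    qed (simp add: \<eta>(4))
  qed
  moreover have "(LINT x|lebesgue. u x * \<eta> n x) = 0" for n
    by (rule z[OF ck_test_mono[OF \<eta>(1)]]) auto
  ultimately show ?thesis by (simp add: LIMSEQ_const_iff)
qed

text \<open>Every compact subset of {u > 0} is null, since \<open>u\<close> is positive on it and
  has integral 0 there; hence so is every closed subset. If the whole set had positive measure,
  inner regularity would supply a closed subset whose complement in it has strictly smaller measure,
  although removing a null set changes nothing.\<close>

lemma AE_nonpos_if_compact_integrals_zero:
  assumes u: "loc_integrable u"
    and z: "\<And>K. compact K \<Longrightarrow> (LINT x|lebesgue. u x * indicator K x) = 0"
  shows "AE x in lebesgue. u x \<le> 0"
proof -
  have um[measurable]: "u \<in> borel_measurable lebesgue" using u by (simp add: loc_integrable_def)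
  define A where "A = {x. u x > 0}"
  have A: "A \<in> sets lebesgue" unfolding A_def using measurable_sets[OF um, of "{0<..}"]
    by (simp add: vimage_def)
  have null: "K \<in> null_sets lebesgue" if K: "compact K" "K \<subseteq> A" for K
  proof -
    obtain R where R: "\<And>x. x \<in> K \<Longrightarrow> norm x \<le> R"
      using compact_imp_bounded[OF K(1)] by (auto simp: bounded_iff)
    have Ks: "K \<in> sets lebesgue" by (intro fmeasurableD lmeasurable_compact K)
    have "x \<notin> K" if "R < norm x" for x using R[of x] that by auto
    then have "integrable lebesgue (\<lambda>x. u x * indicator K x)"
      by (intro loc_integrable_mult_bounded[OF u, where B=1 and R=R])
         (use Ks in \<open>auto simp: indicator_def\<close>)
    moreover have "AE x in lebesgue. 0 \<le> u x * indicator K x"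
      using K(2) by (auto simp: A_def indicator_def intro: less_imp_le)
    ultimately have "AE x in lebesgue. u x * indicator K x = 0"
      using integral_nonneg_eq_0_iff_AE z[OF K(1)] by blast
    then have "AE x in lebesgue. x \<notin> K"
      by eventually_elim (use K(2) in \<open>auto simp: A_def indicator_def\<close>)
    then show ?thesis using Ks by (simp add: AE_iff_null_sets)
  qed
  have "emeasure lebesgue A = 0"
  proof (rule ccontr)
    assume "emeasure lebesgue A \<noteq> 0"
    then obtain e' where e': "0 < e'" "e' < emeasure lebesgue A"
      using dense[of 0 "emeasure lebesgue A"] by (auto simp: zero_less_iff_neq_zero)
    then obtain e :: real where e: "e > 0" "ennreal e < emeasure lebesgue A"
      by (cases e') (auto simp: ennreal_less_zero_iff)
    obtain T where T: "closed T" "T \<subseteq> A" "A - T \<in> lmeasurable" "emeasure lebesgue (A - T) < ennreal e"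
      using sets_lebesgue_inner_closed[OF A e(1)] by blast
    have Tm: "T \<in> sets lebesgue" using T(1) by auto
    have "(\<Union>n::nat. T \<inter> cball 0 (real n)) \<in> null_sets lebesgue"
      by (intro null_sets_UN null) (use T in \<open>auto simp: closed_Int_compact\<close>)
    moreover have "(\<Union>n::nat. T \<inter> cball 0 (real n)) = T"
      using real_arch_simple by (auto simp: norm_conv_dist[symmetric])
    ultimately have "T \<in> null_sets lebesgue" by simp
    then have "emeasure lebesgue (A - T) = emeasure lebesgue A" using A by (simp add: emeasure_Diff_null_set)
    with T(4) e(2) show False by simp
  qed
  then have "A \<in> null_sets lebesgue" using A by auto
  then have "AE x in lebesgue. x \<notin> A" by (rule AE_not_in)
  then show ?thesis by eventually_elim (simp add: A_def not_less)
qed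

lemma loc_integrable_uminus: "loc_integrable u \<Longrightarrow> loc_integrable (\<lambda>x. - u x)"
  by (auto simp: loc_integrable_def)

lemma fundamental_lemma_variations:
  assumes u: "loc_integrable u"
    and z: "\<And>\<eta>. ck_test k UNIV \<eta> \<Longrightarrow> (LINT x|lebesgue. u x * \<eta> x) = 0"
  shows "AE x in lebesgue. u x = 0"
proof -
  have "AE x in lebesgue. u x \<le> 0"
    by (intro AE_nonpos_if_compact_integrals_zero u integral_compact_zero_if_tests_zero[OF u z])
  moreover have "AE x in lebesgue. - u x \<le> 0"
    using z by (intro AE_nonpos_if_compact_integrals_zero integral_compact_zero_if_tests_zero[where k=k]
        loc_integrable_uminus u) auto
  ultimately show ?thesis by eventually_elim simp
qed

section \<open>Maximum principle and uniqueness for the equation \<Delta>u = u\<close>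

lemma second_derivative_at_max_nonpos:
  fixes f f' :: "real \<Rightarrow> real"
  assumes f: "\<And>t. (f has_real_derivative f' t) (at t)" and f': "(f' has_real_derivative d) (at 0)"
    and max: "\<And>t. f t \<le> f 0"
  shows "d \<le> 0"
proof (rule ccontr)
  assume "\<not> d \<le> 0"
  then have d: "d > 0" by simp
  \<comment> \<open>As f'(0) = 0 and d > 0, f' is positive just to the right of 0, and the mean
    value theorem lifts \<open>f\<close> above its maximum.\<close>
  have f'0: "f' 0 = 0"
    by (rule DERIV_local_max[of f "f' 0" 0 1]) (use f max in auto)
  obtain e where e: "e > 0" "\<And>h. 0 < h \<Longrightarrow> h < e \<Longrightarrow> f' 0 < f' (0 + h)"
    using DERIV_pos_inc_right[OF f' d] by auto
  obtain z where z: "z > 0" "z < e / 2" "f (e / 2) - f 0 = (e / 2 - 0) * f' z"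
    using MVT2[of 0 "e / 2" f f'] f e(1) by auto
  have "f' z > 0" using e(2)[of z] z f'0 e(1) by simp
  then have "f (e / 2) - f 0 > 0" unfolding z(3) using e(1) by simp
  with max[of "e / 2"] show False by simp
qed

text \<open>The barrier \<open>\<epsilon> |x|\<^sup>2\<close> makes the supremum of \<open>\<Phi> - \<epsilon> |x|\<^sup>2\<close> attained.\<close>
lemma bounded_solution_laplace_eq_self_nonpos:
  fixes \<Phi> :: "pt \<Rightarrow> real"
  assumes cont: "continuous_on UNIV \<Phi>" and bdd: "\<And>x. \<bar>\<Phi> x\<bar> \<le> C"
    and d1: "\<And>x i t. ((\<lambda>t. \<Phi> (x + t *\<^sub>R axis i 1)) has_real_derivative D i (x + t *\<^sub>R axis i 1)) (at t)"
    and d2: "\<And>x i t. ((\<lambda>t. D i (x + t *\<^sub>R axis i 1)) has_real_derivative E i (x + t *\<^sub>R axis i 1)) (at t)"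
    and lap: "\<And>x. (\<Sum>i\<in>UNIV. E i x) = \<Phi> x"
  shows "\<Phi> x \<le> 0"
proof -
  \<comment> \<open>The 6 is the Laplacian of |x|^2 in dimension three: at the maximum of the
    function with barrier each second derivative of \<Phi> is at most 2 \<epsilon>.\<close>
  have est: "\<Phi> y \<le> \<epsilon> * (6 + (norm y)\<^sup>2)" if \<epsilon>: "\<epsilon> > 0" for \<epsilon> y
  proof -
    define V where "V x = \<Phi> x - \<epsilon> * (norm x)\<^sup>2" for x
    \<comment> \<open>As R >= 1, outside this ball \<epsilon> |x|^2 is at least \<epsilon> R =
      \<epsilon> + 2 C + 1, more than \<Phi> can vary; so the maximum over the ball is a global
      one.\<close>
    define R where "R = 1 + (2 * C + 1) / \<epsilon>"
    have C: "C \<ge> 0" using bdd[of 0] by linarith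
    have R: "R \<ge> 1" using C \<epsilon> by (simp add: R_def)
    have "continuous_on (cball 0 R) V" unfolding V_def
      by (intro continuous_intros continuous_on_subset[OF cont]) auto
    then obtain z where z: "z \<in> cball 0 R" "\<And>x. x \<in> cball 0 R \<Longrightarrow> V x \<le> V z"
      using continuous_attains_sup[of "cball 0 R" V] R by auto
    have zmax: "V x \<le> V z" for x
    proof (cases "x \<in> cball 0 R")
      case False
      then have "R < norm x" by simp
      then have "R * 1 \<le> norm x * norm x" using R by (intro mult_mono) auto
      then have "\<epsilon> * R \<le> \<epsilon> * (norm x)\<^sup>2" using \<epsilon> by (simp add: power2_eq_square)
      moreover have "\<epsilon> * R = \<epsilon> + (2 * C + 1)" using \<epsilon> by (simp add: R_def field_simps)
      ultimately have "V x \<le> C - (2 * C + 1)" using bdd[of x] \<epsilon> unfolding V_def by linarith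
      also have "\<dots> \<le> V 0" using bdd[of 0] by (simp add: V_def)
      also have "\<dots> \<le> V z" using z(2)[of 0] R by simp
      finally show ?thesis .
    qed (rule z)
    have n2: "(norm (z + t *\<^sub>R axis i 1))\<^sup>2 = (norm z)\<^sup>2 + 2 * t * z $ i + t\<^sup>2" for i t
      by (simp only: power2_norm_eq_inner inner_add_left inner_add_right inner_scaleR_left inner_scaleR_right)
         (simp add: inner_commute inner_axis power2_eq_square algebra_simps)
    have "E i z - 2 * \<epsilon> \<le> 0" for i
    proof (rule second_derivative_at_max_nonpos)
      fix t
      show "((\<lambda>t. V (z + t *\<^sub>R axis i 1)) has_real_derivative
          (D i (z + t *\<^sub>R axis i 1) - \<epsilon> * (2 * z $ i + 2 * t))) (at t)"
        unfolding V_def n2 by (rule derivative_eq_intros d1 refl)+ simp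
      show "V (z + t *\<^sub>R axis i 1) \<le> V (z + 0 *\<^sub>R axis i 1)" using zmax by simp
      have "((\<lambda>t. D i (z + t *\<^sub>R axis i 1) - \<epsilon> * (2 * z $ i + 2 * t)) has_real_derivative
          (E i (z + 0 *\<^sub>R axis i 1) - \<epsilon> * 2)) (at 0)"
        by (rule derivative_eq_intros d2 refl)+ simp
      then show "((\<lambda>t. D i (z + t *\<^sub>R axis i 1) - \<epsilon> * (2 * z $ i + 2 * t)) has_real_derivative
          (E i z - 2 * \<epsilon>)) (at 0)" by (simp add: mult.commute)
    qed
    then have "(\<Sum>i\<in>UNIV. E i z) \<le> (\<Sum>i\<in>(UNIV::3 set). 2 * \<epsilon>)" by (intro sum_mono) simp
    then have "\<Phi> z \<le> 6 * \<epsilon>" using lap[of z] by simp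
    moreover have "V y \<le> V z" by (rule zmax)
    moreover have "0 \<le> \<epsilon> * (norm z)\<^sup>2" using \<epsilon> by simp
    ultimately show ?thesis unfolding V_def by (simp add: algebra_simps)
  qed
  have "\<Phi> x \<le> 0 + e" if e: "e > 0" for e
  proof -
    have p: "6 + (norm x)\<^sup>2 > 0" by (simp add: add_pos_nonneg)
    then have "\<Phi> x \<le> e / (6 + (norm x)\<^sup>2) * (6 + (norm x)\<^sup>2)" using e by (intro est) simp
    then show ?thesis using p by simp
  qed
  then show ?thesis by (rule field_le_epsilon)
qed

lemma ck_test_sq_integrable:
  assumes "ck_test k U \<phi>" shows "sq_integrable \<phi>"
proof -
  have "ck_test 0 U (\<lambda>x. \<phi> x * \<phi> x)"
    using assms by (intro ck_test_mult ck_test_mono[OF assms]) (auto simp: ck_test_def ck_continuous)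
  from loc_integrable_mult_ck_test[OF loc_integrable_const[of 1] this]
  show ?thesis using ck_test_measurable[OF assms] by (simp add: sq_integrable_def power2_eq_square)
qed

lemma sq_integrable_translate_ck_test:
  assumes "ck_test k UNIV \<phi>"
  shows "(LINT y|lebesgue. (\<phi> (a + y))\<^sup>2) = (LINT y|lebesgue. (\<phi> y)\<^sup>2)"
  by (rule integral_lebesgue_translate[where f="\<lambda>x. (\<phi> x)\<^sup>2"])
     (intro continuous_intros ck_continuous[OF ck_test_ck[OF assms]])

text \<open>Let \<Phi>(x) be the integral of u(y) \<eta>(x + y) over y. Testing with translates of
  \<eta> gives \<Delta>\<Phi> = \<Phi>, and \<Phi> is bounded because all translates of \<eta> have
  the same L^2 norm. Its value at 0 is the integral that has to vanish.\<close>

lemma weak_helmholtz_zero: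
  assumes u: "sq_integrable (u :: pt \<Rightarrow> real)"
    and weak: "\<And>\<eta>. ck_test 3 UNIV \<eta> \<Longrightarrow> (LINT x|lebesgue. u x * lap \<eta> x) = (LINT x|lebesgue. u x * \<eta> x)"
  shows "AE x in lebesgue. u x = 0"
proof (rule fundamental_lemma_variations[where k=3])
  have u': "loc_integrable u" by (rule sq_integrable_imp_loc_integrable[OF u])
  then show "loc_integrable u" .
  \<comment> \<open>Stated for its own \<open>u\<close> so that it also applies to -u; the maximum
    principle yields only one sign.\<close>
  have le: "(LINT x|lebesgue. u x * \<eta> x) \<le> 0"
    if uu: "sq_integrable (u :: pt \<Rightarrow> real)"
      and weak: "\<And>\<eta>. ck_test 3 UNIV \<eta> \<Longrightarrow> (LINT x|lebesgue. u x * lap \<eta> x) = (LINT x|lebesgue. u x * \<eta> x)"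
      and \<eta>: "ck_test 3 UNIV \<eta>" for u \<eta>
  proof -
    have u: "loc_integrable u" by (rule sq_integrable_imp_loc_integrable[OF uu])
    have \<eta>3: "ck_test (Suc (Suc (Suc 0))) UNIV \<eta>" using \<eta> by (simp add: eval_nat_numeral)
    note \<eta>1 = ck_test_pd[OF \<eta>3] and \<eta>2 = ck_test_pd[OF ck_test_pd[OF \<eta>3]]
    define \<Phi> where "\<Phi> x = (LINT y|lebesgue. u y * \<eta> (x + y))" for x
    have "\<Phi> 0 \<le> 0"
    proof (rule bounded_solution_laplace_eq_self_nonpos)
      show "continuous_on UNIV \<Phi>" unfolding \<Phi>_def by (rule continuous_integral_translate[OF u \<eta>])
      show "((\<lambda>t. \<Phi> (x + t *\<^sub>R axis i 1)) has_real_derivative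
          (LINT y|lebesgue. u y * pd i \<eta> (x + t *\<^sub>R axis i 1 + y))) (at t)" for x i t
        unfolding \<Phi>_def by (rule DERIV_integral_translate[OF u \<eta>3])
      show "((\<lambda>t. LINT y|lebesgue. u y * pd i \<eta> (x + t *\<^sub>R axis i 1 + y)) has_real_derivative
          (LINT y|lebesgue. u y * pd i (pd i \<eta>) (x + t *\<^sub>R axis i 1 + y))) (at t)" for x i t
        by (rule DERIV_integral_translate[OF u \<eta>1])
      show "(\<Sum>i\<in>UNIV. LINT y|lebesgue. u y * pd i (pd i \<eta>) (x + y)) = \<Phi> x" for x
      proof -
        have "lap (\<lambda>y. \<eta> (x + y)) y = (\<Sum>i\<in>UNIV. pd i (pd i \<eta>) (x + y))" for y
        proof -
          have "pd i (\<lambda>y. \<eta> (x + y)) = (\<lambda>y. pd i \<eta> (x + y))" for i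
            using ck_test_ck[OF \<eta>3] by (auto simp: pd_translate)
          moreover have "pd i (\<lambda>y. pd i \<eta> (x + y)) y = pd i (pd i \<eta>) (x + y)" for i
            using ck_test_ck[OF \<eta>1] by (auto simp: pd_translate)
          ultimately show ?thesis by (simp add: lap_def)
        qed
        then have "\<Phi> x = (LINT y|lebesgue. (\<Sum>i\<in>UNIV. u y * pd i (pd i \<eta>) (x + y)))"
          using weak[OF ck_test_translate[OF \<eta>, of x]] by (simp add: \<Phi>_def sum_distrib_left)
        also have "\<dots> = (\<Sum>i\<in>UNIV. LINT y|lebesgue. u y * pd i (pd i \<eta>) (x + y))"
          by (intro Bochner_Integration.integral_sum loc_integrable_mult_ck_test[OF u ck_test_translate[OF \<eta>2]])
        finally show ?thesis by simp
      qed
      show "\<bar>\<Phi> x\<bar> \<le> (LINT y|lebesgue. (u y)\<^sup>2) + (LINT y|lebesgue. (\<eta> y)\<^sup>2)" for x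
      proof -
        have i: "integrable lebesgue (\<lambda>y. (u y)\<^sup>2)" using uu by (simp add: sq_integrable_def)
        have i': "integrable lebesgue (\<lambda>y. (\<eta> (x + y))\<^sup>2)"
          using ck_test_sq_integrable[OF ck_test_translate[OF \<eta>]] by (simp add: sq_integrable_def)
        have "\<bar>\<Phi> x\<bar> \<le> (LINT y|lebesgue. \<bar>u y * \<eta> (x + y)\<bar>)" unfolding \<Phi>_def by (rule integral_abs_bound)
        also have "\<dots> \<le> (LINT y|lebesgue. (u y)\<^sup>2 + (\<eta> (x + y))\<^sup>2)"
        proof (rule integral_mono)
          show "integrable lebesgue (\<lambda>y. \<bar>u y * \<eta> (x + y)\<bar>)"
            by (intro integrable_abs loc_integrable_mult_ck_test[OF u ck_test_translate[OF \<eta>]])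
          show "integrable lebesgue (\<lambda>y. (u y)\<^sup>2 + (\<eta> (x + y))\<^sup>2)" using i i' by simp
          show "\<bar>u y * \<eta> (x + y)\<bar> \<le> (u y)\<^sup>2 + (\<eta> (x + y))\<^sup>2" for y
            using sum_squares_bound[of "\<bar>u y\<bar>" "\<bar>\<eta> (x + y)\<bar>"] abs_ge_zero[of "u y * \<eta> (x + y)"]
            unfolding abs_mult power2_abs mult.assoc by linarith
        qed
        also have "\<dots> = (LINT y|lebesgue. (u y)\<^sup>2) + (LINT y|lebesgue. (\<eta> y)\<^sup>2)"
          using i i' by (simp add: sq_integrable_translate_ck_test[OF \<eta>])
        finally show ?thesis .
      qed
    qed
    then show ?thesis by (simp add: \<Phi>_def)
  qed
  fix \<eta> assume \<eta>: "ck_test 3 UNIV \<eta>"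
  have "(LINT x|lebesgue. - u x * \<eta> x) \<le> 0"
    by (rule le[OF sq_integrable_uminus[OF u] _ \<eta>]) (simp add: weak)
  moreover have "(LINT x|lebesgue. u x * \<eta> x) \<le> 0" by (rule le[OF u weak \<eta>])
  ultimately show "(LINT x|lebesgue. u x * \<eta> x) = 0" by simp
qed

section \<open>The Sobolev space of jets\<close>

type_synonym jet = "complex \<times> (complex, 3) vec"

lemma sq_integrable_bounded_linear:
  fixes T :: "'b::euclidean_space \<Rightarrow> 'c::euclidean_space"
  assumes f: "sq_integrable f" and T: "bounded_linear T"
  shows "sq_integrable (\<lambda>x. T (f x))"
proof -
  obtain K where K: "\<And>v. norm (T v) \<le> K * norm v"
    using bounded_linear.bounded[OF T] by (auto simp: mult.commute)
  have "(\<lambda>x. T (f x)) \<in> borel_measurable lebesgue"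
    using borel_measurable_continuous_on[OF linear_continuous_on[OF T]] f by (auto simp: sq_integrable_def)
  then show ?thesis by (rule sq_integrable_bound[OF f, where C=K]) (simp add: K)
qed

lemma jet_eq_sum: "(u, g) = (u, 0) + (\<Sum>i\<in>UNIV. (0, axis i (g $ i)))" for g :: "(complex, 3) vec"
  by (simp add: prod_eq_iff fst_sum snd_sum vec_eq_iff axis_def)

lemma sq_integrable_sum:
  "(\<And>a. a \<in> A \<Longrightarrow> sq_integrable (f a)) \<Longrightarrow> sq_integrable (\<lambda>x. \<Sum>a\<in>A. f a x)"
  by (induction A rule: infinite_finite_induct) (auto intro: sq_integrable_add sq_integrable_zero)

abbreviation mk_jet :: "('a \<Rightarrow> complex) \<Rightarrow> (3 \<Rightarrow> 'a \<Rightarrow> complex) \<Rightarrow> 'a \<Rightarrow> jet" where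
  "mk_jet u g \<equiv> \<lambda>x. (u x, \<chi> i. g i x)"

lemma sq_integrable_jetI:
  fixes u :: "'a::euclidean_space \<Rightarrow> complex" and g :: "3 \<Rightarrow> 'a \<Rightarrow> complex"
  assumes "sq_integrable u" "\<And>i. sq_integrable (g i)"
  shows "sq_integrable (mk_jet u g)"
proof -
  have "bounded_linear (\<lambda>c::complex. (c, 0 :: (complex, 3) vec))"
    by (intro bounded_linear_Pair bounded_linear_ident bounded_linear_zero)
  moreover have "bounded_linear (\<lambda>c::complex. (0 :: complex, axis i c :: (complex, 3) vec))" for i
    by (rule linear_conv_bounded_linear[THEN iffD1], rule linearI) (auto simp: axis_def vec_eq_iff)
  ultimately have "sq_integrable (\<lambda>x. (u x, 0) + (\<Sum>i\<in>UNIV. (0, axis i (g i x) :: (complex, 3) vec)))"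
    using assms by (intro sq_integrable_add sq_integrable_sum) (auto intro: sq_integrable_bounded_linear)
  then show ?thesis by (subst jet_eq_sum) simp
qed

lemma bounded_linear_snd_nth: "bounded_linear (\<lambda>v::jet. snd v $ i)"
  using bounded_linear_compose[OF bounded_linear_vec_nth bounded_linear_snd] .

lemma sq_integrable_jet_fst: "sq_integrable F \<Longrightarrow> sq_integrable (\<lambda>x. fst (F x :: jet))"
  by (rule sq_integrable_bounded_linear[OF _ bounded_linear_fst])

lemma sq_integrable_jet_snd: "sq_integrable F \<Longrightarrow> sq_integrable (\<lambda>x. snd (F x :: jet) $ i)"
  by (rule sq_integrable_bounded_linear[OF _ bounded_linear_snd_nth])

lemma sq_integrable_test_scaleR:
  "ck_test k U \<phi> \<Longrightarrow> sq_integrable (\<lambda>x. \<phi> x *\<^sub>R (z::'b::euclidean_space))"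
  by (rule sq_integrable_bounded_linear[OF ck_test_sq_integrable bounded_linear_scaleR_left])

lemma integrable_test_scaleR:
  fixes f :: "pt \<Rightarrow> 'b::euclidean_space"
  assumes "sq_integrable f" "ck_test k U \<phi>"
  shows "integrable lebesgue (\<lambda>x. \<phi> x *\<^sub>R f x)"
proof -
  have m: "f \<in> borel_measurable lebesgue" using assms(1) by (simp add: sq_integrable_def)
  have "sq_integrable (\<lambda>x. norm (f x))" using assms(1) m by (auto simp: sq_integrable_def)
  from sq_integrable_inner[OF ck_test_sq_integrable[OF assms(2)] this]
  have "integrable lebesgue (\<lambda>x. \<phi> x * norm (f x))" by simp
  then show ?thesis
    by (rule Bochner_Integration.integrable_bound) (use m ck_test_measurable[OF assms(2)] in \<open>auto simp: abs_mult\<close>)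
qed

text \<open>Test functions are real, so a complex constant \<open>z\<close> is attached; letting it
  range over all complex numbers recovers a complex identity from the real inner product.\<close>

definition jet :: "(pt \<Rightarrow> real) \<Rightarrow> complex \<Rightarrow> pt \<Rightarrow> jet" where
  "jet \<phi> z x = (\<phi> x *\<^sub>R z, \<chi> i. pd i \<phi> x *\<^sub>R z)"

text \<open>The inner product of (u, g) with this vector is the real part of conj(z) times the
  integral of u \<partial>_i\<phi> + g_i \<phi>. The defining identity of a weak derivative thus
  becomes an orthogonality condition in L^2.\<close>

definition weak_test :: "3 \<Rightarrow> (pt \<Rightarrow> real) \<Rightarrow> complex \<Rightarrow> pt \<Rightarrow> jet" where
  "weak_test i \<phi> z x = (pd i \<phi> x *\<^sub>R z, \<chi> k. (if k = i then \<phi> x else 0) *\<^sub>R z)"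

lemma sq_integrable_jet: "ck_test (Suc k) UNIV \<phi> \<Longrightarrow> sq_integrable (jet \<phi> z)"
  unfolding jet_def by (intro sq_integrable_jetI sq_integrable_test_scaleR[where k="k" and U=UNIV] ck_test_pd)
    (auto intro: ck_test_mono)

lemma sq_integrable_weak_test: "ck_test (Suc k) UNIV \<phi> \<Longrightarrow> sq_integrable (weak_test i \<phi> z)"
  unfolding weak_test_def
proof (intro sq_integrable_jetI)
  assume \<phi>: "ck_test (Suc k) UNIV \<phi>"
  show "sq_integrable (\<lambda>x. pd i \<phi> x *\<^sub>R z)" by (rule sq_integrable_test_scaleR[OF ck_test_pd[OF \<phi>]])
  show "sq_integrable (\<lambda>x. (if k = i then \<phi> x else 0) *\<^sub>R z)" for k
    using sq_integrable_test_scaleR[OF \<phi>, of z] by (cases "k = i") (simp_all add: sq_integrable_zero)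
qed

lemma inner_l2_jet:
  assumes F: "sq_integrable F" and \<phi>: "ck_test (Suc k) UNIV \<phi>"
  shows "inner (l2_of F) (l2_of (jet \<phi> z)) =
    inner (LINT x|lebesgue. \<phi> x *\<^sub>R fst (F x) + (\<Sum>i\<in>UNIV. pd i \<phi> x *\<^sub>R snd (F x) $ i)) z"
proof -
  have "integrable lebesgue (\<lambda>x. \<phi> x *\<^sub>R fst (F x) + (\<Sum>i\<in>UNIV. pd i \<phi> x *\<^sub>R snd (F x) $ i))"
    by (intro Bochner_Integration.integrable_add Bochner_Integration.integrable_sum
        integrable_test_scaleR[OF sq_integrable_jet_fst[OF F] \<phi>]
        integrable_test_scaleR[OF sq_integrable_jet_snd[OF F] ck_test_pd[OF \<phi>]])
  then have "inner (LINT x|lebesgue. \<phi> x *\<^sub>R fst (F x) + (\<Sum>i\<in>UNIV. pd i \<phi> x *\<^sub>R snd (F x) $ i)) z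
      = (LINT x|lebesgue. inner (\<phi> x *\<^sub>R fst (F x) + (\<Sum>i\<in>UNIV. pd i \<phi> x *\<^sub>R snd (F x) $ i)) z)"
    by (intro integral_inner_left[symmetric])
  also have "\<dots> = (LINT x|lebesgue. inner (F x) (jet \<phi> z x))"
    by (simp add: jet_def inner_prod_def inner_vec_def inner_add_left inner_sum_left)
  finally show ?thesis using inner_l2_of[OF F sq_integrable_jet[OF \<phi>]] by simp
qed

lemma inner_l2_weak_test:
  assumes F: "sq_integrable F" and \<phi>: "ck_test (Suc k) UNIV \<phi>"
  shows "inner (l2_of F) (l2_of (weak_test i \<phi> z)) =
    inner ((LINT x|lebesgue. pd i \<phi> x *\<^sub>R fst (F x)) + (LINT x|lebesgue. \<phi> x *\<^sub>R snd (F x) $ i)) z"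
proof -
  have i: "integrable lebesgue (\<lambda>x. pd i \<phi> x *\<^sub>R fst (F x))" "integrable lebesgue (\<lambda>x. \<phi> x *\<^sub>R snd (F x) $ i)"
    by (rule integrable_test_scaleR[OF sq_integrable_jet_fst[OF F] ck_test_pd[OF \<phi>]]
             integrable_test_scaleR[OF sq_integrable_jet_snd[OF F] \<phi>])+
  have "inner (LINT x|lebesgue. pd i \<phi> x *\<^sub>R fst (F x) + \<phi> x *\<^sub>R snd (F x) $ i) z
      = (LINT x|lebesgue. inner (pd i \<phi> x *\<^sub>R fst (F x) + \<phi> x *\<^sub>R snd (F x) $ i) z)"
    using i by (intro integral_inner_left[symmetric]) simp
  also have "\<dots> = (LINT x|lebesgue. inner (F x) (weak_test i \<phi> z x))"
    by (simp add: weak_test_def inner_prod_def inner_vec_def inner_add_left if_distrib[of "\<lambda>c. c * _"] cong: if_cong)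
  finally show ?thesis using inner_l2_of[OF F sq_integrable_weak_test[OF \<phi>]] i by simp
qed

text \<open>The index is the regularity of the test functions, so a smaller \<open>k\<close> is the
  stronger condition.\<close>

definition weak_jets :: "nat \<Rightarrow> (pt, jet) l2 set" where
  "weak_jets k = {F. \<forall>i \<phi> z. ck_test k UNIV \<phi> \<longrightarrow> inner F (l2_of (weak_test i \<phi> z)) = 0}"

text \<open>This is H^1: the L^2 norm of the pair (u, gradient of u) is the H^1 norm, and being
  closed in a complete space the set supports projections and Lax--Milgram.\<close>

definition sobolev :: "(pt, jet) l2 set" where
  "sobolev = closure (span {l2_of (jet \<phi> z) | \<phi> z. ck_test 3 UNIV \<phi>})"

lemma subspace_weak_jets: "subspace (weak_jets k)"
  by (auto simp: subspace_def weak_jets_def inner_add_left)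

lemma closed_weak_jets: "closed (weak_jets k)"
proof -
  have "weak_jets k = (\<Inter>(i, \<phi>, z)\<in>UNIV \<times> Collect (ck_test k UNIV) \<times> UNIV. {F. inner F (l2_of (weak_test i \<phi> z)) = 0})"
    by (auto simp: weak_jets_def)
  also have "closed \<dots>"
    by (intro closed_INT ballI) (auto simp: case_prod_beta intro!: closed_Collect_eq continuous_intros)
  finally show ?thesis .
qed

lemma subspace_closure_subspace:
  fixes S :: "'a::real_normed_vector set"
  assumes S: "subspace S"
  shows "subspace (closure S)"
  unfolding subspace_def
proof (intro conjI ballI allI)
  show "0 \<in> closure S" using subspace_0[OF S] closure_subset by blast
  fix x y and c :: real assume "x \<in> closure S"
  then obtain X where X: "\<And>n. X n \<in> S" "X \<longlonglongrightarrow> x" unfolding closure_sequential by blast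
  show "c *\<^sub>R x \<in> closure S" unfolding closure_sequential
    by (intro exI[of _ "\<lambda>n. c *\<^sub>R X n"] conjI allI subspace_scale[OF S] tendsto_intros X)
  assume "y \<in> closure S"
  then obtain Y where Y: "\<And>n. Y n \<in> S" "Y \<longlonglongrightarrow> y" unfolding closure_sequential by blast
  show "x + y \<in> closure S" unfolding closure_sequential
    by (intro exI[of _ "\<lambda>n. X n + Y n"] conjI allI subspace_add[OF S] tendsto_intros X Y)
qed

lemma subspace_sobolev: "subspace sobolev"
  unfolding sobolev_def by (intro subspace_closure_subspace subspace_span)

lemma closed_sobolev: "closed sobolev"
  by (simp add: sobolev_def)

lemma inner_eq_zero_all_complex: "(\<And>z. inner c z = 0) \<Longrightarrow> c = (0::complex)"
  using inner_eq_zero_iff[of c] by simp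

lemma weak_jets_iff:
  assumes F: "sq_integrable F"
  shows "l2_of F \<in> weak_jets (Suc k) \<longleftrightarrow> (\<forall>i \<phi>. ck_test (Suc k) UNIV \<phi> \<longrightarrow>
     (LINT x|lebesgue. pd i \<phi> x *\<^sub>R fst (F x)) = - (LINT x|lebesgue. \<phi> x *\<^sub>R snd (F x) $ i))"
  (is "_ \<longleftrightarrow> (\<forall>i \<phi>. _ \<longrightarrow> ?a i \<phi> = - ?b i \<phi>)")
proof -
  have "l2_of F \<in> weak_jets (Suc k) \<longleftrightarrow> (\<forall>i \<phi>. ck_test (Suc k) UNIV \<phi> \<longrightarrow> (\<forall>z. inner (?a i \<phi> + ?b i \<phi>) z = 0))"
    by (auto simp: weak_jets_def inner_l2_weak_test[OF F])
  also have "\<dots> \<longleftrightarrow> (\<forall>i \<phi>. ck_test (Suc k) UNIV \<phi> \<longrightarrow> ?a i \<phi> = - ?b i \<phi>)"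
    using inner_eq_zero_all_complex by (simp only: eq_neg_iff_add_eq_0) fastforce
  finally show ?thesis .
qed

lemma weak_jets_antimono: "j \<le> k \<Longrightarrow> weak_jets j \<subseteq> weak_jets k"
  by (auto simp: weak_jets_def intro: ck_test_mono)

lemma jet_in_weak_jets:
  assumes \<phi>: "ck_test 1 UNIV \<phi>"
  shows "l2_of (jet \<phi> z) \<in> weak_jets 1"
proof -
  have si: "sq_integrable (jet \<phi> z)" by (rule sq_integrable_jet[of 0]) (use \<phi> in simp)
  have "(LINT x|lebesgue. pd i \<psi> x *\<^sub>R \<phi> x *\<^sub>R z) = - (LINT x|lebesgue. \<psi> x *\<^sub>R pd i \<phi> x *\<^sub>R z)"
    if \<psi>: "ck_test 1 UNIV \<psi>" for i \<psi>
  proof -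
    have i: "integrable lebesgue (\<lambda>x. \<phi> x * pd i \<psi> x)" "integrable lebesgue (\<lambda>x. pd i \<phi> x * \<psi> x)"
      using integrable_test_scaleR[OF ck_test_sq_integrable[OF \<phi>] ck_test_pd[of 0 UNIV \<psi> i]]
        integrable_test_scaleR[OF ck_test_sq_integrable[OF \<psi>] ck_test_pd[of 0 UNIV \<phi> i]] \<phi> \<psi>
      by (auto simp: mult.commute)
    have "(LINT x|lebesgue. pd i \<psi> x *\<^sub>R \<phi> x *\<^sub>R z) = (LINT x|lebesgue. \<phi> x * pd i \<psi> x) *\<^sub>R z"
      using i by (simp add: mult.commute)
    also have "\<dots> = - ((LINT x|lebesgue. pd i \<phi> x * \<psi> x) *\<^sub>R z)"
      using integration_by_parts[OF ck_test_ck[OF \<phi>] \<psi>] by simp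
    also have "\<dots> = - (LINT x|lebesgue. \<psi> x *\<^sub>R pd i \<phi> x *\<^sub>R z)"
      using i by (simp add: mult.commute)
    finally show ?thesis .
  qed
  then show ?thesis using weak_jets_iff[OF si, of 0] by (simp add: jet_def)
qed

lemma sobolev_subset_weak_jets: "sobolev \<subseteq> weak_jets 1"
  unfolding sobolev_def
proof (rule closure_minimal[OF span_minimal])
  show "{l2_of (jet \<phi> z) |\<phi> z. ck_test 3 UNIV \<phi>} \<subseteq> weak_jets 1"
    using jet_in_weak_jets ck_test_mono[of 3 UNIV _ 1 UNIV] by auto
qed (rule subspace_weak_jets closed_weak_jets)+

lemma jet3_in_sobolev: "ck_test 3 UNIV \<phi> \<Longrightarrow> l2_of (jet \<phi> z) \<in> sobolev"
  unfolding sobolev_def by (intro subsetD[OF closure_subset] span_base) auto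

lemma sq_integrable_inner_const:
  "sq_integrable f \<Longrightarrow> sq_integrable (\<lambda>x. inner (f x) z)"
  by (rule sq_integrable_bounded_linear[OF _ bounded_linear_inner_left])

lemma AE_zero_if_inner_zero:
  fixes f :: "pt \<Rightarrow> complex"
  assumes "\<And>z. AE x in lebesgue. inner (f x) z = 0"
  shows "AE x in lebesgue. f x = 0"
  using assms[of 1] assms[of \<i>] by eventually_elim (simp add: inner_complex_def complex_eq_iff)

text \<open>Orthogonality to the jets of a C^3 function \<eta> says that \<open>u\<close> against
  \<eta> is minus the gradient of \<open>u\<close> against that of \<eta>. Each \<partial>_i\<eta>
  is C^2, just what \<open>weak_jets 2\<close> admits as a test function, so the right side is
  \<open>u\<close> against \<Delta>\<eta>. Hence u = 0, and then its weak gradient vanishes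
  too.\<close>

lemma weak_jet_orthogonal_sobolev_zero:
  assumes F: "F \<in> weak_jets 2" and orth: "\<And>G. G \<in> sobolev \<Longrightarrow> inner F G = 0"
  shows "F = 0"
proof -
  define f where "f = l2_fun F"
  have f: "sq_integrable f" and Ff: "F = l2_of f" by (simp_all add: f_def)
  have iu: "integrable lebesgue (\<lambda>x. \<phi> x *\<^sub>R fst (f x))" if "ck_test k UNIV \<phi>" for k \<phi>
    by (rule integrable_test_scaleR[OF sq_integrable_jet_fst[OF f] that])
  have ig: "integrable lebesgue (\<lambda>x. \<phi> x *\<^sub>R snd (f x) $ i)" if "ck_test k UNIV \<phi>" for k \<phi> i
    by (rule integrable_test_scaleR[OF sq_integrable_jet_snd[OF f] that])
  have weak: "(LINT x|lebesgue. pd i \<phi> x *\<^sub>R fst (f x)) = - (LINT x|lebesgue. \<phi> x *\<^sub>R snd (f x) $ i)"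
    if "ck_test 2 UNIV \<phi>" for \<phi> i
    using F weak_jets_iff[OF f, of 1] that unfolding Ff by (simp add: numeral_2_eq_2)
  have u0: "AE x in lebesgue. fst (f x) = 0"
  proof (rule AE_zero_if_inner_zero, rule weak_helmholtz_zero)
    fix z
    show "sq_integrable (\<lambda>x. inner (fst (f x)) z)"
      by (intro sq_integrable_inner_const sq_integrable_jet_fst f)
    fix \<eta> assume \<eta>: "ck_test 3 UNIV \<eta>"
    then have \<eta>3: "ck_test (Suc 2) UNIV \<eta>" by simp
    note p1 = ck_test_pd[OF \<eta>3]
    have p2: "ck_test 1 UNIV (pd i (pd i \<eta>))" for i
      using ck_test_pd[of 1 UNIV "pd i \<eta>" i] p1[of i] by (simp add: numeral_2_eq_2)
    have "inner (LINT x|lebesgue. \<eta> x *\<^sub>R fst (f x) + (\<Sum>i\<in>UNIV. pd i \<eta> x *\<^sub>R snd (f x) $ i)) z' = 0" for z'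
      using orth[OF jet3_in_sobolev[OF \<eta>, of z']] inner_l2_jet[OF f \<eta>3, of z'] by (simp add: Ff)
    then have "(LINT x|lebesgue. \<eta> x *\<^sub>R fst (f x) + (\<Sum>i\<in>UNIV. pd i \<eta> x *\<^sub>R snd (f x) $ i)) = 0"
      by (rule inner_eq_zero_all_complex)
    then have "(LINT x|lebesgue. \<eta> x *\<^sub>R fst (f x)) = - (\<Sum>i\<in>UNIV. LINT x|lebesgue. pd i \<eta> x *\<^sub>R snd (f x) $ i)"
      using iu[OF \<eta>] ig[OF p1] by (simp add: eq_neg_iff_add_eq_0)
    also have "\<dots> = (\<Sum>i\<in>UNIV. LINT x|lebesgue. pd i (pd i \<eta>) x *\<^sub>R fst (f x))"
      using weak[OF p1] by (simp add: sum_negf)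
    also have "\<dots> = (LINT x|lebesgue. (\<Sum>i\<in>UNIV. pd i (pd i \<eta>) x *\<^sub>R fst (f x)))"
      using iu[OF p2] by simp
    also have "\<dots> = (LINT x|lebesgue. lap \<eta> x *\<^sub>R fst (f x))"
      by (simp add: lap_def scaleR_sum_left)
    finally have eq: "(LINT x|lebesgue. \<eta> x *\<^sub>R fst (f x)) = (LINT x|lebesgue. lap \<eta> x *\<^sub>R fst (f x))" .
    have il: "integrable lebesgue (\<lambda>x. lap \<eta> x *\<^sub>R fst (f x))"
      unfolding lap_def scaleR_sum_left using iu[OF p2] by simp
    have "(LINT x|lebesgue. inner (fst (f x)) z * lap \<eta> x) = (LINT x|lebesgue. inner (lap \<eta> x *\<^sub>R fst (f x)) z)"
      by (simp add: mult.commute)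
    also have "\<dots> = inner (LINT x|lebesgue. lap \<eta> x *\<^sub>R fst (f x)) z" using il by (intro integral_inner_left) simp
    also have "\<dots> = (LINT x|lebesgue. inner (\<eta> x *\<^sub>R fst (f x)) z)"
      unfolding eq[symmetric] using iu[OF \<eta>] by (intro integral_inner_left[symmetric]) simp
    finally show "(LINT x|lebesgue. inner (fst (f x)) z * lap \<eta> x) = (LINT x|lebesgue. inner (fst (f x)) z * \<eta> x)"
      by (simp add: mult.commute)
  qed
  have g0: "AE x in lebesgue. snd (f x) $ i = 0" for i
  proof (rule AE_zero_if_inner_zero, rule fundamental_lemma_variations[where k=2])
    fix z
    show "loc_integrable (\<lambda>x. inner (snd (f x) $ i) z)"
      by (intro sq_integrable_imp_loc_integrable sq_integrable_inner_const sq_integrable_jet_snd f)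
    fix \<eta> assume \<eta>: "ck_test 2 UNIV \<eta>"
    have "(LINT x|lebesgue. pd i \<eta> x *\<^sub>R fst (f x)) = 0"
      by (rule integral_eq_zero_AE) (use u0 in eventually_elim, simp)
    then have "(LINT x|lebesgue. \<eta> x *\<^sub>R snd (f x) $ i) = 0" using weak[OF \<eta>, of i] by simp
    then have "inner (LINT x|lebesgue. \<eta> x *\<^sub>R snd (f x) $ i) z = 0" by simp
    then have "(LINT x|lebesgue. inner (\<eta> x *\<^sub>R snd (f x) $ i) z) = 0"
      using ig[OF \<eta>] by (subst integral_inner_left) auto
    then show "(LINT x|lebesgue. inner (snd (f x) $ i) z * \<eta> x) = 0" by (simp add: mult.commute)
  qed
  have "AE x in lebesgue. \<forall>i. snd (f x) $ i = 0" using g0 by (simp add: AE_all_countable)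
  with u0 have "AE x in lebesgue. f x = 0"
    by eventually_elim (simp add: prod_eq_iff vec_eq_iff)
  then have "l2_of f = l2_of (\<lambda>x. 0)" by (simp add: l2_of_eq_iff f sq_integrable_zero)
  then show ?thesis by (simp add: Ff l2_of_def zero_l2.abs_eq)
qed

text \<open>Combined with \<open>sobolev_subset_weak_jets\<close>, this upgrades a gradient verified
  against C^2 functions to one valid against C^1 functions.\<close>

lemma weak_jets_subset_sobolev: "weak_jets 2 \<subseteq> sobolev"
  by (rule dense_if_orthogonal_trivial[OF subspace_sobolev closed_sobolev subspace_weak_jets])
     (use sobolev_subset_weak_jets weak_jets_antimono[of 1 2] weak_jet_orthogonal_sobolev_zero in auto)

text \<open>A C^2 jet has the right weak gradient by integration by parts, so it enters through the
  weak characterisation although the generators of \<open>sobolev\<close> are C^3.\<close>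

lemma jet_in_sobolev: "ck_test 2 UNIV \<phi> \<Longrightarrow> l2_of (jet \<phi> z) \<in> sobolev"
  using weak_jets_subset_sobolev weak_jets_antimono[of 1 2] jet_in_weak_jets[of \<phi> z] ck_test_mono[of 2 UNIV \<phi> 1 UNIV]
  by auto

lemma orthogonal_sobolevI:
  assumes "\<And>\<phi> z. ck_test 3 UNIV \<phi> \<Longrightarrow> inner F (l2_of (jet \<phi> z)) = 0" and "G \<in> sobolev"
  shows "inner F G = 0"
proof -
  have "sobolev \<subseteq> {G. inner F G = 0}" unfolding sobolev_def
  proof (rule closure_minimal[OF span_minimal])
    show "{l2_of (jet \<phi> z) |\<phi> z. ck_test 3 UNIV \<phi>} \<subseteq> {G. inner F G = 0}" using assms(1) by auto
    show "subspace {G. inner F G = 0}" by (auto simp: subspace_def inner_add_right)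
    show "closed {G. inner F G = 0}" by (intro closed_Collect_eq continuous_intros)
  qed
  with assms(2) show ?thesis by blast
qed

section \<open>Multiplication operators and Lipschitz boundaries\<close>

lemma sq_integrable_mult_bounded:
  fixes p f :: "'a::euclidean_space \<Rightarrow> complex"
  assumes p: "p \<in> borel_measurable lebesgue" and C: "\<And>x. norm (p x) \<le> C" and f: "sq_integrable f"
  shows "sq_integrable (\<lambda>x. p x * f x)"
proof (rule sq_integrable_bound[OF f, where C=C])
  show "(\<lambda>x. p x * f x) \<in> borel_measurable lebesgue"
    using p f by (auto simp: sq_integrable_def)
  show "AE x in lebesgue. norm (p x * f x) \<le> C * norm (f x)"
    by (simp add: norm_mult mult_right_mono C)
qed

definition diag_fun :: "('a \<Rightarrow> complex) \<Rightarrow> ('a \<Rightarrow> complex) \<Rightarrow> ('a \<Rightarrow> jet) \<Rightarrow> 'a \<Rightarrow> jet" where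
  "diag_fun p q F x = (p x * fst (F x), \<chi> i. q x * snd (F x) $ i)"

definition diag_mult :: "(pt \<Rightarrow> complex) \<Rightarrow> (pt \<Rightarrow> complex) \<Rightarrow> (pt, jet) l2 \<Rightarrow> (pt, jet) l2" where
  "diag_mult p q F = l2_of (diag_fun p q (l2_fun F))"

definition bounded_coef :: "real \<Rightarrow> (pt \<Rightarrow> complex) \<Rightarrow> bool" where
  "bounded_coef C p \<longleftrightarrow> p \<in> borel_measurable lebesgue \<and> (\<forall>x. norm (p x) \<le> C)"

lemma bounded_coef_mono: "bounded_coef C p \<Longrightarrow> C \<le> C' \<Longrightarrow> bounded_coef C' p"
  by (auto simp: bounded_coef_def intro: order_trans)

lemma bounded_coef_zero: "0 \<le> C \<Longrightarrow> bounded_coef C (\<lambda>x. 0)"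
  by (simp add: bounded_coef_def)

lemma sq_integrable_diag_fun:
  assumes "bounded_coef C p" "bounded_coef C q" "sq_integrable F"
  shows "sq_integrable (diag_fun p q F)"
  unfolding diag_fun_def using assms
  by (intro sq_integrable_jetI sq_integrable_mult_bounded[where C=C]
      sq_integrable_jet_fst sq_integrable_jet_snd) (auto simp: bounded_coef_def)

lemma diag_mult_l2_of:
  assumes "bounded_coef C p" "bounded_coef C q" "sq_integrable F"
  shows "diag_mult p q (l2_of F) = l2_of (diag_fun p q F)"
  unfolding diag_mult_def
proof (subst l2_of_eq_iff)
  show "AE x in lebesgue. diag_fun p q (l2_fun (l2_of F)) x = diag_fun p q F x"
    using l2_fun_l2_of[OF assms(3)] by eventually_elim (simp add: diag_fun_def)
qed (use assms in \<open>auto intro: sq_integrable_diag_fun\<close>)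

lemma norm_jet_squared: "(norm v)\<^sup>2 = (norm (fst v))\<^sup>2 + (\<Sum>i\<in>UNIV. (norm (snd v $ i))\<^sup>2)" for v :: jet
  by (simp add: power2_norm_eq_inner inner_prod_def inner_vec_def)

lemma norm_diag_fun_le:
  assumes C: "0 \<le> C" "norm (p x) \<le> C" "norm (q x) \<le> C"
  shows "norm (diag_fun p q F x) \<le> C * norm (F x)"
proof (rule power2_le_imp_le)
  have le: "(norm (r * z))\<^sup>2 \<le> C\<^sup>2 * (norm z)\<^sup>2" if "norm r \<le> C" for r z :: complex
    using that by (simp add: norm_mult power_mult_distrib mult_right_mono power_mono)
  have "(norm (diag_fun p q F x))\<^sup>2 \<le> C\<^sup>2 * (norm (fst (F x)))\<^sup>2 + (\<Sum>i\<in>UNIV. C\<^sup>2 * (norm (snd (F x) $ i))\<^sup>2)"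
    unfolding norm_jet_squared diag_fun_def using C by (auto intro!: add_mono sum_mono le)
  also have "\<dots> = (C * norm (F x))\<^sup>2"
    unfolding power_mult_distrib norm_jet_squared[of "F x"] by (simp add: sum_distrib_left distrib_left)
  finally show "(norm (diag_fun p q F x))\<^sup>2 \<le> (C * norm (F x))\<^sup>2" .
qed (use C in simp)

lemma norm_l2_mono:
  assumes "sq_integrable f" "sq_integrable g" "AE x in lebesgue. norm (f x) \<le> C * norm (g x)" "0 \<le> C"
  shows "norm (l2_of f) \<le> C * norm (l2_of g)"
proof -
  have "(LINT x|lebesgue. (norm (f x))\<^sup>2) \<le> (LINT x|lebesgue. C\<^sup>2 * (norm (g x))\<^sup>2)"
  proof (rule integral_mono_AE)
    show "AE x in lebesgue. (norm (f x))\<^sup>2 \<le> C\<^sup>2 * (norm (g x))\<^sup>2"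
      using assms(3)
    proof eventually_elim
      case (elim x)
      then have "(norm (f x))\<^sup>2 \<le> (C * norm (g x))\<^sup>2" by (intro power_mono) auto
      then show ?case by (simp add: power_mult_distrib)
    qed
  qed (use assms in \<open>auto simp: sq_integrable_def\<close>)
  then have "sqrt (LINT x|lebesgue. (norm (f x))\<^sup>2) \<le> sqrt (C\<^sup>2 * (LINT x|lebesgue. (norm (g x))\<^sup>2))" by simp
  then show ?thesis using assms by (simp add: norm_l2_of real_sqrt_mult)
qed

lemma norm_diag_mult_le:
  assumes "bounded_coef C p" "bounded_coef C q"
  shows "norm (diag_mult p q F) \<le> C * norm F"
proof -
  have C: "0 \<le> C" using assms(1) norm_ge_zero order_trans unfolding bounded_coef_def by blast
  have "norm (diag_mult p q F) \<le> C * norm (l2_of (l2_fun F))" unfolding diag_mult_def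
    by (intro norm_l2_mono sq_integrable_diag_fun[OF assms] sq_integrable_l2_fun AE_I2 norm_diag_fun_le C)
       (use assms in \<open>auto simp: bounded_coef_def\<close>)
  then show ?thesis by simp
qed

lemma bounded_linear_diag_mult:
  assumes "bounded_coef C p" "bounded_coef C q"
  shows "bounded_linear (diag_mult p q)"
proof (rule bounded_linear_intro)
  note si = sq_integrable_diag_fun[OF assms]
  fix F G :: "(pt, jet) l2" and r :: real
  have "diag_mult p q (F + G) = diag_mult p q (l2_of (\<lambda>x. l2_fun F x + l2_fun G x))" by (simp add: l2_of_add)
  also have "\<dots> = l2_of (diag_fun p q (\<lambda>x. l2_fun F x + l2_fun G x))"
    by (intro diag_mult_l2_of[OF assms] sq_integrable_add sq_integrable_l2_fun)
  also have "diag_fun p q (\<lambda>x. l2_fun F x + l2_fun G x) = (\<lambda>x. diag_fun p q (l2_fun F) x + diag_fun p q (l2_fun G) x)"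
    by (auto simp: diag_fun_def prod_eq_iff vec_eq_iff algebra_simps)
  finally show "diag_mult p q (F + G) = diag_mult p q F + diag_mult p q G"
    by (simp add: l2_of_add si diag_mult_def)
  have "diag_mult p q (r *\<^sub>R F) = diag_mult p q (l2_of (\<lambda>x. r *\<^sub>R l2_fun F x))" by (simp add: l2_of_scaleR)
  also have "\<dots> = l2_of (diag_fun p q (\<lambda>x. r *\<^sub>R l2_fun F x))"
    by (intro diag_mult_l2_of[OF assms] sq_integrable_scaleR sq_integrable_l2_fun)
  also have "diag_fun p q (\<lambda>x. r *\<^sub>R l2_fun F x) = (\<lambda>x. r *\<^sub>R diag_fun p q (l2_fun F) x)"
    by (auto simp: diag_fun_def prod_eq_iff vec_eq_iff algebra_simps)
  finally show "diag_mult p q (r *\<^sub>R F) = r *\<^sub>R diag_mult p q F"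
    by (simp add: l2_of_scaleR si diag_mult_def)
  show "norm (diag_mult p q F) \<le> norm F * C" using norm_diag_mult_le[OF assms] by (simp add: mult.commute)
qed

lemma diag_mult_diff:
  assumes "bounded_coef C p" "bounded_coef C q" "bounded_coef C' p'" "bounded_coef C' q'"
  shows "diag_mult p' q' F - diag_mult p q F = diag_mult (\<lambda>x. p' x - p x) (\<lambda>x. q' x - q x) F"
proof -
  have "diag_fun (\<lambda>x. p' x - p x) (\<lambda>x. q' x - q x) (l2_fun F)
      = (\<lambda>x. diag_fun p' q' (l2_fun F) x - diag_fun p q (l2_fun F) x)"
    by (auto simp: diag_fun_def prod_eq_iff vec_eq_iff algebra_simps)
  then show ?thesis
    using sq_integrable_diag_fun[OF assms(1,2)] sq_integrable_diag_fun[OF assms(3,4)]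
    by (simp add: diag_mult_def l2_of_diff)
qed

lemma diag_mult_coercive:
  assumes "bounded_coef C p" "bounded_coef C q"
    and c: "\<And>x. c \<le> Re (p x)" "\<And>x. c \<le> Re (q x)"
  shows "c * (norm F)\<^sup>2 \<le> inner (diag_mult p q F) F"
proof -
  define f where "f = l2_fun F"
  have f: "sq_integrable f" "F = l2_of f" by (simp_all add: f_def)
  have "c * (norm F)\<^sup>2 = (LINT x|lebesgue. c * inner (f x) (f x))"
    by (simp add: power2_norm_eq_inner f inner_l2_of)
  also have "\<dots> \<le> (LINT x|lebesgue. inner (diag_fun p q f x) (f x))"
  proof (rule integral_mono)
    show "integrable lebesgue (\<lambda>x. c * inner (f x) (f x))" using sq_integrable_inner[OF f(1) f(1)] by simp
    show "integrable lebesgue (\<lambda>x. inner (diag_fun p q f x) (f x))"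
      by (intro sq_integrable_inner sq_integrable_diag_fun[OF assms(1,2)] f)
    \<comment> \<open>For the real inner product only the real part of a multiplier enters the
      quadratic form.\<close>
    have m: "inner (r * z) z = Re r * inner z z" for r z :: complex
      by (simp add: inner_complex_def algebra_simps)
    show "c * inner (f x) (f x) \<le> inner (diag_fun p q f x) (f x)" for x
      unfolding diag_fun_def inner_prod_def inner_vec_def distrib_left sum_distrib_left
      using c[of x] by (auto simp: m intro!: add_mono sum_mono mult_right_mono)
  qed
  also have "\<dots> = inner (diag_mult p q F) F"
    unfolding f(2) by (simp add: diag_mult_l2_of[OF assms(1,2) f(1)] inner_l2_of sq_integrable_diag_fun[OF assms(1,2)] f(1))
  finally show ?thesis .
qed

text \<open>The graph is contained in the image of the hyperplane y_3 = 0 under y -> p + T^(-1)(y +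
  \<psi>(y) e_3), a Lipschitz map between spaces of equal dimension, which preserves null sets.
  Since \<psi> ignores the third coordinate, subtracting the height of a point does not change
  \<psi>.\<close>

lemma negligible_graph:
  fixes T :: "pt \<Rightarrow> pt" and \<psi> :: "pt \<Rightarrow> real"
  assumes T: "orthogonal_transformation T" and L: "M-lipschitz_on UNIV \<psi>"
    and dep: "\<forall>y z. y$1 = z$1 \<and> y$2 = z$2 \<longrightarrow> \<psi> y = \<psi> z"
  shows "negligible {x. (T (x - p))$3 = \<psi> (T (x - p))}"
proof -
  obtain T' where T': "linear T'" "\<And>x. T' (T x) = x" "\<And>x. norm (T' x) = norm x"
  proof -
    have "orthogonal_transformation (inv T)" using T by (rule orthogonal_transformation_inv)
    moreover have "inv T (T x) = x" for x using orthogonal_transformation_bij[OF T] by (simp add: bij_is_inj)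
    ultimately show thesis using that[of "inv T"] by (auto simp: orthogonal_transformation)
  qed
  define S where "S = {y::pt. y $ 3 = 0}"
  define F where "F y = p + T' (y + \<psi> y *\<^sub>R axis 3 1)" for y
  have "negligible S" unfolding S_def using negligible_standard_hyperplane[of "axis 3 1 :: pt" 0]
    by (simp add: inner_axis axis_in_Basis_iff)
  then have "negligible (F ` S)"
  proof (rule negligible_locally_Lipschitz_image[OF order_refl])
    fix x assume "x \<in> S"
    have "norm (F y - F x) \<le> (1 + M) * norm (y - x)" for y
    proof -
      have "F y - F x = T' ((y - x) + (\<psi> y - \<psi> x) *\<^sub>R axis 3 1)"
        by (simp add: F_def linear_diff[OF T'(1), symmetric] algebra_simps)
      then have "norm (F y - F x) \<le> norm (y - x) + norm ((\<psi> y - \<psi> x) *\<^sub>R (axis 3 1 :: pt))"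
        using norm_triangle_ineq by (simp only: T'(3))
      also have "\<dots> \<le> norm (y - x) + M * norm (y - x)"
        using lipschitz_onD[OF L, of y x] by (simp add: dist_norm)
      finally show ?thesis by (simp add: algebra_simps)
    qed
    then show "\<exists>T B. open T \<and> x \<in> T \<and> (\<forall>y\<in>S \<inter> T. norm (F y - F x) \<le> B * norm (y - x))"
      by (intro exI[of _ UNIV] exI[of _ "1 + M"]) auto
  qed
  moreover have "{x. (T (x - p))$3 = \<psi> (T (x - p))} \<subseteq> F ` S"
  proof
    fix x assume x: "x \<in> {x. (T (x - p))$3 = \<psi> (T (x - p))}"
    define y where "y = T (x - p)"
    define y0 where "y0 = y - \<psi> y *\<^sub>R axis 3 1"
    have "y0 $ 1 = y $ 1" "y0 $ 2 = y $ 2" by (simp_all add: y0_def axis_def)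
    then have "\<psi> y0 = \<psi> y" using dep by blast
    then have "y0 + \<psi> y0 *\<^sub>R axis 3 1 = y" by (simp add: y0_def)
    then have "F y0 = x" by (simp add: F_def y_def T'(2))
    moreover have "y0 \<in> S" using x by (simp add: S_def y0_def y_def axis_def)
    ultimately show "x \<in> F ` S" by blast
  qed
  ultimately show ?thesis by (rule negligible_subset)
qed

text \<open>Near a boundary point the frontier lies in the graph: openness of \<open>U\<close>
  excludes points strictly below it, and membership in the closure of \<open>U\<close> excludes
  points strictly above. Being locally null is enough.\<close>

lemma lipschitz_domain_frontier_negligible:
  assumes U: "lipschitz_domain U"
  shows "negligible (frontier U)"
  unfolding locally_negligible_alt[of "frontier U"]
proof
  fix p assume p: "p \<in> frontier U"
  have opU: "open U" using U by (simp add: lipschitz_domain_def)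
  obtain T :: "pt \<Rightarrow> pt" and r \<psi> M where T: "orthogonal_transformation T" and r: "r > 0"
    and L: "M-lipschitz_on UNIV \<psi>" and dep: "\<forall>y z. y$1 = z$1 \<and> y$2 = z$2 \<longrightarrow> \<psi> y = \<psi> z"
    and eq: "U \<inter> ball p r = {x \<in> ball p r. (T (x - p))$3 < \<psi> (T (x - p))}"
    using conjunct2[OF U[unfolded lipschitz_domain_def], rule_format, OF p] by blast
  have cT: "continuous_on UNIV (\<lambda>x. T (x - p))"
    using orthogonal_transformation_linear[OF T]
    by (intro continuous_on_compose2[OF linear_continuous_on[of T UNIV]] continuous_intros)
       (auto simp: linear_conv_bounded_linear)
  have cl: "closed {x. (T (x - p))$3 \<le> \<psi> (T (x - p))}"
    by (intro closed_Collect_le continuous_on_component cT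
        continuous_on_compose2[OF lipschitz_on_continuous_on[OF L] cT]) auto
  have sub: "frontier U \<inter> ball p r \<subseteq> {x. (T (x - p))$3 = \<psi> (T (x - p))}"
  proof
    fix x assume x: "x \<in> frontier U \<inter> ball p r"
    then have "x \<notin> U" using opU by (simp add: frontier_def interior_open)
    then have ge: "\<not> (T (x - p))$3 < \<psi> (T (x - p))" using eq x by blast
    have "x \<in> closure (U \<inter> ball p r)"
      using x open_Int_closure_subset[of "ball p r" U] by (auto simp: frontier_def Int_commute)
    also have "\<dots> \<subseteq> {x. (T (x - p))$3 \<le> \<psi> (T (x - p))}"
      by (rule closure_minimal[OF _ cl]) (use eq in auto)
    finally show "x \<in> {x. (T (x - p))$3 = \<psi> (T (x - p))}" using ge by simp
  qed
  show "\<exists>V. openin (top_of_set (frontier U)) V \<and> p \<in> V \<and> negligible V"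
  proof (intro exI conjI)
    show "openin (top_of_set (frontier U)) (frontier U \<inter> ball p r)" by (intro openin_open_Int) simp
    show "p \<in> frontier U \<inter> ball p r" using p r by simp
    show "negligible (frontier U \<inter> ball p r)"
      by (rule negligible_subset[OF negligible_graph[OF T L dep] sub])
  qed
qed

section \<open>The transmission problem in weak form\<close>

lemma L2_on_UNIV_iff: "L2_on UNIV u \<longleftrightarrow> sq_integrable u"
  by (simp add: L2_on_def sq_integrable_def set_borel_measurable_def set_integrable_def)

lemma L2_on_extend:
  assumes "L2_on U h"
  shows "sq_integrable (\<lambda>x. indicator U x *\<^sub>R h x)"
proof -
  have "(norm (indicator U x *\<^sub>R h x))\<^sup>2 = indicator U x *\<^sub>R (norm (h x))\<^sup>2" for x by (simp add: indicator_def)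
  then show ?thesis using assms
    by (simp add: L2_on_def sq_integrable_def set_borel_measurable_def set_integrable_def)
qed

lemma sq_integrable_imp_L2_on:
  assumes "sq_integrable h" "U \<in> sets lebesgue"
  shows "L2_on U h"
  using assms integrable_mult_indicator[OF assms(2), of "\<lambda>x. (norm (h x))\<^sup>2"]
  by (auto simp: L2_on_def sq_integrable_def set_borel_measurable_def set_integrable_def)

definition pairing_density :: "(3 \<Rightarrow> pt \<Rightarrow> complex) \<Rightarrow> (pt \<Rightarrow> complex) \<Rightarrow> (pt \<Rightarrow> real) \<Rightarrow> pt \<Rightarrow> complex" where
  "pairing_density g h \<phi> x = (\<Sum>i\<in>UNIV. g i x * of_real (pd i \<phi> x)) + h x * of_real (\<phi> x)"

lemma neumann_pairing_eq: "neumann_pairing U g h \<phi> = (LINT x:U|lebesgue. pairing_density g h \<phi> x)"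
  by (simp add: neumann_pairing_def pairing_density_def)

lemma integrable_mult_test:
  fixes f :: "pt \<Rightarrow> complex"
  assumes "sq_integrable f" "ck_test k U \<phi>"
  shows "integrable lebesgue (\<lambda>x. f x * of_real (\<phi> x))"
  using integrable_test_scaleR[OF assms] by (simp add: scaleR_conv_of_real mult.commute)

lemma integrable_pairing_density:
  assumes "\<And>i. sq_integrable (g i)" "sq_integrable h" "ck_test (Suc k) U \<phi>"
  shows "integrable lebesgue (pairing_density g h \<phi>)"
  unfolding pairing_density_def
  by (intro Bochner_Integration.integrable_add Bochner_Integration.integrable_sum
      integrable_mult_test[OF assms(1) ck_test_pd[OF assms(3)]] integrable_mult_test[OF assms(2,3)])

lemma neumann_pairing_zero:
  assumes "U \<inter> supp \<phi> = {}"
  shows "neumann_pairing U g h \<phi> = 0"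
proof -
  have "indicator U x *\<^sub>R pairing_density g h \<phi> x = 0" for x
  proof (cases "x \<in> U")
    case True
    then have x: "x \<notin> supp \<phi>" using assms by blast
    show ?thesis by (simp add: pairing_density_def pd_zero_outside_support[OF x] zero_outside_support[OF x])
  qed simp
  then show ?thesis unfolding neumann_pairing_eq set_lebesgue_integral_def by (simp only: integral_zero)
qed

lemma neumann_pairing_scale_AE:
  assumes U: "U \<in> sets lebesgue"
    and si: "\<And>i. sq_integrable (g i)" "\<And>i. sq_integrable (g' i)" "sq_integrable h" "sq_integrable h'"
    and \<phi>: "ck_test (Suc k) V \<phi>"
    and ae: "AE x in lebesgue. x \<in> U \<longrightarrow> (\<forall>i. g' i x = c * g i x) \<and> h' x = c * h x"
  shows "neumann_pairing U g' h' \<phi> = c * neumann_pairing U g h \<phi>"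
proof -
  have m: "pairing_density g h \<phi> \<in> borel_measurable lebesgue" "pairing_density g' h' \<phi> \<in> borel_measurable lebesgue"
    using integrable_pairing_density[OF si(1,3) \<phi>] integrable_pairing_density[OF si(2,4) \<phi>] by auto
  have "(LINT x|lebesgue. indicator U x *\<^sub>R pairing_density g' h' \<phi> x)
      = (LINT x|lebesgue. c * (indicator U x *\<^sub>R pairing_density g h \<phi> x))"
  proof (rule integral_cong_AE)
    show "AE x in lebesgue. indicator U x *\<^sub>R pairing_density g' h' \<phi> x = c * (indicator U x *\<^sub>R pairing_density g h \<phi> x)"
      using ae
    proof eventually_elim
      case (elim x)
      show ?case
      proof (cases "x \<in> U")
        case True
        with elim have "(\<forall>i. g' i x = c * g i x)" "h' x = c * h x" by auto
        with True show ?thesis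
          by (simp add: pairing_density_def sum_distrib_left distrib_left mult.assoc)
      qed simp
    qed
  qed (use U m in measurable)
  then show ?thesis by (simp add: neumann_pairing_eq set_lebesgue_integral_def del: mult_scaleR_right)
qed

lemma neumann_pairing_extend:
  "neumann_pairing U g (\<lambda>x. indicator U x *\<^sub>R h x) \<phi> = neumann_pairing U g h \<phi>"
  unfolding neumann_pairing_eq set_lebesgue_integral_def
  by (rule Bochner_Integration.integral_cong) (auto simp: pairing_density_def indicator_def)

lemma neumann_pairing_add:
  assumes si: "\<And>i. sq_integrable (g i)" "sq_integrable h"
    and \<phi>: "ck_test (Suc k) V \<phi>" and \<psi>: "ck_test (Suc k) V \<psi>"
  shows "neumann_pairing UNIV g h (\<lambda>x. \<phi> x + \<psi> x) = neumann_pairing UNIV g h \<phi> + neumann_pairing UNIV g h \<psi>"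
proof -
  have "pairing_density g h (\<lambda>x. \<phi> x + \<psi> x) x = pairing_density g h \<phi> x + pairing_density g h \<psi> x" for x
    using ck_test_ck[OF \<phi>] ck_test_ck[OF \<psi>]
    by (simp add: pairing_density_def pd_add distrib_left sum.distrib)
  then show ?thesis
    using integrable_pairing_density[OF si \<phi>] integrable_pairing_density[OF si \<psi>]
    by (simp add: neumann_pairing_eq set_lebesgue_integral_def)
qed

lemma set_integral_test_support:
  fixes f :: "pt \<Rightarrow> complex"
  assumes "\<And>x. x \<notin> U \<Longrightarrow> f x = 0"
  shows "(LINT x:U|lebesgue. f x) = (LINT x|lebesgue. f x)"
  unfolding set_lebesgue_integral_def
  by (rule Bochner_Integration.integral_cong) (auto simp: indicator_def assms)

text \<open>For \<phi> supported in \<open>U\<close> there is no boundary term. The weak gradient is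
  tested with \<partial>_i\<phi>, so \<phi> must have one derivative more than the test functions
  for which that gradient is known.\<close>

lemma neumann_pairing_green:
  assumes u: "sq_integrable u" and g: "\<And>i. sq_integrable (g i)" and h: "sq_integrable h"
    and weak: "l2_of (mk_jet u g) \<in> weak_jets (Suc k)" and \<phi>: "ck_test (Suc (Suc k)) U \<phi>"
  shows "neumann_pairing U g h \<phi> = (LINT x:U|lebesgue. h x * of_real (\<phi> x)) - (LINT x:U|lebesgue. u x * of_real (lap \<phi> x))"
proof -
  have out: "\<phi> x = 0" "pd i \<phi> x = 0" "lap \<phi> x = 0" if "x \<notin> U" for x i
  proof -
    have x: "x \<notin> supp \<phi>" using \<phi> that by (auto simp: ck_test_def)
    then show "\<phi> x = 0" "pd i \<phi> x = 0" by (rule zero_outside_support pd_zero_outside_support)+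
    have "pd i (pd i \<phi>) x = 0" for i using x support_pd_subset[of i \<phi>] by (intro pd_zero_outside_support) auto
    then show "lap \<phi> x = 0" by (simp add: lap_def)
  qed
  have p1: "ck_test (Suc k) UNIV (pd i \<phi>)" for i using ck_test_mono[OF ck_test_pd[OF \<phi>]] by simp
  have p2: "ck_test k UNIV (pd i (pd i \<phi>))" for i by (rule ck_test_pd[OF p1])
  have w: "(LINT x|lebesgue. g i x * of_real (pd i \<phi> x)) = - (LINT x|lebesgue. u x * of_real (pd i (pd i \<phi>) x))" for i
  proof -
    have "(LINT x|lebesgue. pd i (pd i \<phi>) x *\<^sub>R u x) = - (LINT x|lebesgue. pd i \<phi> x *\<^sub>R g i x)"
      using weak p1[of i] weak_jets_iff[OF sq_integrable_jetI[where u=u and g=g, OF u g], of k] by simp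
    then show ?thesis by (simp add: scaleR_conv_of_real mult.commute)
  qed
  have "neumann_pairing U g h \<phi> = (LINT x|lebesgue. pairing_density g h \<phi> x)"
    unfolding neumann_pairing_eq by (rule set_integral_test_support) (simp add: pairing_density_def out)
  also have "\<dots> = (\<Sum>i\<in>UNIV. LINT x|lebesgue. g i x * of_real (pd i \<phi> x)) + (LINT x|lebesgue. h x * of_real (\<phi> x))"
    unfolding pairing_density_def using integrable_mult_test[OF g p1] integrable_mult_test[OF h \<phi>] by simp
  also have "(\<Sum>i\<in>UNIV. LINT x|lebesgue. g i x * of_real (pd i \<phi> x)) = - (LINT x|lebesgue. u x * of_real (lap \<phi> x))"
    unfolding w lap_def using integrable_mult_test[OF u p2] by (simp add: sum_negf sum_distrib_left)
  also have "(LINT x|lebesgue. u x * of_real (lap \<phi> x)) = (LINT x:U|lebesgue. u x * of_real (lap \<phi> x))"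
    by (rule set_integral_test_support[symmetric]) (simp add: out)
  also have "(LINT x|lebesgue. h x * of_real (\<phi> x)) = (LINT x:U|lebesgue. h x * of_real (\<phi> x))"
    by (rule set_integral_test_support[symmetric]) (simp add: out)
  finally show ?thesis by simp
qed

lemma weak_grad_iff_weak_jets:
  assumes u: "sq_integrable u" and g: "\<And>i. sq_integrable (g i)"
  shows "weak_grad UNIV u g \<longleftrightarrow> l2_of (mk_jet u g) \<in> weak_jets 2"
  using weak_jets_iff[OF sq_integrable_jetI[where u=u and g=g, OF u g], of 1]
  by (simp add: weak_grad_def test_fun_iff set_lebesgue_integral_def scaleR_conv_of_real mult.commute
      flip: numeral_2_eq_2)

section \<open>Finitely many disjoint domains and piecewise constant coefficients\<close>

locale disjoint_domains =
  fixes n :: nat and Om :: "nat \<Rightarrow> pt set"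
  assumes open_Om: "l \<in> {1..n} \<Longrightarrow> open (Om l)"
    and bounded_Om: "l \<in> {1..n} \<Longrightarrow> bounded (Om l)"
    and negligible_frontier_Om: "l \<in> {1..n} \<Longrightarrow> negligible (frontier (Om l))"
    and disjoint_closure_Om: "l \<in> {1..n} \<Longrightarrow> k \<in> {1..n} \<Longrightarrow> l \<noteq> k \<Longrightarrow> closure (Om l) \<inter> closure (Om k) = {}"
begin

abbreviation "Oex \<equiv> Omega_ex n Om"

lemma Oex_eq: "Oex = - (\<Union>l\<in>{1..n}. closure (Om l))"
proof -
  have "closure (\<Union>l\<in>A. Om l) = (\<Union>l\<in>A. closure (Om l))" if "finite A" for A
    using that by induction auto
  then show ?thesis by (simp add: Omega_ex_def Omega_union_def)
qed

lemma open_Oex: "open Oex"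
  unfolding Omega_ex_def by (intro open_Compl closed_closure)

lemma Om_disjoint: "l \<in> {1..n} \<Longrightarrow> k \<in> {1..n} \<Longrightarrow> x \<in> Om l \<Longrightarrow> x \<in> Om k \<Longrightarrow> l = k"
  using disjoint_closure_Om[of l k] closure_subset[of "Om l"] closure_subset[of "Om k"] by blast

lemma Oex_Om_disjoint: "l \<in> {1..n} \<Longrightarrow> x \<in> Om l \<Longrightarrow> x \<notin> Oex"
  using closure_subset[of "Om l"] by (auto simp: Oex_eq)

lemma sets_Om: "l \<in> {1..n} \<Longrightarrow> Om l \<in> sets lebesgue"
  using open_Om by (simp add: lborelD)

lemma sets_Oex: "Oex \<in> sets lebesgue"
  using open_Oex by (simp add: lborelD)

definition coef :: "(nat \<Rightarrow> real) \<Rightarrow> pt \<Rightarrow> real" where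
  "coef \<alpha> x = 1 + (\<Sum>l\<in>{1..n}. (\<alpha> l - 1) * indicator (Om l) x)"

abbreviation flux_coef :: "(nat \<Rightarrow> real) \<Rightarrow> pt \<Rightarrow> real" where
  "flux_coef \<rho> \<equiv> coef (\<lambda>l. 1 / \<rho> l)"

abbreviation mass_coef :: "(nat \<Rightarrow> real) \<Rightarrow> (nat \<Rightarrow> real) \<Rightarrow> pt \<Rightarrow> real" where
  "mass_coef v \<rho> \<equiv> coef (\<lambda>l. 1 / (\<rho> l * (v l)\<^sup>2))"

lemma coef_Om:
  assumes "l \<in> {1..n}" "x \<in> Om l"
  shows "coef \<alpha> x = \<alpha> l"
proof -
  have "(\<Sum>k\<in>{1..n}. (\<alpha> k - 1) * indicator (Om k) x) = (\<Sum>k\<in>{1..n}. if k = l then \<alpha> l - 1 else 0)"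
  proof (intro sum.cong refl)
    fix k assume "k \<in> {1..n}"
    then show "(\<alpha> k - 1) * indicator (Om k) x = (if k = l then \<alpha> l - 1 else 0)"
      using Om_disjoint[of k l x] assms by (cases "k = l") (auto simp: indicator_def)
  qed
  then show ?thesis using assms by (simp add: coef_def)
qed

lemma coef_outside: "(\<And>l. l \<in> {1..n} \<Longrightarrow> x \<notin> Om l) \<Longrightarrow> coef \<alpha> x = 1"
  by (simp add: coef_def)

text \<open>The split covers every point, interfaces included, where the value is 1; bounds on
  \<open>coef\<close> therefore hold everywhere and not only almost everywhere.\<close>

lemma coef_cases:
  obtains "\<And>\<alpha>. coef \<alpha> x = 1" | l where "l \<in> {1..n}" "\<And>\<alpha>. coef \<alpha> x = \<alpha> l"
  using coef_outside[of x] coef_Om[of _ x] by blast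

lemma coef_measurable [measurable]: "coef \<alpha> \<in> borel_measurable lebesgue"
  unfolding coef_def[abs_def] using sets_Om by measurable

text \<open>What remains outside the exterior and the domains lies in a finite union of boundaries,
  a null set.\<close>

lemma integral_split:
  fixes f :: "pt \<Rightarrow> complex"
  assumes f: "integrable lebesgue f"
  shows "(LINT x|lebesgue. f x) = (LINT x:Oex|lebesgue. f x) + (\<Sum>l\<in>{1..n}. LINT x:Om l|lebesgue. f x)"
proof -
  have i: "integrable lebesgue (\<lambda>x. indicator U x *\<^sub>R f x)" if "U \<in> sets lebesgue" for U
    by (rule integrable_mult_indicator[OF that f])
  have "(\<Union>l\<in>{1..n}. frontier (Om l)) \<in> null_sets lebesgue"
    using negligible_frontier_Om by (intro null_sets_UN') (auto simp: negligible_iff_null_sets)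
  then have "AE x in lebesgue. x \<notin> (\<Union>l\<in>{1..n}. frontier (Om l))" by (rule AE_not_in)
  then have "AE x in lebesgue. f x = indicator Oex x *\<^sub>R f x + (\<Sum>l\<in>{1..n}. indicator (Om l) x *\<^sub>R f x)"
  proof eventually_elim
    case (elim x)
    show ?case
    proof (cases "x \<in> Oex")
      case True
      then have "x \<notin> Om l" if "l \<in> {1..n}" for l using Oex_Om_disjoint that by blast
      then have "(\<Sum>l\<in>{1..n}. indicator (Om l) x *\<^sub>R f x) = 0" by (intro sum.neutral) auto
      with True show ?thesis by simp
    next
      case False
      then obtain l where l: "l \<in> {1..n}" "x \<in> closure (Om l)" by (auto simp: Oex_eq)
      then have "x \<in> Om l" using elim open_Om by (auto simp: frontier_def interior_open)
      then have "(\<Sum>k\<in>{1..n}. indicator (Om k) x *\<^sub>R f x) = (\<Sum>k\<in>{1..n}. if k = l then f x else 0)"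
      proof (intro sum.cong refl)
        fix k assume "k \<in> {1..n}"
        then show "indicator (Om k) x *\<^sub>R f x = (if k = l then f x else 0)"
          using Om_disjoint[of k l x] l \<open>x \<in> Om l\<close> by (cases "k = l") (auto simp: indicator_def)
      qed
      with False l(1) show ?thesis by simp
    qed
  qed
  then have "(LINT x|lebesgue. f x) = (LINT x|lebesgue. indicator Oex x *\<^sub>R f x + (\<Sum>l\<in>{1..n}. indicator (Om l) x *\<^sub>R f x))"
  proof (rule integral_cong_AE[rotated 2])
    show "f \<in> borel_measurable lebesgue" using f by auto
    show "(\<lambda>x. indicator Oex x *\<^sub>R f x + (\<Sum>l\<in>{1..n}. indicator (Om l) x *\<^sub>R f x)) \<in> borel_measurable lebesgue"
      using i[OF sets_Oex] i[OF sets_Om] by (intro borel_measurable_add borel_measurable_sum) auto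
  qed
  also have "\<dots> = (LINT x|lebesgue. indicator Oex x *\<^sub>R f x) + (\<Sum>l\<in>{1..n}. LINT x|lebesgue. indicator (Om l) x *\<^sub>R f x)"
    by (simp only: Bochner_Integration.integral_sum[OF i[OF sets_Om]]
        Bochner_Integration.integral_add[OF i[OF sets_Oex] Bochner_Integration.integrable_sum[OF i[OF sets_Om]]])
  finally show ?thesis by (simp add: set_lebesgue_integral_def)
qed

text \<open>The weak form of \<open>b w = div (a g)\<close> with \<open>a = 1/\<rho>\<close> and \<open>b = 1/(\<rho> v\<^sup>2)\<close> inside, \<open>a = b = 1\<close> outside:
  the transmission condition makes the flux \<open>a g\<close> continuous across the interfaces.\<close>
definition weak_form :: "(nat \<Rightarrow> real) \<Rightarrow> (nat \<Rightarrow> real) \<Rightarrow> (3 \<Rightarrow> pt \<Rightarrow> complex) \<Rightarrow> (pt \<Rightarrow> complex) \<Rightarrow> (pt \<Rightarrow> real) \<Rightarrow> complex" where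
  "weak_form v \<rho> g w \<phi> = neumann_pairing UNIV
     (\<lambda>i x. of_real (flux_coef \<rho> x) * g i x)
     (\<lambda>x. of_real (mass_coef v \<rho> x) * w x) \<phi>"

lemma coef_bounded: "\<exists>C. \<forall>x. \<bar>coef \<alpha> x\<bar> \<le> C"
proof (intro exI allI)
  fix x
  have "0 \<le> (\<Sum>l\<in>{1..n}. \<bar>\<alpha> l\<bar>)" by (simp add: sum_nonneg)
  moreover have "\<bar>\<alpha> l\<bar> \<le> (\<Sum>l\<in>{1..n}. \<bar>\<alpha> l\<bar>)" if "l \<in> {1..n}" for l using that by (intro member_le_sum) auto
  ultimately show "\<bar>coef \<alpha> x\<bar> \<le> 1 + (\<Sum>l\<in>{1..n}. \<bar>\<alpha> l\<bar>)"
    by (cases rule: coef_cases[of x]) force+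
qed

lemma sq_integrable_coef:
  assumes "sq_integrable f"
  shows "sq_integrable (\<lambda>x. complex_of_real (coef \<alpha> x) * f x)"
proof -
  obtain C where "\<And>x. \<bar>coef \<alpha> x\<bar> \<le> C" using coef_bounded by blast
  then show ?thesis by (intro sq_integrable_mult_bounded[where C=C] assms) auto
qed

text \<open>Inside \<open>Om l\<close> the flux coefficient is 1/\<rho>, and the mass coefficient
  1/(\<rho> v^2) times w = v^2 \<open>hin l\<close> is \<open>hin l\<close> / \<rho>. Both terms
  carry the same factor 1/\<rho>, so each domain contributes a multiple of its original Neumann
  pairing.\<close>

lemma weak_form_split:
  assumes pos: "\<And>l. l \<in> {1..n} \<Longrightarrow> v l > 0 \<and> \<rho> l > 0"
    and g: "\<And>i. sq_integrable (g i)" and w: "sq_integrable w"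
    and hex: "L2_on Oex hex" and hin: "\<And>l. l \<in> {1..n} \<Longrightarrow> L2_on (Om l) (hin l)"
    and wex: "AE x in lebesgue. x \<in> Oex \<longrightarrow> w x = hex x"
    and win: "\<And>l. l \<in> {1..n} \<Longrightarrow> AE x in lebesgue. x \<in> Om l \<longrightarrow> w x = of_real ((v l)\<^sup>2) * hin l x"
    and \<phi>: "ck_test (Suc k) V \<phi>"
  shows "weak_form v \<rho> g w \<phi> = neumann_pairing Oex g hex \<phi>
     + (\<Sum>l\<in>{1..n}. of_real (1 / \<rho> l) * neumann_pairing (Om l) g (hin l) \<phi>)"
proof -
  let ?g = "\<lambda>i x. of_real (flux_coef \<rho> x) * g i x"
  let ?h = "\<lambda>x. of_real (mass_coef v \<rho> x) * w x"
  have g': "\<And>i. sq_integrable (?g i)" and h': "sq_integrable ?h"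
    using g w by (auto intro: sq_integrable_coef)
  have "weak_form v \<rho> g w \<phi> = (LINT x|lebesgue. pairing_density ?g ?h \<phi> x)"
    by (simp add: weak_form_def neumann_pairing_eq set_lebesgue_integral_def)
  also have "\<dots> = neumann_pairing Oex ?g ?h \<phi> + (\<Sum>l\<in>{1..n}. neumann_pairing (Om l) ?g ?h \<phi>)"
    using integral_split[OF integrable_pairing_density[OF g' h' \<phi>]] by (simp only: neumann_pairing_eq)
  also have "neumann_pairing Oex ?g ?h \<phi> = 1 * neumann_pairing Oex g (\<lambda>x. indicator Oex x *\<^sub>R hex x) \<phi>"
  proof (rule neumann_pairing_scale_AE[OF sets_Oex g g' L2_on_extend[OF hex] h' \<phi>])
    show "AE x in lebesgue. x \<in> Oex \<longrightarrow> (\<forall>i. ?g i x = 1 * g i x) \<and> ?h x = 1 * (indicator Oex x *\<^sub>R hex x)"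
      using wex
    proof eventually_elim
      case (elim x)
      have "coef \<alpha> x = 1" if "x \<in> Oex" for \<alpha> using that Oex_Om_disjoint by (intro coef_outside) blast
      with elim show ?case by simp
    qed
  qed
  also have "\<dots> = neumann_pairing Oex g hex \<phi>" by (simp add: neumann_pairing_extend)
  also have "(\<Sum>l\<in>{1..n}. neumann_pairing (Om l) ?g ?h \<phi>)
      = (\<Sum>l\<in>{1..n}. of_real (1 / \<rho> l) * neumann_pairing (Om l) g (hin l) \<phi>)"
  proof (rule sum.cong[OF refl])
    fix l assume l: "l \<in> {1..n}"
    have "neumann_pairing (Om l) ?g ?h \<phi> = of_real (1 / \<rho> l) * neumann_pairing (Om l) g (\<lambda>x. indicator (Om l) x *\<^sub>R hin l x) \<phi>"
    proof (rule neumann_pairing_scale_AE[OF sets_Om[OF l] g g' L2_on_extend[OF hin[OF l]] h' \<phi>])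
      show "AE x in lebesgue. x \<in> Om l \<longrightarrow> (\<forall>i. ?g i x = of_real (1 / \<rho> l) * g i x) \<and>
          ?h x = of_real (1 / \<rho> l) * (indicator (Om l) x *\<^sub>R hin l x)"
        using win[OF l] by eventually_elim (use coef_Om[OF l] pos[OF l] in \<open>auto simp: field_simps\<close>)
    qed
    then show "neumann_pairing (Om l) ?g ?h \<phi> = of_real (1 / \<rho> l) * neumann_pairing (Om l) g (hin l) \<phi>"
      by (simp add: neumann_pairing_extend)
  qed
  finally show ?thesis .
qed

section \<open>Equivalence of the operator graph and the weak form\<close>

abbreviation away_from_others :: "nat \<Rightarrow> pt set" where
  "away_from_others l \<equiv> - (\<Union>k\<in>{1..n} - {l}. closure (Om k))"

text \<open>A partition of unity near the closed domains, each cutoff avoiding all domains but its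
  own. One minus the sum vanishes near every closed domain, so multiplying by it confines a test
  function to the exterior.\<close>

lemma separating_cutoffs:
  obtains \<eta> W where
    "\<And>l. l \<in> {1..n} \<Longrightarrow> ck_test 3 (away_from_others l) (\<eta> l)"
    "open W" "(\<Union>l\<in>{1..n}. closure (Om l)) \<subseteq> W" "\<And>x. x \<in> W \<Longrightarrow> (\<Sum>l\<in>{1..n}. \<eta> l x) = 1"
proof -
  let ?V = away_from_others
  have "\<exists>\<eta> W. ck_test 3 (?V l) \<eta> \<and> open W \<and> closure (Om l) \<subseteq> W \<and> (\<forall>x\<in>W. \<eta> x = 1)"
    if l: "l \<in> {1..n}" for l
  proof -
    have "compact (closure (Om l))" using bounded_Om[OF l] by (simp add: compact_closure)
    moreover have "open (?V l)" by (intro open_Compl closed_UN) auto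
    moreover have "closure (Om l) \<subseteq> ?V l" using disjoint_closure_Om[OF l] by blast
    ultimately show ?thesis by (rule smooth_cutoff[of _ _ 3]) blast
  qed
  then obtain \<eta> W where \<eta>: "\<And>l. l \<in> {1..n} \<Longrightarrow> ck_test 3 (?V l) (\<eta> l)"
    and W: "\<And>l. l \<in> {1..n} \<Longrightarrow> open (W l)" "\<And>l. l \<in> {1..n} \<Longrightarrow> closure (Om l) \<subseteq> W l"
    and one: "\<And>l x. l \<in> {1..n} \<Longrightarrow> x \<in> W l \<Longrightarrow> \<eta> l x = 1" by metis
  \<comment> \<open>With the supports of the other cutoffs removed, exactly one cutoff is nonzero
    here, and its value is 1.\<close>
  define W' where "W' l = W l - (\<Union>k\<in>{1..n} - {l}. supp (\<eta> k))" for l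
  have "open (\<Union>l\<in>{1..n}. W' l)"
    unfolding W'_def using W(1) by (intro open_UN ballI open_Diff closed_UN) auto
  moreover have "(\<Union>l\<in>{1..n}. closure (Om l)) \<subseteq> (\<Union>l\<in>{1..n}. W' l)"
  proof (rule UN_mono[OF order_refl])
    fix l assume l: "l \<in> {1..n}"
    have "supp (\<eta> k) \<inter> closure (Om l) = {}" if "k \<in> {1..n} - {l}" for k
      using \<eta>[of k] that l unfolding ck_test_def by blast
    then show "closure (Om l) \<subseteq> W' l" using W(2)[OF l] unfolding W'_def by blast
  qed
  moreover have "(\<Sum>l\<in>{1..n}. \<eta> l x) = 1" if "x \<in> (\<Union>l\<in>{1..n}. W' l)" for x
  proof -
    obtain l where l: "l \<in> {1..n}" "x \<in> W' l" using \<open>x \<in> (\<Union>l\<in>{1..n}. W' l)\<close> by blast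
    have "(\<Sum>k\<in>{1..n}. \<eta> k x) = (\<Sum>k\<in>{1..n}. if k = l then 1 else 0)"
    proof (intro sum.cong refl)
      fix k assume k: "k \<in> {1..n}"
      show "\<eta> k x = (if k = l then 1 else 0)"
      proof (cases "k = l")
        case True
        then show ?thesis using one[of l x] l by (simp add: W'_def)
      next
        case False
        then have "x \<notin> supp (\<eta> k)" using l(2) k by (auto simp: W'_def)
        from zero_outside_support[OF this] False show ?thesis by simp
      qed
    qed
    then show ?thesis using l(1) by simp
  qed
  ultimately show thesis using that[of \<eta> "\<Union>l\<in>{1..n}. W' l"] \<eta> by blast
qed

lemma sum_single: "l \<in> {1..n} \<Longrightarrow> (\<And>k. k \<in> {1..n} \<Longrightarrow> k \<noteq> l \<Longrightarrow> f k = 0) \<Longrightarrow> sum f {1..n} = (f l :: complex)"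
  using sum.remove[of "{1..n}" l f] sum.neutral[of "{1..n} - {l}" f] by auto

lemma weak_form_add:
  assumes "\<And>i. sq_integrable (g i)" "sq_integrable w" "ck_test (Suc k) UNIV \<phi>" "ck_test (Suc k) UNIV \<psi>"
  shows "weak_form v \<rho> g w (\<lambda>x. \<phi> x + \<psi> x) = weak_form v \<rho> g w \<phi> + weak_form v \<rho> g w \<psi>"
  unfolding weak_form_def
proof (rule neumann_pairing_add[OF _ _ assms(3,4)])
  show "sq_integrable (\<lambda>x. complex_of_real (flux_coef \<rho> x) * g i x)" for i
    by (rule sq_integrable_coef[OF assms(1)])
  show "sq_integrable (\<lambda>x. complex_of_real (mass_coef v \<rho> x) * w x)"
    by (rule sq_integrable_coef[OF assms(2)])
qed

text \<open>The regularity of the partial sum is part of the claim because additivity of the form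
  uses it in the induction step.\<close>

lemma weak_form_sum_zero:
  assumes g: "\<And>i. sq_integrable (g i)" and w: "sq_integrable w"
    and "finite A" and \<psi>: "\<And>a. a \<in> A \<Longrightarrow> ck_test (Suc k) UNIV (\<psi> a)"
    and z: "\<And>a. a \<in> A \<Longrightarrow> weak_form v \<rho> g w (\<psi> a) = 0"
  shows "ck_test (Suc k) UNIV (\<lambda>x. \<Sum>a\<in>A. \<psi> a x) \<and> weak_form v \<rho> g w (\<lambda>x. \<Sum>a\<in>A. \<psi> a x) = 0"
  using \<open>finite A\<close> \<psi> z
proof (induction A)
  case empty
  have "weak_form v \<rho> g w (\<lambda>x. 0) = 0" unfolding weak_form_def by (rule neumann_pairing_zero) simp
  moreover have "ck_test (Suc k) UNIV (\<lambda>x. 0)" by (simp only: ck_test_def ck_const) simp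
  ultimately show ?case by simp
next
  case (insert a A)
  then have "ck_test (Suc k) UNIV (\<lambda>x. \<Sum>a\<in>A. \<psi> a x)" "weak_form v \<rho> g w (\<lambda>x. \<Sum>a\<in>A. \<psi> a x) = 0"
    and a: "ck_test (Suc k) UNIV (\<psi> a)" "weak_form v \<rho> g w (\<psi> a) = 0"
    by (blast intro: insertI1 insertI2)+
  then show ?case using insert.hyps
    by (simp add: weak_form_add[OF g w a(1)] ck_test_add)
qed

text \<open>Split \<phi> by the separating cutoffs. On the exterior piece Green's formula and the
  weak Laplacian cancel; on the piece of domain \<open>l\<close> the transmission condition cancels
  the exterior pairing against 1/\<rho> times the interior one. The test functions are C^3, as the
  gradient is only known against C^2 tests.\<close>

lemma acoustic_graph_weak_form:
  assumes pos: "\<And>l. l \<in> {1..n} \<Longrightarrow> v l > 0 \<and> \<rho> l > 0"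
    and graph: "acoustic_graph n Om v \<rho> u w"
  obtains g where "sq_integrable u" "sq_integrable w" "\<And>i. sq_integrable (g i)"
    "l2_of (mk_jet u g) \<in> sobolev"
    "\<And>\<phi>. ck_test 3 UNIV \<phi> \<Longrightarrow> weak_form v \<rho> g w \<phi> = 0"
proof -
  obtain g hex hin where u: "sq_integrable u" and w: "sq_integrable w"
    and g: "\<And>i. sq_integrable (g i)" and wg: "weak_grad UNIV u g"
    and hex: "L2_on Oex hex" "weak_lap Oex u hex"
    and hin: "\<And>l. l \<in> {1..n} \<Longrightarrow> L2_on (Om l) (hin l)"
    and trans: "\<And>l \<phi>. l \<in> {1..n} \<Longrightarrow> test_fun UNIV \<phi> \<Longrightarrow>
           (\<forall>k\<in>{1..n}. k \<noteq> l \<longrightarrow> supp \<phi> \<inter> closure (Om k) = {}) \<Longrightarrow>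
           of_real (\<rho> l) * (- neumann_pairing Oex g hex \<phi>) = neumann_pairing (Om l) g (hin l) \<phi>"
    and wex: "AE x in lebesgue. x \<in> Oex \<longrightarrow> w x = hex x"
    and win: "\<And>l. l \<in> {1..n} \<Longrightarrow> AE x in lebesgue. x \<in> Om l \<longrightarrow> w x = of_real ((v l)\<^sup>2) * hin l x"
    using graph unfolding acoustic_graph_def L2_on_UNIV_iff by blast
  have wj: "l2_of (mk_jet u g) \<in> weak_jets 2"
    using wg weak_grad_iff_weak_jets[OF u g] by simp
  have split: "weak_form v \<rho> g w \<phi> = neumann_pairing Oex g hex \<phi>
      + (\<Sum>l\<in>{1..n}. of_real (1 / \<rho> l) * neumann_pairing (Om l) g (hin l) \<phi>)"
    if \<phi>: "ck_test (Suc k) UNIV \<phi>" for k \<phi>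
    by (rule weak_form_split[OF _ _ _ _ _ _ _ \<phi>]) (fact pos g w hex(1) hin wex win)+
  have ext: "weak_form v \<rho> g w \<psi> = 0" if \<psi>: "ck_test 3 Oex \<psi>" for \<psi>
  proof -
    have \<psi>3: "ck_test (Suc 2) UNIV \<psi>" "ck_test (Suc (Suc 1)) Oex \<psi>" "ck_test (Suc (Suc (Suc 0))) Oex \<psi>"
      using \<psi> ck_test_mono[of 3 Oex \<psi>] by (auto simp: eval_nat_numeral)
    have "neumann_pairing (Om l) g (hin l) \<psi> = 0" if "l \<in> {1..n}" for l
      using \<psi> Oex_Om_disjoint[OF that] by (intro neumann_pairing_zero) (auto simp: ck_test_def)
    then have "weak_form v \<rho> g w \<psi> = neumann_pairing Oex g hex \<psi>" using split[OF \<psi>3(1)] by simp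
    also have "\<dots> = neumann_pairing Oex g (\<lambda>x. indicator Oex x *\<^sub>R hex x) \<psi>" by (simp add: neumann_pairing_extend)
    also have "\<dots> = (LINT x:Oex|lebesgue. (indicator Oex x *\<^sub>R hex x) * of_real (\<psi> x)) - (LINT x:Oex|lebesgue. u x * of_real (lap \<psi> x))"
      by (rule neumann_pairing_green[OF u g L2_on_extend[OF hex(1)], where k=1]) (use wj \<psi>3 in \<open>auto simp: numeral_2_eq_2\<close>)
    also have "(LINT x:Oex|lebesgue. (indicator Oex x *\<^sub>R hex x) * of_real (\<psi> x)) = (LINT x:Oex|lebesgue. hex x * of_real (\<psi> x))"
      unfolding set_lebesgue_integral_def by (rule Bochner_Integration.integral_cong) (auto simp: indicator_def)
    also have "\<dots> = (LINT x:Oex|lebesgue. u x * of_real (lap \<psi> x))"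
      using hex(2) ck_test_mono[OF \<psi>, of 2 Oex] by (simp add: weak_lap_def test_fun_iff)
    finally show ?thesis by simp
  qed
  have int: "weak_form v \<rho> g w \<psi> = 0"
    if l: "l \<in> {1..n}" and \<psi>: "ck_test 3 (away_from_others l) \<psi>" for l \<psi>
  proof -
    have \<psi>3: "ck_test (Suc 2) UNIV \<psi>" using \<psi> by (auto intro: ck_test_mono)
    have dis: "supp \<psi> \<inter> closure (Om k) = {}" if "k \<in> {1..n}" "k \<noteq> l" for k
      using \<psi> that unfolding ck_test_def by blast
    then have z: "neumann_pairing (Om k) g (hin k) \<psi> = 0" if "k \<in> {1..n}" "k \<noteq> l" for k
      using that closure_subset[of "Om k"] by (intro neumann_pairing_zero) blast
    have "(\<Sum>k\<in>{1..n}. of_real (1 / \<rho> k) * neumann_pairing (Om k) g (hin k) \<psi>)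
        = of_real (1 / \<rho> l) * neumann_pairing (Om l) g (hin l) \<psi>"
      using z by (intro sum_single l) auto
    \<comment> \<open>The minus sign comes from the normal: the pairing over the exterior belongs to
      the normal pointing into \<open>Om l\<close>, the trace in the transmission condition to the
      opposite one.\<close>
    also have "neumann_pairing (Om l) g (hin l) \<psi> = of_real (\<rho> l) * (- neumann_pairing Oex g hex \<psi>)"
      using \<psi>3 dis ck_test_mono[of "Suc 2" UNIV \<psi> 2 UNIV] by (intro trans[OF l, symmetric]) (auto simp: test_fun_iff)
    finally show ?thesis using split[OF \<psi>3] pos[OF l] by simp
  qed
  obtain \<eta> W where \<eta>: "\<And>l. l \<in> {1..n} \<Longrightarrow> ck_test 3 (away_from_others l) (\<eta> l)"
    and W: "open W" "(\<Union>l\<in>{1..n}. closure (Om l)) \<subseteq> W" and one: "\<And>x. x \<in> W \<Longrightarrow> (\<Sum>l\<in>{1..n}. \<eta> l x) = 1"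
    using separating_cutoffs by blast
  have "weak_form v \<rho> g w \<phi> = 0" if \<phi>: "ck_test 3 UNIV \<phi>" for \<phi>
  proof -
    have \<phi>3: "ck_test (Suc 2) UNIV \<phi>" using \<phi> by simp
    define \<phi>0 where "\<phi>0 x = (1 - (\<Sum>l\<in>{1..n}. \<eta> l x)) * \<phi> x" for x
    have 0: "ck_test (Suc 2) UNIV \<phi>0" unfolding \<phi>0_def
      using \<eta> by (intro ck_test_mult \<phi>3 ck_diff ck_const ck_sum) (auto simp: ck_test_def)
    have "supp \<phi>0 \<subseteq> - W"
      by (rule closure_minimal) (use one W(1) in \<open>auto simp: \<phi>0_def\<close>)
    then have "supp \<phi>0 \<subseteq> Oex" using W(2) by (auto simp: Oex_eq)
    then have 1: "weak_form v \<rho> g w \<phi>0 = 0" using 0 by (intro ext) (auto simp: ck_test_def)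
    have l1: "ck_test 3 (away_from_others l) (\<lambda>x. \<phi> x * \<eta> l x)" if "l \<in> {1..n}" for l
      by (intro ck_test_mult \<eta> that ck_test_ck[OF \<phi>])
    have 2: "ck_test (Suc 2) UNIV (\<lambda>x. \<Sum>l\<in>{1..n}. \<phi> x * \<eta> l x) \<and> weak_form v \<rho> g w (\<lambda>x. \<Sum>l\<in>{1..n}. \<phi> x * \<eta> l x) = 0"
    proof (rule weak_form_sum_zero[OF g w])
      fix l assume l: "l \<in> {1..n}"
      show "weak_form v \<rho> g w (\<lambda>x. \<phi> x * \<eta> l x) = 0" by (rule int[OF l l1[OF l]])
      show "ck_test (Suc 2) UNIV (\<lambda>x. \<phi> x * \<eta> l x)" using ck_test_mono[OF l1[OF l], of "Suc 2" UNIV] by simp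
    qed simp
    have "\<phi> = (\<lambda>x. \<phi>0 x + (\<Sum>l\<in>{1..n}. \<phi> x * \<eta> l x))"
      by (simp add: \<phi>0_def sum_distrib_left[symmetric] algebra_simps)
    then have "weak_form v \<rho> g w \<phi> = weak_form v \<rho> g w (\<lambda>x. \<phi>0 x + (\<Sum>l\<in>{1..n}. \<phi> x * \<eta> l x))" by simp
    also have "\<dots> = 0" using weak_form_add[OF g w 0 conjunct1[OF 2]] 1 2 by simp
    finally show ?thesis .
  qed
  then show thesis using that[of g] u w g wj weak_jets_subset_sobolev by blast
qed

text \<open>Localising the test function recovers the conditions one by one: support in the exterior
  or in one domain gives the weak Laplacian there, support meeting at most one closed domain gives
  its transmission condition. Membership in \<open>sobolev\<close> validates the gradient against
  C^1 tests, so Green's formula reaches every C^2 function.\<close>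

lemma weak_form_acoustic_graph:
  assumes pos: "\<And>l. l \<in> {1..n} \<Longrightarrow> v l > 0 \<and> \<rho> l > 0"
    and u: "sq_integrable u" and w: "sq_integrable w" and g: "\<And>i. sq_integrable (g i)"
    and sob: "l2_of (mk_jet u g) \<in> sobolev"
    and weak: "\<And>\<phi>. ck_test 2 UNIV \<phi> \<Longrightarrow> weak_form v \<rho> g w \<phi> = 0"
  shows "acoustic_graph n Om v \<rho> u w"
proof -
  \<comment> \<open>Inside a domain \<open>w\<close> has to be v^2 times the Laplacian, which
    dictates this candidate; in the exterior \<open>w\<close> itself serves.\<close>
  define hin where "hin l x = of_real (1 / (v l)\<^sup>2) * w x" for l x
  have hin_si: "sq_integrable (hin l)" for l
    unfolding hin_def by (rule sq_integrable_mult_bounded[OF _ _ w, where C="norm (complex_of_real (1 / (v l)\<^sup>2))"]) auto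
  have hin: "L2_on (Om l) (hin l)" if "l \<in> {1..n}" for l
    by (rule sq_integrable_imp_L2_on[OF hin_si sets_Om[OF that]])
  have hex: "L2_on Oex w" by (rule sq_integrable_imp_L2_on[OF w sets_Oex])
  have win: "AE x in lebesgue. x \<in> Om l \<longrightarrow> w x = of_real ((v l)\<^sup>2) * hin l x" if "l \<in> {1..n}" for l
    using pos[OF that] by (simp add: hin_def)
  have wj1: "l2_of (mk_jet u g) \<in> weak_jets (Suc 0)" using sob sobolev_subset_weak_jets by auto
  then have wg: "weak_grad UNIV u g"
    using weak_grad_iff_weak_jets[OF u g] weak_jets_antimono[of "Suc 0" 2] by auto
  have wex: "AE x in lebesgue. x \<in> Oex \<longrightarrow> w x = w x" by simp
  have split: "weak_form v \<rho> g w \<phi> = neumann_pairing Oex g w \<phi>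
      + (\<Sum>l\<in>{1..n}. of_real (1 / \<rho> l) * neumann_pairing (Om l) g (hin l) \<phi>)"
    if \<phi>: "ck_test (Suc k) UNIV \<phi>" for k \<phi>
    by (rule weak_form_split[OF _ _ _ _ _ _ _ \<phi>]) (fact pos g w hex hin wex win)+
  have wlex: "weak_lap Oex u w"
    unfolding weak_lap_def test_fun_iff
  proof (intro allI impI)
    fix \<phi> assume \<phi>: "ck_test 2 Oex \<phi>"
    then have \<phi>2: "ck_test (Suc (Suc 0)) Oex \<phi>" "ck_test (Suc 1) UNIV \<phi>" "ck_test 2 UNIV \<phi>"
      using ck_test_mono[OF \<phi>, of _ UNIV] by (auto simp: numeral_2_eq_2)
    have "neumann_pairing (Om l) g (hin l) \<phi> = 0" if "l \<in> {1..n}" for l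
      using \<phi> Oex_Om_disjoint[OF that] by (intro neumann_pairing_zero) (auto simp: ck_test_def)
    then have "neumann_pairing Oex g w \<phi> = 0" using split[OF \<phi>2(2)] weak[OF \<phi>2(3)] by simp
    then show "(LINT x:Oex|lebesgue. u x * of_real (lap \<phi> x)) = (LINT x:Oex|lebesgue. w x * of_real (\<phi> x))"
      using neumann_pairing_green[OF u g w wj1 \<phi>2(1)] by simp
  qed
  have wlin: "weak_lap (Om l) u (hin l)" if l: "l \<in> {1..n}" for l
    unfolding weak_lap_def test_fun_iff
  proof (intro allI impI)
    fix \<phi> assume \<phi>: "ck_test 2 (Om l) \<phi>"
    then have \<phi>2: "ck_test (Suc (Suc 0)) (Om l) \<phi>" "ck_test (Suc 1) UNIV \<phi>" "ck_test 2 UNIV \<phi>"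
      using ck_test_mono[OF \<phi>, of _ UNIV] by (auto simp: numeral_2_eq_2)
    have "neumann_pairing Oex g w \<phi> = 0"
      using \<phi> Oex_Om_disjoint[OF l] by (intro neumann_pairing_zero) (auto simp: ck_test_def)
    moreover have "neumann_pairing (Om k) g (hin k) \<phi> = 0" if "k \<in> {1..n}" "k \<noteq> l" for k
      using \<phi> Om_disjoint[OF that(1) l] that(2) by (intro neumann_pairing_zero) (auto simp: ck_test_def)
    then have "(\<Sum>k\<in>{1..n}. of_real (1 / \<rho> k) * neumann_pairing (Om k) g (hin k) \<phi>)
        = of_real (1 / \<rho> l) * neumann_pairing (Om l) g (hin l) \<phi>"
      by (intro sum_single l) auto
    ultimately have "of_real (1 / \<rho> l) * neumann_pairing (Om l) g (hin l) \<phi> = 0"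
      using split[OF \<phi>2(2)] weak[OF \<phi>2(3)] by simp
    then have "neumann_pairing (Om l) g (hin l) \<phi> = 0" using pos[OF l] by simp
    then show "(LINT x:Om l|lebesgue. u x * of_real (lap \<phi> x)) = (LINT x:Om l|lebesgue. hin l x * of_real (\<phi> x))"
      using neumann_pairing_green[OF u g hin_si wj1 \<phi>2(1)] by simp
  qed
  have trans: "of_real (\<rho> l) * (- neumann_pairing Oex g w \<phi>) = neumann_pairing (Om l) g (hin l) \<phi>"
    if l: "l \<in> {1..n}" and \<phi>: "test_fun UNIV \<phi>"
      and dis: "\<forall>k\<in>{1..n}. k \<noteq> l \<longrightarrow> supp \<phi> \<inter> closure (Om k) = {}" for l \<phi>
  proof -
    have \<phi>2: "ck_test (Suc 1) UNIV \<phi>" "ck_test 2 UNIV \<phi>" using \<phi> by (auto simp: test_fun_iff numeral_2_eq_2)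
    have "neumann_pairing (Om k) g (hin k) \<phi> = 0" if "k \<in> {1..n}" "k \<noteq> l" for k
      using dis that closure_subset[of "Om k"] by (intro neumann_pairing_zero) blast
    then have "(\<Sum>k\<in>{1..n}. of_real (1 / \<rho> k) * neumann_pairing (Om k) g (hin k) \<phi>)
        = of_real (1 / \<rho> l) * neumann_pairing (Om l) g (hin l) \<phi>"
      by (intro sum_single l) auto
    then have "neumann_pairing Oex g w \<phi> + of_real (1 / \<rho> l) * neumann_pairing (Om l) g (hin l) \<phi> = 0"
      using split[OF \<phi>2(1)] weak[OF \<phi>2(2)] by simp
    then have "neumann_pairing (Om l) g (hin l) \<phi> + of_real (\<rho> l) * neumann_pairing Oex g w \<phi> = 0"
      using pos[OF l] by (simp add: field_simps)
    then show ?thesis unfolding mult_minus_right using eq_neg_iff_add_eq_0 by metis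
  qed
  show ?thesis unfolding acoustic_graph_def L2_on_UNIV_iff
    by (intro conjI exI[of _ g] exI[of _ w] exI[of _ hin] u w)
       (use g wg hex wlex hin wlin trans win in auto)
qed

section \<open>Resolvents\<close>

text \<open>The rotation factor \<open>c = \<i> \<kappa>\<^sup>*\<close> makes both \<open>Re c = Im \<kappa>\<close> and \<open>Re (- c \<kappa>\<^sup>2) = |\<kappa>|\<^sup>2 Im \<kappa>\<close> positive.\<close>
definition form_operator :: "complex \<Rightarrow> (nat \<Rightarrow> real) \<Rightarrow> (nat \<Rightarrow> real) \<Rightarrow> (pt, jet) l2 \<Rightarrow> (pt, jet) l2" where
  "form_operator \<kappa> v \<rho> = diag_mult
     (\<lambda>x. \<i> * cnj \<kappa> * (- \<kappa>\<^sup>2) * of_real (mass_coef v \<rho> x))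
     (\<lambda>x. \<i> * cnj \<kappa> * of_real (flux_coef \<rho> x))"

text \<open>Only the slot of function values is loaded: the functional pairs b f with the value of
  the test element, rotated by the same factor as the operator.\<close>

definition form_rhs :: "complex \<Rightarrow> (nat \<Rightarrow> real) \<Rightarrow> (nat \<Rightarrow> real) \<Rightarrow> (pt \<Rightarrow> complex) \<Rightarrow> (pt, jet) l2" where
  "form_rhs \<kappa> v \<rho> f = diag_mult
     (\<lambda>x. \<i> * cnj \<kappa> * of_real (mass_coef v \<rho> x)) (\<lambda>x. 0) (l2_of (\<lambda>x. (f x, \<chi> i. 0)))"

definition solves :: "complex \<Rightarrow> (nat \<Rightarrow> real) \<Rightarrow> (nat \<Rightarrow> real) \<Rightarrow> (pt \<Rightarrow> complex) \<Rightarrow> (pt, jet) l2 \<Rightarrow> bool" where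
  "solves \<kappa> v \<rho> f F \<longleftrightarrow> F \<in> sobolev \<and> (\<forall>G\<in>sobolev. inner (form_operator \<kappa> v \<rho> F - form_rhs \<kappa> v \<rho> f) G = 0)"

lemma bounded_coef_coef:
  assumes "\<And>x. \<bar>coef \<alpha> x\<bar> \<le> C"
  shows "bounded_coef (norm c * C) (\<lambda>x. c * of_real (coef \<alpha> x))"
  using assms by (auto simp: bounded_coef_def norm_mult intro!: mult_left_mono)

lemma form_coefficients_bounded:
  obtains C where "0 \<le> C"
    "bounded_coef C (\<lambda>x. \<i> * cnj \<kappa> * (- \<kappa>\<^sup>2) * of_real (mass_coef v \<rho> x))"
    "bounded_coef C (\<lambda>x. \<i> * cnj \<kappa> * of_real (flux_coef \<rho> x))"
    "bounded_coef C (\<lambda>x. \<i> * cnj \<kappa> * of_real (mass_coef v \<rho> x))"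
proof -
  have ex: "\<exists>C\<ge>0. bounded_coef C (\<lambda>x. c * of_real (coef \<alpha> x))" for c \<alpha>
  proof -
    obtain C where C: "\<And>x. \<bar>coef \<alpha> x\<bar> \<le> C" using coef_bounded by blast
    then have "0 \<le> C" by (meson abs_ge_zero order_trans)
    then show ?thesis using bounded_coef_coef[OF C] by (intro exI[of _ "norm c * C"]) auto
  qed
  obtain A B D where "0 \<le> A" "0 \<le> B" "0 \<le> D"
    "bounded_coef A (\<lambda>x. \<i> * cnj \<kappa> * (- \<kappa>\<^sup>2) * of_real (mass_coef v \<rho> x))"
    "bounded_coef B (\<lambda>x. \<i> * cnj \<kappa> * of_real (flux_coef \<rho> x))"
    "bounded_coef D (\<lambda>x. \<i> * cnj \<kappa> * of_real (mass_coef v \<rho> x))"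
    using ex by meson
  then show thesis by (intro that[of "A + B + D"]) (auto intro: bounded_coef_mono)
qed

lemma bounded_linear_form_operator: "bounded_linear (form_operator \<kappa> v \<rho>)"
  unfolding form_operator_def by (rule form_coefficients_bounded) (rule bounded_linear_diag_mult)

text \<open>Inserting f = - w - \<kappa>^2 u collapses the zeroth-order terms, - \<kappa>^2 b u - b
  f = b w, and leaves the weak form times the rotation factor. This is the dictionary between the
  Hilbert space equation and the acoustic problem.\<close>

lemma form_residual_jet:
  assumes u: "sq_integrable u" and g: "\<And>i. sq_integrable (g i)"
    and f: "sq_integrable f" and w: "sq_integrable w"
    and eq: "AE x in lebesgue. - w x - \<kappa>\<^sup>2 * u x = f x"
    and \<phi>: "ck_test (Suc k) UNIV \<phi>"
  shows "inner (form_operator \<kappa> v \<rho> (l2_of (mk_jet u g)) - form_rhs \<kappa> v \<rho> f) (l2_of (jet \<phi> z))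
    = inner (\<i> * cnj \<kappa> * weak_form v \<rho> g w \<phi>) z"
proof -
  define c where "c = \<i> * cnj \<kappa>"
  define a where "a = flux_coef \<rho>"
  define b where "b = mass_coef v \<rho>"
  obtain C where C: "0 \<le> C" "bounded_coef C (\<lambda>x. c * (- \<kappa>\<^sup>2) * of_real (b x))"
    "bounded_coef C (\<lambda>x. c * of_real (a x))" "bounded_coef C (\<lambda>x. c * of_real (b x))"
    unfolding a_def b_def c_def by (rule form_coefficients_bounded)
  have U: "sq_integrable (mk_jet u g)" by (rule sq_integrable_jetI[OF u g])
  have F: "sq_integrable (\<lambda>x. (f x, \<chi> i::3. (0::complex)))"
    by (rule sq_integrable_jetI[OF f sq_integrable_zero])
  have ag: "sq_integrable (\<lambda>x. complex_of_real (a x) * g i x)" for i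
    unfolding a_def by (rule sq_integrable_coef[OF g])
  have bw: "sq_integrable (\<lambda>x. complex_of_real (b x) * w x)"
    unfolding b_def by (rule sq_integrable_coef[OF w])
  define H where "H x = (c * (of_real (b x) * w x), \<chi> i::3. c * (of_real (a x) * g i x))" for x
  have H: "sq_integrable H" unfolding H_def
    by (intro sq_integrable_jetI sq_integrable_mult_bounded[where C="norm c"] ag bw) auto
  note si = sq_integrable_diag_fun[OF C(2,3) U] sq_integrable_diag_fun[OF C(4) bounded_coef_zero[OF C(1)] F]
  have "form_operator \<kappa> v \<rho> (l2_of (mk_jet u g)) - form_rhs \<kappa> v \<rho> f
      = l2_of (diag_fun (\<lambda>x. c * (- \<kappa>\<^sup>2) * of_real (b x)) (\<lambda>x. c * of_real (a x)) (mk_jet u g))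
       - l2_of (diag_fun (\<lambda>x. c * of_real (b x)) (\<lambda>x. 0) (\<lambda>x. (f x, \<chi> i. 0)))"
    unfolding form_operator_def form_rhs_def a_def[symmetric] b_def[symmetric] c_def[symmetric]
    by (simp only: diag_mult_l2_of[OF C(2,3) U] diag_mult_l2_of[OF C(4) bounded_coef_zero[OF C(1)] F])
  also have "\<dots> = l2_of H"
    unfolding l2_of_diff[OF si, symmetric]
  proof (subst l2_of_eq_iff[OF sq_integrable_diff[OF si] H])
    show "AE x in lebesgue. diag_fun (\<lambda>x. c * (- \<kappa>\<^sup>2) * of_real (b x)) (\<lambda>x. c * of_real (a x)) (mk_jet u g) x
        - diag_fun (\<lambda>x. c * of_real (b x)) (\<lambda>x. 0) (\<lambda>x. (f x, \<chi> i. 0)) x = H x"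
      using eq
    proof eventually_elim
      case (elim x)
      have "w x = - \<kappa>\<^sup>2 * u x - (- w x - \<kappa>\<^sup>2 * u x)" by simp
      then have "w x = - \<kappa>\<^sup>2 * u x - f x" unfolding elim .
      then show ?case unfolding diag_fun_def H_def by (simp add: prod_eq_iff vec_eq_iff right_diff_distrib mult_ac)
    qed
  qed
  also have "inner (l2_of H) (l2_of (jet \<phi> z))
      = inner (LINT x|lebesgue. \<phi> x *\<^sub>R fst (H x) + (\<Sum>i\<in>UNIV. pd i \<phi> x *\<^sub>R snd (H x) $ i)) z"
    by (rule inner_l2_jet[OF H \<phi>])
  also have "(LINT x|lebesgue. \<phi> x *\<^sub>R fst (H x) + (\<Sum>i\<in>UNIV. pd i \<phi> x *\<^sub>R snd (H x) $ i))
      = (LINT x|lebesgue. c * pairing_density (\<lambda>i x. of_real (a x) * g i x) (\<lambda>x. of_real (b x) * w x) \<phi> x)"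
    by (rule Bochner_Integration.integral_cong)
       (auto simp: H_def pairing_density_def scaleR_conv_of_real sum_distrib_left algebra_simps)
  also have "\<dots> = c * weak_form v \<rho> g w \<phi>"
    by (simp add: weak_form_def a_def b_def neumann_pairing_eq set_lebesgue_integral_def)
  finally show ?thesis by (simp add: c_def)
qed

lemma coef_ge:
  assumes "\<And>l. l \<in> {1..n} \<Longrightarrow> m \<le> \<alpha> l" "m \<le> 1" shows "m \<le> coef \<alpha> x"
  using assms by (cases rule: coef_cases[of x]) auto

lemma form_operator_coercive:
  assumes \<kappa>: "Im \<kappa> > 0" and m: "0 < m" "m \<le> 1"
    and le: "\<And>l. l \<in> {1..n} \<Longrightarrow> m \<le> 1 / \<rho> l" "\<And>l. l \<in> {1..n} \<Longrightarrow> m \<le> 1 / (\<rho> l * (v l)\<^sup>2)"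
  shows "Im \<kappa> * m * min 1 ((norm \<kappa>)\<^sup>2) * (norm F)\<^sup>2 \<le> inner (form_operator \<kappa> v \<rho> F) F"
proof -
  have 1: "Re (\<i> * cnj \<kappa> * (- \<kappa>\<^sup>2) * of_real t) = Im \<kappa> * ((norm \<kappa>)\<^sup>2 * t)" for t
    unfolding cmod_power2 by (simp add: power2_eq_square algebra_simps)
  have 2: "Re (\<i> * cnj \<kappa> * of_real t) = Im \<kappa> * (1 * t)" for t by simp
  \<comment> \<open>Both real parts have the shape Im \<kappa> times weight times coefficient, with
    weight |\<kappa>|^2 for the mass term and 1 for the flux term; hence the minimum in the
    constant.\<close>
  have 3: "Im \<kappa> * m * min 1 ((norm \<kappa>)\<^sup>2) \<le> Im \<kappa> * (r * t)" if "m \<le> t" "min 1 ((norm \<kappa>)\<^sup>2) \<le> r" for r t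
  proof -
    have "m * min 1 ((norm \<kappa>)\<^sup>2) \<le> t * r" using that m by (intro mult_mono) auto
    then show ?thesis using \<kappa> by (simp add: mult.assoc mult.commute[of r])
  qed
  show ?thesis
  proof (rule form_coefficients_bounded)
    fix C
    assume "bounded_coef C (\<lambda>x. \<i> * cnj \<kappa> * (- \<kappa>\<^sup>2) * of_real (mass_coef v \<rho> x))"
      "bounded_coef C (\<lambda>x. \<i> * cnj \<kappa> * of_real (flux_coef \<rho> x))"
    then show ?thesis unfolding form_operator_def
    proof (rule diag_mult_coercive)
      show "Im \<kappa> * m * min 1 ((norm \<kappa>)\<^sup>2) \<le> Re (\<i> * cnj \<kappa> * (- \<kappa>\<^sup>2) * of_real (mass_coef v \<rho> x))" for x
        unfolding 1 by (intro 3 coef_ge le m) auto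
      show "Im \<kappa> * m * min 1 ((norm \<kappa>)\<^sup>2) \<le> Re (\<i> * cnj \<kappa> * of_real (flux_coef \<rho> x))" for x
        unfolding 2 by (intro 3 coef_ge le m) auto
    qed
  qed
qed

lemma positive_lower_bound:
  fixes \<alpha> \<beta> :: "nat \<Rightarrow> real"
  assumes "\<And>l. l \<in> {1..n} \<Longrightarrow> \<alpha> l > 0" "\<And>l. l \<in> {1..n} \<Longrightarrow> \<beta> l > 0"
  obtains m where "0 < m" "m \<le> 1" "\<And>l. l \<in> {1..n} \<Longrightarrow> m \<le> \<alpha> l" "\<And>l. l \<in> {1..n} \<Longrightarrow> m \<le> \<beta> l"
proof -
  let ?S = "insert 1 (\<alpha> ` {1..n} \<union> \<beta> ` {1..n})"
  have "0 < Min ?S" using assms by (subst Min_gr_iff) auto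
  moreover have "Min ?S \<le> x" if "x \<in> ?S" for x using that by (intro Min_le) auto
  ultimately show thesis using that[of "Min ?S"] by blast
qed

lemma coefficients_positive:
  assumes "\<And>l. l \<in> {1..n} \<Longrightarrow> v l > 0 \<and> \<rho> l > (0::real)" "l \<in> {1..n}"
  shows "1 / \<rho> l > 0" "1 / (\<rho> l * (v l)\<^sup>2) > 0"
  using assms(1)[OF assms(2)] by auto

lemma acoustic_resolvent_exists:
  assumes pos: "\<And>l. l \<in> {1..n} \<Longrightarrow> v l > 0 \<and> \<rho> l > 0" and \<kappa>: "Im \<kappa> > 0" and f: "sq_integrable f"
  shows "\<exists>u w. acoustic_graph n Om v \<rho> u w \<and> (AE x in lebesgue. - w x - \<kappa>\<^sup>2 * u x = f x)"
proof -
  obtain m where m: "0 < m" "m \<le> 1" "\<And>l. l \<in> {1..n} \<Longrightarrow> m \<le> 1 / \<rho> l" "\<And>l. l \<in> {1..n} \<Longrightarrow> m \<le> 1 / (\<rho> l * (v l)\<^sup>2)"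
    using positive_lower_bound[of "\<lambda>l. 1 / \<rho> l" "\<lambda>l. 1 / (\<rho> l * (v l)\<^sup>2)"] coefficients_positive[of v \<rho>, OF pos] by metis
  have \<kappa>0: "\<kappa> \<noteq> 0" using \<kappa> by auto
  then have "0 < Im \<kappa> * m * min 1 ((norm \<kappa>)\<^sup>2)" using \<kappa> m(1) by simp
  then have "\<exists>F\<in>sobolev. \<forall>G\<in>sobolev. inner (form_operator \<kappa> v \<rho> F - form_rhs \<kappa> v \<rho> f) G = 0"
  proof (rule lax_milgram_closed_subspace[OF subspace_sobolev closed_sobolev bounded_linear_form_operator])
    fix F
    show "Im \<kappa> * m * min 1 ((norm \<kappa>)\<^sup>2) * (norm F)\<^sup>2 \<le> inner (form_operator \<kappa> v \<rho> F) F"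
      using \<kappa> m by (rule form_operator_coercive)
  qed
  then obtain F where F: "F \<in> sobolev" "\<And>G. G \<in> sobolev \<Longrightarrow> inner (form_operator \<kappa> v \<rho> F - form_rhs \<kappa> v \<rho> f) G = 0"
    by blast
  define u where "u x = fst (l2_fun F x)" for x
  define g where "g i x = snd (l2_fun F x) $ i" for i x
  \<comment> \<open>The resolvent equation holds by construction; the weak form then has to show
    that \<open>w\<close> is the operator applied to \<open>u\<close>.\<close>
  define w where "w x = - \<kappa>\<^sup>2 * u x - f x" for x
  have u: "sq_integrable u" unfolding u_def by (rule sq_integrable_jet_fst[OF sq_integrable_l2_fun])
  have g: "sq_integrable (g i)" for i unfolding g_def by (rule sq_integrable_jet_snd[OF sq_integrable_l2_fun])
  have w: "sq_integrable w" unfolding w_def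
    by (intro sq_integrable_diff f sq_integrable_mult_bounded[OF _ _ u, where C="norm (- \<kappa>\<^sup>2)"]) auto
  have "mk_jet u g = l2_fun F" by (auto simp: u_def g_def prod_eq_iff vec_eq_iff)
  then have FF: "l2_of (mk_jet u g) = F" by simp
  have eq: "AE x in lebesgue. - w x - \<kappa>\<^sup>2 * u x = f x" by (simp add: w_def)
  \<comment> \<open>C^2 test functions are admissible because their jets belong to
    \<open>sobolev\<close>, and \<open>weak_form_acoustic_graph\<close> asks for exactly this
    class.\<close>
  have "weak_form v \<rho> g w \<phi> = 0" if \<phi>: "ck_test 2 UNIV \<phi>" for \<phi>
  proof -
    have "inner (\<i> * cnj \<kappa> * weak_form v \<rho> g w \<phi>) z = 0" for z
      using form_residual_jet[where u=u and g=g and f=f and w=w and \<kappa>=\<kappa> and \<phi>=\<phi> and k=1 and v=v and \<rho>=\<rho> and z=z, OF u g f w eq] F(2)[OF jet_in_sobolev[OF \<phi>]] \<phi>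
      by (simp add: FF numeral_2_eq_2)
    then have "\<i> * cnj \<kappa> * weak_form v \<rho> g w \<phi> = 0" by (rule inner_eq_zero_all_complex)
    then show ?thesis using \<kappa>0 by simp
  qed
  then have "acoustic_graph n Om v \<rho> u w"
    using F(1) by (intro weak_form_acoustic_graph[where g=g] pos u w g) (simp_all add: FF)
  with eq show ?thesis by blast
qed

text \<open>Existence discharges the \<open>SOME\<close>: whatever function is chosen, together with
  a suitable gradient it solves the weak problem. The later estimates use only this, so the choice
  of a representative does not enter.\<close>

lemma acoustic_resolvent_solves:
  assumes pos: "\<And>l. l \<in> {1..n} \<Longrightarrow> v l > 0 \<and> \<rho> l > 0" and \<kappa>: "Im \<kappa> > 0" and f: "sq_integrable f"
  shows "\<exists>g. sq_integrable (acoustic_resolvent n Om v \<rho> \<kappa> f) \<and> (\<forall>i. sq_integrable (g i)) \<and>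
    solves \<kappa> v \<rho> f (l2_of (\<lambda>x. (acoustic_resolvent n Om v \<rho> \<kappa> f x, \<chi> i. g i x)))"
proof -
  define u where "u = acoustic_resolvent n Om v \<rho> \<kappa> f"
  have "\<exists>w. acoustic_graph n Om v \<rho> u w \<and> (AE x in lebesgue. - w x - \<kappa>\<^sup>2 * u x = f x)"
    unfolding u_def acoustic_resolvent_def by (rule someI_ex[OF acoustic_resolvent_exists[OF pos \<kappa> f]])
  then obtain w where graph: "acoustic_graph n Om v \<rho> u w" and eq: "AE x in lebesgue. - w x - \<kappa>\<^sup>2 * u x = f x" by blast
  obtain g where u: "sq_integrable u" and w: "sq_integrable w" and g: "\<And>i. sq_integrable (g i)"
    and sob: "l2_of (mk_jet u g) \<in> sobolev"
    and weak: "\<And>\<phi>. ck_test 3 UNIV \<phi> \<Longrightarrow> weak_form v \<rho> g w \<phi> = 0"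
    using acoustic_graph_weak_form[OF pos graph] by blast
  have "inner (form_operator \<kappa> v \<rho> (l2_of (mk_jet u g)) - form_rhs \<kappa> v \<rho> f) G = 0" if "G \<in> sobolev" for G
  proof (rule orthogonal_sobolevI[OF _ that])
    fix \<phi> z assume \<phi>: "ck_test 3 UNIV \<phi>"
    then show "inner (form_operator \<kappa> v \<rho> (l2_of (mk_jet u g)) - form_rhs \<kappa> v \<rho> f) (l2_of (jet \<phi> z)) = 0"
      using form_residual_jet[where u=u and g=g and f=f and w=w and \<kappa>=\<kappa> and \<phi>=\<phi> and k=2 and v=v and \<rho>=\<rho> and z=z, OF u g f w eq] weak[OF \<phi>] by simp
  qed
  with u g sob show ?thesis by (intro exI[of _ g]) (auto simp: solves_def u_def)
qed

section \<open>Stability under a change of coefficients\<close>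

lemma coef_diff_le:
  "\<bar>coef \<alpha> x - coef \<beta> x\<bar> \<le> (\<Sum>l\<in>{1..n}. \<bar>\<alpha> l - \<beta> l\<bar>)"
proof (cases rule: coef_cases[of x])
  case (2 l)
  then show ?thesis using member_le_sum[of l "{1..n}" "\<lambda>l. \<bar>\<alpha> l - \<beta> l\<bar>"] by simp
qed (simp add: sum_nonneg)

lemma bounded_coef_diff:
  assumes "\<And>x. \<bar>coef \<alpha> x - coef \<beta> x\<bar> \<le> \<delta>" "norm c * \<delta> \<le> C"
  shows "bounded_coef C (\<lambda>x. c * of_real (coef \<alpha> x) - c * of_real (coef \<beta> x))"
proof -
  have "norm (c * of_real (coef \<alpha> x) - c * of_real (coef \<beta> x)) \<le> norm c * \<delta>" for x
    using assms(1)[of x] by (simp add: norm_mult mult_left_mono flip: right_diff_distrib of_real_diff)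
  with assms(2) show ?thesis by (auto simp: bounded_coef_def intro: order_trans)
qed

text \<open>The data of the two weak problems differ by at most |\<kappa>| \<delta>, and the
  operators by at most |\<kappa>| (1 + |\<kappa>|^2) \<delta> in norm. The factor |\<kappa>| B / c0
  bounds the solution for the unprimed coefficients, and c0 is a coercivity constant valid for both
  operators.\<close>

lemma resolvent_difference_bound:
  fixes v \<rho> v' \<rho>' :: "nat \<Rightarrow> real"
  defines "\<delta> \<equiv> (\<Sum>l\<in>{1..n}. \<bar>1 / \<rho>' l - 1 / \<rho> l\<bar>) + (\<Sum>l\<in>{1..n}. \<bar>1 / (\<rho>' l * (v' l)\<^sup>2) - 1 / (\<rho> l * (v l)\<^sup>2)\<bar>)"
  assumes pos: "\<And>l. l \<in> {1..n} \<Longrightarrow> v l > 0 \<and> \<rho> l > 0" and pos': "\<And>l. l \<in> {1..n} \<Longrightarrow> v' l > 0 \<and> \<rho>' l > 0"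
    and \<kappa>: "Im \<kappa> > 0" and m: "0 < m" "m \<le> 1"
    and le: "\<And>l. l \<in> {1..n} \<Longrightarrow> m \<le> 1 / \<rho> l" "\<And>l. l \<in> {1..n} \<Longrightarrow> m \<le> 1 / (\<rho> l * (v l)\<^sup>2)"
    and le': "\<And>l. l \<in> {1..n} \<Longrightarrow> m \<le> 1 / \<rho>' l" "\<And>l. l \<in> {1..n} \<Longrightarrow> m \<le> 1 / (\<rho>' l * (v' l)\<^sup>2)"
    and B: "\<And>x. \<bar>mass_coef v \<rho> x\<bar> \<le> B"
    and c0: "c0 = Im \<kappa> * m * min 1 ((norm \<kappa>)\<^sup>2)"
    and f: "L2_on UNIV f" "L2norm f \<le> 1"
  shows "L2norm (\<lambda>x. acoustic_resolvent n Om v' \<rho>' \<kappa> f x - acoustic_resolvent n Om v \<rho> \<kappa> f x)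
    \<le> (norm \<kappa> + norm \<kappa> * (1 + (norm \<kappa>)\<^sup>2) * (norm \<kappa> * B / c0)) / c0 * \<delta>"
proof -
  let ?R = "acoustic_resolvent n Om v \<rho> \<kappa> f" and ?R' = "acoustic_resolvent n Om v' \<rho>' \<kappa> f"
  let ?f = "\<lambda>x. (f x, \<chi> i::3. (0::complex))"
  let ?F = "l2_of ?f"
  let ?a = "flux_coef \<rho>" and ?b = "mass_coef v \<rho>"
  let ?a' = "flux_coef \<rho>'" and ?b' = "mass_coef v' \<rho>'"
  define c where "c = \<i> * cnj \<kappa>"
  have nc: "norm c = norm \<kappa>" by (simp add: c_def norm_mult)
  have "\<kappa> \<noteq> 0" using \<kappa> by auto
  then have c0pos: "c0 > 0" using \<kappa> m by (simp add: c0)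
  have \<delta>0: "0 \<le> \<delta>" unfolding \<delta>_def by (intro add_nonneg_nonneg sum_nonneg) auto
  have B0: "0 \<le> B" using B[of 0] by linarith
  have ad: "\<bar>?a' x - ?a x\<bar> \<le> \<delta>" and bd: "\<bar>?b' x - ?b x\<bar> \<le> \<delta>" for x
    unfolding \<delta>_def by (rule order_trans[OF coef_diff_le], simp add: sum_nonneg)+
  have f': "sq_integrable f" using f(1) by (simp add: L2_on_UNIV_iff)
  have jf: "sq_integrable ?f" by (rule sq_integrable_jetI[OF f' sq_integrable_zero])
  have nf: "norm ?F \<le> 1"
    using f(2) unfolding norm_l2_of[OF jf] by (simp add: L2norm_def norm_jet_squared)
  obtain g where u: "sq_integrable ?R" and g: "\<And>i. sq_integrable (g i)"
    and sol: "solves \<kappa> v \<rho> f (l2_of (mk_jet ?R g))"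
    using acoustic_resolvent_solves[of v \<rho> \<kappa> f] pos \<kappa> f' by blast
  obtain g' where u': "sq_integrable ?R'" and g': "\<And>i. sq_integrable (g' i)"
    and sol': "solves \<kappa> v' \<rho>' f (l2_of (mk_jet ?R' g'))"
    using acoustic_resolvent_solves[of v' \<rho>' \<kappa> f] pos' \<kappa> f' by blast
  define U where "U x = (?R x, \<chi> i. g i x)" for x
  define U' where "U' x = (?R' x, \<chi> i. g' i x)" for x
  have U: "sq_integrable U" "sq_integrable U'"
    unfolding U_def U'_def by (rule sq_integrable_jetI[OF u g] sq_integrable_jetI[OF u' g'])+
  define F where "F = l2_of U"
  define F' where "F' = l2_of U'"
  have sF: "solves \<kappa> v \<rho> f F" "solves \<kappa> v' \<rho>' f F'" using sol sol' by (simp_all add: F_def F'_def U_def[abs_def] U'_def[abs_def])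
  then have FS: "F \<in> sobolev" "F' \<in> sobolev" "F' - F \<in> sobolev"
    by (auto simp: solves_def intro: subspace_diff[OF subspace_sobolev])
  obtain C where C: "0 \<le> C" "bounded_coef C (\<lambda>x. c * (- \<kappa>\<^sup>2) * of_real (?b x))"
    "bounded_coef C (\<lambda>x. c * of_real (?a x))" "bounded_coef C (\<lambda>x. c * of_real (?b x))"
    unfolding c_def by (rule form_coefficients_bounded)
  obtain C' where C': "0 \<le> C'" "bounded_coef C' (\<lambda>x. c * (- \<kappa>\<^sup>2) * of_real (?b' x))"
    "bounded_coef C' (\<lambda>x. c * of_real (?a' x))" "bounded_coef C' (\<lambda>x. c * of_real (?b' x))"
    unfolding c_def by (rule form_coefficients_bounded)
  have rhs: "norm (form_rhs \<kappa> v \<rho> f) \<le> norm \<kappa> * B"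
  proof -
    have "norm (form_rhs \<kappa> v \<rho> f) \<le> (norm c * B) * norm ?F"
      unfolding form_rhs_def c_def[symmetric]
      by (intro norm_diag_mult_le bounded_coef_coef B bounded_coef_zero) (simp add: B0)
    also have "\<dots> \<le> (norm c * B) * 1" using nf B0 by (intro mult_left_mono) auto
    finally show ?thesis by (simp add: nc)
  qed
  have nF: "norm F \<le> norm \<kappa> * B / c0"
  proof -
    \<comment> \<open>Comparison with the zero solution for zero data turns the stability lemma into
      an a priori bound.\<close>
    have "c0 * norm (F - 0) \<le> norm (form_rhs \<kappa> v \<rho> f - 0) + norm (form_operator \<kappa> v \<rho> 0 - form_operator \<kappa> v \<rho> 0)"
    proof (rule coercive_solution_difference[OF c0pos _ bounded_linear_form_operator])
      show "c0 * (norm (F - 0))\<^sup>2 \<le> inner (form_operator \<kappa> v \<rho> (F - 0)) (F - 0)"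
        unfolding c0 using \<kappa> m le by (rule form_operator_coercive)
      show "inner (form_operator \<kappa> v \<rho> 0 - 0) (F - 0) = 0"
        by (simp add: linear_0[OF bounded_linear.linear[OF bounded_linear_form_operator]])
      show "inner (form_operator \<kappa> v \<rho> F - form_rhs \<kappa> v \<rho> f) (F - 0) = 0" using sF(1) FS by (simp add: solves_def)
    qed
    then show ?thesis using rhs c0pos by (simp add: field_simps)
  qed
  have drhs: "norm (form_rhs \<kappa> v' \<rho>' f - form_rhs \<kappa> v \<rho> f) \<le> norm \<kappa> * \<delta>"
  proof -
    have "form_rhs \<kappa> v' \<rho>' f - form_rhs \<kappa> v \<rho> f
        = diag_mult (\<lambda>x. c * of_real (?b' x) - c * of_real (?b x)) (\<lambda>x. 0 - 0) ?F"
      unfolding form_rhs_def c_def[symmetric]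
      by (rule diag_mult_diff[OF C(4) bounded_coef_zero[OF C(1)] C'(4) bounded_coef_zero[OF C'(1)]])
    also have "norm \<dots> \<le> (norm c * \<delta>) * norm ?F"
    proof (rule norm_diag_mult_le)
      show "bounded_coef (norm c * \<delta>) (\<lambda>x. c * of_real (?b' x) - c * of_real (?b x))"
        by (rule bounded_coef_diff[OF bd order_refl])
      show "bounded_coef (norm c * \<delta>) (\<lambda>x. 0 - 0)" using \<delta>0 by (simp add: bounded_coef_def)
    qed
    also have "\<dots> \<le> (norm c * \<delta>) * 1" using nf \<delta>0 by (intro mult_left_mono) auto
    finally show ?thesis by (simp add: nc)
  qed
  have dop: "norm (form_operator \<kappa> v' \<rho>' F - form_operator \<kappa> v \<rho> F) \<le> norm \<kappa> * (1 + (norm \<kappa>)\<^sup>2) * \<delta> * norm F"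
  proof -
    have "form_operator \<kappa> v' \<rho>' F - form_operator \<kappa> v \<rho> F
        = diag_mult (\<lambda>x. c * (- \<kappa>\<^sup>2) * of_real (?b' x) - c * (- \<kappa>\<^sup>2) * of_real (?b x))
            (\<lambda>x. c * of_real (?a' x) - c * of_real (?a x)) F"
      unfolding form_operator_def c_def[symmetric] by (rule diag_mult_diff[OF C(2,3) C'(2,3)])
    also have "norm \<dots> \<le> norm \<kappa> * (1 + (norm \<kappa>)\<^sup>2) * \<delta> * norm F"
    proof (intro norm_diag_mult_le bounded_coef_diff[where \<delta>=\<delta>] bd ad)
      \<comment> \<open>The rotated mass and flux multipliers change by at most |\<kappa>|^3
        \<delta> and |\<kappa>| \<delta>; their sum bounds both.\<close>
      show "norm (c * (- \<kappa>\<^sup>2)) * \<delta> \<le> norm \<kappa> * (1 + (norm \<kappa>)\<^sup>2) * \<delta>" "norm c * \<delta> \<le> norm \<kappa> * (1 + (norm \<kappa>)\<^sup>2) * \<delta>"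
        using \<delta>0 by (auto simp: norm_mult nc norm_power distrib_left intro!: mult_right_mono)
    qed
    finally show ?thesis .
  qed
  have "c0 * norm (F' - F) \<le> norm (form_rhs \<kappa> v' \<rho>' f - form_rhs \<kappa> v \<rho> f)
      + norm (form_operator \<kappa> v' \<rho>' F - form_operator \<kappa> v \<rho> F)"
  proof (rule coercive_solution_difference[OF c0pos _ bounded_linear_form_operator])
    show "c0 * (norm (F' - F))\<^sup>2 \<le> inner (form_operator \<kappa> v' \<rho>' (F' - F)) (F' - F)"
      unfolding c0 using \<kappa> m le' by (rule form_operator_coercive)
  qed (use sF FS in \<open>auto simp: solves_def\<close>)
  also have "\<dots> \<le> norm \<kappa> * \<delta> + norm \<kappa> * (1 + (norm \<kappa>)\<^sup>2) * \<delta> * (norm \<kappa> * B / c0)"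
    using \<delta>0 nF by (intro add_mono drhs order_trans[OF dop] mult_left_mono) auto
  also have "\<dots> = (norm \<kappa> + norm \<kappa> * (1 + (norm \<kappa>)\<^sup>2) * (norm \<kappa> * B / c0)) * \<delta>" by (simp add: algebra_simps)
  finally have main: "norm (F' - F) \<le> (norm \<kappa> + norm \<kappa> * (1 + (norm \<kappa>)\<^sup>2) * (norm \<kappa> * B / c0)) / c0 * \<delta>"
    using c0pos by (simp add: field_simps)
  have "L2norm (\<lambda>x. ?R' x - ?R x)
      = norm (l2_of (\<lambda>x. ?R' x - ?R x))"
    by (simp add: L2norm_def norm_l2_of sq_integrable_diff[OF u' u])
  \<comment> \<open>The norm of the first component is dominated by that of the whole jet, so an H^1
    estimate implies the L^2 estimate.\<close>
  also have "\<dots> \<le> 1 * norm (l2_of (\<lambda>x. U' x - U x))"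
  proof (rule norm_l2_mono[OF sq_integrable_diff[OF u' u] sq_integrable_diff[OF U(2,1)]])
    show "AE x in lebesgue. norm (?R' x - ?R x) \<le> 1 * norm (U' x - U x)"
      using norm_fst_le[of "?R' _ - ?R _"]
      by (auto simp: U_def U'_def)
  qed simp
  also have "\<dots> = norm (F' - F)" by (simp add: F_def F'_def l2_of_diff U)
  finally show ?thesis using main by simp
qed

end

theorem mainTheorem9:
  fixes n :: nat and Om :: "nat \<Rightarrow> pt set"
    and v \<rho> :: "nat \<Rightarrow> real" and vj \<rho>j :: "nat \<Rightarrow> nat \<Rightarrow> real"
  assumes doms: "\<forall>l\<in>{1..n}. open (Om l) \<and> bounded (Om l) \<and> connected (Om l) \<and> lipschitz_domain (Om l)"
    and disj: "\<forall>l\<in>{1..n}. \<forall>k\<in>{1..n}. l \<noteq> k \<longrightarrow> closure (Om l) \<inter> closure (Om k) = {}"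
    and pos: "\<forall>l\<in>{1..n}. v l > 0 \<and> \<rho> l > 0"
    and posj: "\<forall>j\<ge>1. \<forall>l\<in>{1..n}. vj j l > 0 \<and> \<rho>j j l > 0"
    and conv: "\<forall>l\<in>{1..n}. (\<lambda>j. vj j l) \<longlonglongrightarrow> v l \<and> (\<lambda>j. \<rho>j j l) \<longlonglongrightarrow> \<rho> l"
  shows "\<forall>\<kappa>::complex. Im \<kappa> > 0 \<longrightarrow>
     (\<lambda>j. L2_opnorm_diff (acoustic_resolvent n Om (vj j) (\<rho>j j) \<kappa>)
                         (acoustic_resolvent n Om v \<rho> \<kappa>)) \<longlonglongrightarrow> 0"
proof (intro allI impI)
  fix \<kappa> :: complex assume \<kappa>: "Im \<kappa> > 0"
  interpret disjoint_domains n Om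
    using doms disj by unfold_locales (auto intro: lipschitz_domain_frontier_negligible)
  define \<alpha> where "\<alpha> l = 1 / \<rho> l" for l
  define \<beta> where "\<beta> l = 1 / (\<rho> l * (v l)\<^sup>2)" for l
  define \<alpha>j where "\<alpha>j j l = 1 / \<rho>j j l" for j l
  define \<beta>j where "\<beta>j j l = 1 / (\<rho>j j l * (vj j l)\<^sup>2)" for j l
  have \<alpha>pos: "\<alpha> l > 0" and \<beta>pos: "\<beta> l > 0" if "l \<in> {1..n}" for l
    using coefficients_positive[of v \<rho> l] pos that by (auto simp: \<alpha>_def \<beta>_def)
  have \<alpha>lim: "(\<lambda>j. \<alpha>j j l) \<longlonglongrightarrow> \<alpha> l" and \<beta>lim: "(\<lambda>j. \<beta>j j l) \<longlonglongrightarrow> \<beta> l" if l: "l \<in> {1..n}" for l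
  proof -
    have "\<rho> l \<noteq> 0" "v l \<noteq> 0" "(\<lambda>j. vj j l) \<longlonglongrightarrow> v l" "(\<lambda>j. \<rho>j j l) \<longlonglongrightarrow> \<rho> l" using pos conv l by force+
    then show "(\<lambda>j. \<alpha>j j l) \<longlonglongrightarrow> \<alpha> l" "(\<lambda>j. \<beta>j j l) \<longlonglongrightarrow> \<beta> l"
      unfolding \<alpha>_def \<beta>_def \<alpha>j_def \<beta>j_def by (auto intro!: tendsto_intros)
  qed
  \<comment> \<open>The halves leave room: for large j the perturbed coefficients still exceed
    \<open>m\<close>, so one coercivity constant serves them all.\<close>
  obtain m where m: "0 < m" "m \<le> 1" "\<And>l. l \<in> {1..n} \<Longrightarrow> m \<le> \<alpha> l / 2" "\<And>l. l \<in> {1..n} \<Longrightarrow> m \<le> \<beta> l / 2"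
    using positive_lower_bound[of "\<lambda>l. \<alpha> l / 2" "\<lambda>l. \<beta> l / 2"] \<alpha>pos \<beta>pos by (metis half_gt_zero)
  obtain B where B: "\<And>x. \<bar>coef \<beta> x\<bar> \<le> B" using coef_bounded by blast
  define c0 where "c0 = Im \<kappa> * m * min 1 ((norm \<kappa>)\<^sup>2)"
  \<comment> \<open>Independent of \<open>f\<close> and of j, so the bound survives the supremum
    defining the operator norm.\<close>
  define K where "K = (norm \<kappa> + norm \<kappa> * (1 + (norm \<kappa>)\<^sup>2) * (norm \<kappa> * B / c0)) / c0"
  define \<delta> where "\<delta> j = (\<Sum>l\<in>{1..n}. \<bar>\<alpha>j j l - \<alpha> l\<bar>) + (\<Sum>l\<in>{1..n}. \<bar>\<beta>j j l - \<beta> l\<bar>)" for j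
  have "(\<lambda>j. K * \<delta> j) \<longlonglongrightarrow> K * ((\<Sum>l\<in>{1..n}. \<bar>\<alpha> l - \<alpha> l\<bar>) + (\<Sum>l\<in>{1..n}. \<bar>\<beta> l - \<beta> l\<bar>))"
    unfolding \<delta>_def by (intro tendsto_intros \<alpha>lim \<beta>lim)
  then have K\<delta>: "(\<lambda>j. ennreal (K * \<delta> j)) \<longlonglongrightarrow> ennreal 0" by (intro tendsto_ennrealI) simp
  have "\<forall>\<^sub>F j in sequentially. \<forall>l\<in>{1..n}. \<alpha> l / 2 < \<alpha>j j l \<and> \<beta> l / 2 < \<beta>j j l"
  proof (intro eventually_ball_finite ballI eventually_conj)
    fix l assume l: "l \<in> {1..n}"
    show "\<forall>\<^sub>F j in sequentially. \<alpha> l / 2 < \<alpha>j j l" by (rule order_tendstoD(1)[OF \<alpha>lim[OF l]]) (use \<alpha>pos[OF l] in simp)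
    show "\<forall>\<^sub>F j in sequentially. \<beta> l / 2 < \<beta>j j l" by (rule order_tendstoD(1)[OF \<beta>lim[OF l]]) (use \<beta>pos[OF l] in simp)
  qed simp
  then have ev: "\<forall>\<^sub>F j in sequentially. L2_opnorm_diff (acoustic_resolvent n Om (vj j) (\<rho>j j) \<kappa>)
      (acoustic_resolvent n Om v \<rho> \<kappa>) \<le> ennreal (K * \<delta> j)"
    \<comment> \<open>Positivity of the perturbed coefficients is given from index 1 on, whereas the
      sequences start at 0.\<close>
    using eventually_ge_at_top[of 1]
  proof eventually_elim
    case (elim j)
    have lower: "m \<le> \<alpha> l" "m \<le> \<beta> l" "m \<le> \<alpha>j j l" "m \<le> \<beta>j j l" if "l \<in> {1..n}" for l
      using m(3,4)[OF that] \<alpha>pos[OF that] \<beta>pos[OF that] elim(1) that by force+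
    show ?case unfolding L2_opnorm_diff_def
    proof (rule SUP_least)
      fix f assume "f \<in> {f. L2_on UNIV f \<and> L2norm f \<le> 1}"
      then have f: "L2_on UNIV f" "L2norm f \<le> 1" by auto
      have "L2norm (\<lambda>x. acoustic_resolvent n Om (vj j) (\<rho>j j) \<kappa> f x - acoustic_resolvent n Om v \<rho> \<kappa> f x) \<le> K * \<delta> j"
        unfolding K_def \<delta>_def \<alpha>_def \<beta>_def \<alpha>j_def \<beta>j_def
        by (rule resolvent_difference_bound[where m=m])
           (use pos posj elim(2) \<kappa> m(1,2) lower B f in \<open>auto simp: c0_def \<alpha>_def \<beta>_def[abs_def] \<alpha>j_def \<beta>j_def\<close>)
      then show "ennreal (L2norm (\<lambda>x. acoustic_resolvent n Om (vj j) (\<rho>j j) \<kappa> f x - acoustic_resolvent n Om v \<rho> \<kappa> f x))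
          \<le> ennreal (K * \<delta> j)" by (rule ennreal_leI)
    qed
  qed
  show "(\<lambda>j. L2_opnorm_diff (acoustic_resolvent n Om (vj j) (\<rho>j j) \<kappa>) (acoustic_resolvent n Om v \<rho> \<kappa>)) \<longlonglongrightarrow> 0"
  proof (rule tendsto_sandwich[OF _ ev tendsto_const])
    show "(\<lambda>j. ennreal (K * \<delta> j)) \<longlonglongrightarrow> 0" using K\<delta> by simp
  qed simp
qed

end
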